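(* Let $n\ge1$ and $\varepsilon\in\{0,1\}$. There is a constant $C>0$ such that for any multi-index $\nu$ with $|\nu|=3$ and any $F\in\mathscr S(\mathbb{R}\times\mathbb{R}^n)$, the solution $u(t,x)$ of the Cauchy problem $$i\partial_tu=\Delta^2u-\varepsilon\Delta u+F(t,x),\quad t\in\mathbb{R},\ x\in\mathbb{R}^n,\qquad u(0,x)=0,$$ satisfies $$\sup_{\alpha\in\mathbb{Z}^n}\|D^\nu u\|_{L^2_{t,x}(\mathbb{R}\times Q_\alpha)}\le C\sum_{\alpha\in\mathbb{Z}^n}\|F\|_{L^2_{t,x}(\mathbb{R}\times Q_\alpha)}.$$
   Context: $D^\nu=\partial_x^\nu$ is the spatial derivative; $\mathscr S$ is the Schwartz space; $Q_\alpha=\alpha+[-1/2,1/2)^n$ for $\alpha\in\mathbb{Z}^n$. *)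

theory Defs
  imports "HOL-Analysis.Analysis"
begin

definition dir_deriv :: "'a::real_normed_vector \<Rightarrow> ('a \<Rightarrow> complex) \<Rightarrow> 'a \<Rightarrow> complex" where
  "dir_deriv b f z = vector_derivative (\<lambda>s. f (z + s *\<^sub>R b)) (at 0)"

definition iter_deriv :: "'a::real_normed_vector list \<Rightarrow> ('a \<Rightarrow> complex) \<Rightarrow> 'a \<Rightarrow> complex" where
  "iter_deriv bs f = foldr dir_deriv bs f"

text \<open>
  \<open>C\<^sup>\<infinity>\<close>: every iterated partial derivative, of every order, is (Frechet) differentiable.
\<close>

definition smooth :: "('a::euclidean_space \<Rightarrow> complex) \<Rightarrow> bool" where
  "smooth f \<longleftrightarrow> (\<forall>bs. set bs \<subseteq> Basis \<longrightarrow> (\<forall>z. iter_deriv bs f differentiable (at z)))"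

definition schwartz :: "('a::euclidean_space \<Rightarrow> complex) \<Rightarrow> bool" where
  "schwartz f \<longleftrightarrow> smooth f \<and>
     (\<forall>bs k. set bs \<subseteq> Basis \<longrightarrow> (\<exists>B. \<forall>z. norm z ^ k * cmod (iter_deriv bs f z) \<le> B))"

text \<open>Functions of \<open>(t, x)\<close> live on \<open>real \<times> (real ^ 'n)\<close>.\<close>

abbreviation time_dir :: "real \<times> (real ^ 'n)" where
  "time_dir \<equiv> (1, 0)"

abbreviation space_dir :: "'n::finite \<Rightarrow> real \<times> (real ^ 'n)" where
  "space_dir i \<equiv> (0, axis i 1)"

definition laplacian_x :: "(real \<times> (real ^ 'n::finite) \<Rightarrow> complex) \<Rightarrow> real \<times> (real ^ 'n) \<Rightarrow> complex" where
  "laplacian_x u z = (\<Sum>i\<in>UNIV. dir_deriv (space_dir i) (dir_deriv (space_dir i) u) z)"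

text \<open>
  A multi-index is a function \<open>\<nu> :: 'n \<Rightarrow> nat\<close>, of order \<open>\<Sum>i\<in>UNIV. \<nu> i\<close>. The partial
  derivatives are taken in some order in which the \<open>i\<close>-th one occurs \<open>\<nu> i\<close> times; for
  smooth functions the order is irrelevant.
\<close>

definition spatial_deriv ::
  "('n::finite \<Rightarrow> nat) \<Rightarrow> (real \<times> (real ^ 'n) \<Rightarrow> complex) \<Rightarrow> real \<times> (real ^ 'n) \<Rightarrow> complex" where
  "spatial_deriv \<nu> u =
     iter_deriv (map space_dir (SOME is. \<forall>i. count_list is i = \<nu> i)) u"

text \<open>
  \<open>u \<in> C\<^sup>\<infinity>(\<real>; \<S>(\<real>\<^sup>n))\<close>: Schwartz decay in \<open>x\<close> of all derivatives in \<open>(t, x)\<close>, locally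
  uniformly in \<open>t\<close>.
\<close>

definition smooth_in_time_schwartz_in_space :: "(real \<times> (real ^ 'n::finite) \<Rightarrow> complex) \<Rightarrow> bool" where
  "smooth_in_time_schwartz_in_space u \<longleftrightarrow> smooth u \<and>
     (\<forall>T bs k. set bs \<subseteq> Basis \<longrightarrow>
        (\<exists>B. \<forall>t x. \<bar>t\<bar> \<le> T \<longrightarrow> norm x ^ k * cmod (iter_deriv bs u (t, x)) \<le> B))"

text \<open>
  Some class has to be imposed for the solution to be unique. For a Schwartz right-hand side
  there is exactly one solution in \<open>C\<^sup>\<infinity>(\<real>; \<S>(\<real>\<^sup>n))\<close>, namely the one given by Duhamel's formula.
\<close>

definition cauchy_solution ::
  "real \<Rightarrow> (real \<times> (real ^ 'n::finite) \<Rightarrow> complex) \<Rightarrow> (real \<times> (real ^ 'n) \<Rightarrow> complex) \<Rightarrow> bool" where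
  "cauchy_solution \<epsilon> F u \<longleftrightarrow>
     smooth_in_time_schwartz_in_space u \<and>
     (\<forall>t x. \<i> * dir_deriv time_dir u (t, x) =
        laplacian_x (laplacian_x u) (t, x) - of_real \<epsilon> * laplacian_x u (t, x) + F (t, x)) \<and>
     (\<forall>x. u (0, x) = 0)"

definition unit_cube :: "int ^ 'n::finite \<Rightarrow> (real ^ 'n) set" where
  "unit_cube \<alpha> = {x. \<forall>i. x $ i - of_int (\<alpha> $ i) \<in> {-1/2..<1/2}}"

text \<open>The \<open>L\<^sup>2(A)\<close> norm with values in \<open>[0, \<infinity>]\<close>.\<close>

definition L2_norm_on :: "'a::euclidean_space set \<Rightarrow> ('a \<Rightarrow> complex) \<Rightarrow> ennreal" where
  "L2_norm_on A f =
     (let I = \<integral>\<^sup>+ z\<in>A. ennreal ((cmod (f z))\<^sup>2) \<partial>lborel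
      in if I = \<infinity> then \<infinity> else ennreal (sqrt (enn2real I)))"

end

theory Submission
  imports Defs "HOL-Probability.Probability"
begin

text \<open>
  Let \<open>w(\<xi>) = |\<xi>|\<^sup>4 + \<epsilon> |\<xi>|\<^sup>2\<close>. By causality and reversal in time it suffices to estimate \<open>u\<close> for positive (or negative)
  times with \<open>F\<close> cut off there. After damping by \<open>e\<^bsup>-\<delta>t\<^esup>\<close>, Duhamel's formula makes \<open>D\<^sup>\<nu> u\<close> the Fourier multiplier
  \<open>(i\<xi>)\<^sup>\<nu> / (\<delta> + i (\<tau> + w(\<xi>)))\<close> applied to \<open>F\<close>. Writing \<open>1 = \<Sum>\<^sub>j \<xi>\<^sub>j\<^sup>2 / |\<xi>|\<^sup>2\<close>, fix \<open>j\<close> and regard the \<open>j\<close>-th piece as a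
  function of \<open>\<eta> = \<xi>\<^sub>j\<close> alone. With \<open>r\<^sup>2 = |\<xi>|\<^sup>2 - \<eta>\<^sup>2\<close> the denominator factors as \<open>(\<eta>\<^sup>2 + k\<^sub>1\<^sup>2) (\<eta>\<^sup>2 + k\<^sub>2\<^sup>2)\<close>, where
  \<open>Re k\<^sub>1 > 0\<close> and \<open>k\<^sub>2\<close> is elliptic (\<open>|k\<^sub>2| \<le> 2 Re k\<^sub>2\<close>, \<open>r \<le> |k\<^sub>2|\<close>), so the piece is the product of
  \<open>\<eta> / (\<eta>\<^sup>2 + k\<^sub>1\<^sup>2)\<close>, whose kernel is bounded, and of four factors of the form \<open>\<xi>\<^sub>i / (k \<plusminus> i\<eta>)\<close> with \<open>k \<in> {r, k\<^sub>2}\<close>, each the transform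
  of a measure of uniformly bounded mass. Hence it maps \<open>L\<^sup>1(dx\<^sub>j)\<close> to \<open>L\<^sup>\<infinity>(dx\<^sub>j)\<close> with values in \<open>L\<^sup>2\<close> of the
  remaining variables, and these two norms are controlled by the sum and the supremum over unit cubes.
\<close>


section \<open>The Fourier transform and Gaussian regularisation\<close>

text \<open>The obstacle is the root \<open>k1\<close>. As the damping is removed,
  \<open>Re k1\<close> may tend to 0, and the kernel exp(-k1 |y|) / (2 k1) of 1 / (\<eta>^2 + k1^2)
  is then bounded neither in mass nor in supremum. One factor \<eta> in the numerator repairs the
  supremum. The weight \<xi>_j^2 / |\<xi>|^2 supplies it even if the derivative contains no D_j; its
  second \<eta> and the three derivatives give four numerators for the four elliptic linear factors,
  which is why the order is 3. A bounded kernel maps only L^1 to L^\<infinity> in x_j, hence a sum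
  over cubes on one side and a supremum on the other. No constant depends on \<delta>. The estimate
  is run by duality against \<open>g\<close>, the derivative itself cut off to (0, T] times one
  cube: up to the factor e, for \<delta> = 1 / T, the pairing dominates the squared norm of
  \<open>g\<close>, and it is at most C times the sum over cubes times the norm of \<open>g\<close>.
  That norm is finite, so it cancels, and T tends to infinity. The vanishing initial value leaves no
  boundary term at t = 0, so each half-line can be treated alone.\<close>

lemma lborel_prod_Basis:
  fixes f :: "'a::euclidean_space \<Rightarrow> real \<Rightarrow> complex"
  assumes f: "\<And>b. b \<in> Basis \<Longrightarrow> integrable lborel (f b)"
  shows integrable_lborel_prod_Basis: "integrable lborel (\<lambda>x. \<Prod>b\<in>Basis. f b (x \<bullet> b))"
    and integral_lborel_prod_Basis:
      "(LINT x|lborel. (\<Prod>b\<in>Basis. f b (x \<bullet> b))) = (\<Prod>b\<in>Basis. LINT y|lborel. f b y)"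
proof -
  interpret product_sigma_finite "\<lambda>_::'a. lborel :: real measure"
    by standard
  let ?T = "\<lambda>g::'a \<Rightarrow> real. \<Sum>b\<in>Basis. g b *\<^sub>R b"
  let ?P = "Pi\<^sub>M Basis (\<lambda>_::'a. lborel :: real measure)"
  have fm: "\<And>b. b \<in> Basis \<Longrightarrow> f b \<in> borel_measurable borel"
    using f by auto
  have m: "?T \<in> ?P \<rightarrow>\<^sub>M borel" by simp
  have m2: "(\<lambda>x. \<Prod>b\<in>Basis. f b (x \<bullet> b)) \<in> borel_measurable borel"
    by (intro borel_measurable_prod measurable_compose[OF _ fm]) auto
  have eq: "(\<Prod>b\<in>Basis. f b (?T g \<bullet> b)) = (\<Prod>b\<in>Basis. f b (g b))" for g
    by (intro prod.cong refl) (simp add: inner_sum_left inner_Basis if_distrib cong: if_cong)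
  have "integrable ?P (\<lambda>g. \<Prod>b\<in>Basis. f b (g b))"
    by (rule product_integrable_prod) (auto simp: f)
  then show "integrable lborel (\<lambda>x. \<Prod>b\<in>Basis. f b (x \<bullet> b))"
    by (subst lborel_eq) (simp add: integrable_distr_eq[OF m m2] eq)
  have "(LINT g|?P. (\<Prod>b\<in>Basis. f b (g b))) = (\<Prod>b\<in>Basis. LINT y|lborel. f b y)"
    by (rule product_integral_prod) (auto simp: f)
  then show "(LINT x|lborel. (\<Prod>b\<in>Basis. f b (x \<bullet> b))) = (\<Prod>b\<in>Basis. LINT y|lborel. f b y)"
    by (subst lborel_eq) (simp add: integral_distr[OF m m2] eq)
qed

text \<open>Unnormalised convention: the powers of \<open>2 * pi\<close> sit in Bessel's inequality
  and in Parseval's identity, one factor per dimension.\<close>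

definition ft :: "('a::euclidean_space \<Rightarrow> complex) \<Rightarrow> 'a \<Rightarrow> complex" where
  "ft f \<xi> = (LINT x|lborel. cis (- (x \<bullet> \<xi>)) * f x)"

text \<open>The Fourier integral of exp(-h^2 |x|^2 / 2), see \<open>fourier_gauss\<close>. Its mass
  is \<open>(2 * pi) ^ DIM('a)\<close> for every \<open>h > 0\<close> and concentrates at 0 as
  \<open>h\<close> tends to 0, so it is that constant times an approximate identity.\<close>

definition gauss_kernel :: "real \<Rightarrow> 'a::euclidean_space \<Rightarrow> real" where
  "gauss_kernel h v = (sqrt (2 * pi) / h) ^ DIM('a) * exp (- ((norm v / h)\<^sup>2 / 2))"

lemma borel_measurable_cis [measurable]: "cis \<in> borel_measurable borel"
  by (intro borel_measurable_continuous_onI continuous_intros)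

lemma cnj_borel_measurable [measurable]: "cnj \<in> borel_measurable borel"
  by (intro borel_measurable_continuous_onI continuous_intros)

lemma integrable_cis_mult [simp]:
  fixes g :: "'a \<Rightarrow> real"
  assumes "integrable M f" "g \<in> borel_measurable M"
  shows "integrable M (\<lambda>x. cis (g x) * f x)"
proof (rule Bochner_Integration.integrable_bound[OF assms(1)])
  have [measurable]: "f \<in> borel_measurable M" "g \<in> borel_measurable M" using assms by auto
  show "(\<lambda>x. cis (g x) * f x) \<in> borel_measurable M" by measurable
qed (simp add: norm_mult)

text \<open>For \<open>h = 1\<close> this is the characteristic function of the standard normal
  distribution; rescaling gives the general case.\<close>

lemma gauss_1d:
  fixes h v :: real
  assumes h: "h > 0"
  shows integrable_gauss_1d: "integrable lborel (\<lambda>x. complex_of_real (exp (- ((h * x)\<^sup>2 / 2))))"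
    and fourier_gauss_1d: "(LINT x|lborel. cis (v * x) * complex_of_real (exp (- ((h * x)\<^sup>2 / 2)))) =
       complex_of_real (sqrt (2 * pi) / h * exp (- ((v / h)\<^sup>2 / 2)))"
proof -
  have D: "exp (- (x\<^sup>2 / 2)) = sqrt (2 * pi) * std_normal_density x" for x :: real
    by (simp add: std_normal_density_def)
  have "integrable lborel std_normal_density"
    using integrable_std_normal_moment[of 0] by simp
  then have i1: "integrable lborel (\<lambda>x::real. exp (- (x\<^sup>2 / 2)))"
    unfolding D by simp
  then have "integrable lborel (\<lambda>x. exp (- ((0 + h * x)\<^sup>2 / 2)))"
    using h by (intro lborel_integrable_real_affine) auto
  then show "integrable lborel (\<lambda>x. complex_of_real (exp (- ((h * x)\<^sup>2 / 2))))" by simp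
  have c: "(LINT x|lborel. cis (w * x) * complex_of_real (exp (- (x\<^sup>2 / 2)))) =
       complex_of_real (sqrt (2 * pi) * exp (- (w\<^sup>2 / 2)))" for w
  proof -
    have "complex_of_real (exp (- (w^2) / 2)) = char std_normal_distribution w"
      by (simp add: char_std_normal_distribution)
    also have "\<dots> = (LINT x|lborel. std_normal_density x *\<^sub>R cis (w * x))"
      unfolding char_def
      by (subst integral_density) (simp_all add: normal_density_nonneg cis_conv_exp)
    finally have A: "complex_of_real (exp (- (w^2) / 2)) = (LINT x|lborel. std_normal_density x *\<^sub>R cis (w * x))" .
    have "(LINT x|lborel. cis (w * x) * complex_of_real (exp (- (x\<^sup>2 / 2)))) =
       (LINT x|lborel. complex_of_real (sqrt (2 * pi)) * (std_normal_density x *\<^sub>R cis (w * x)))"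
      unfolding D by (rule Bochner_Integration.integral_cong) (simp_all only: scaleR_conv_of_real of_real_mult mult_ac)
    also have "\<dots> = complex_of_real (sqrt (2 * pi)) * (LINT x|lborel. std_normal_density x *\<^sub>R cis (w * x))"
      by (rule integral_mult_right_zero)
    finally show ?thesis unfolding A[symmetric] by simp
  qed
  have "(LINT x|lborel. cis (v / h * x) * complex_of_real (exp (- (x\<^sup>2 / 2)))) =
     h *\<^sub>R (LINT x|lborel. cis (v * x) * complex_of_real (exp (- ((h * x)\<^sup>2 / 2))))"
    using h by (subst lborel_integral_real_affine[of h _ 0]) auto
  then have "(LINT x|lborel. cis (v * x) * complex_of_real (exp (- ((h * x)\<^sup>2 / 2)))) = 
    inverse h *\<^sub>R complex_of_real (sqrt (2 * pi) * exp (- ((v / h)\<^sup>2 / 2)))"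
    using h unfolding c by (simp add: scaleR_conv_of_real)
  then show "(LINT x|lborel. cis (v * x) * complex_of_real (exp (- ((h * x)\<^sup>2 / 2)))) =
       complex_of_real (sqrt (2 * pi) / h * exp (- ((v / h)\<^sup>2 / 2)))"
    by (simp only: scaleR_conv_of_real divide_inverse of_real_mult mult.assoc mult.commute mult.left_commute)
qed

lemma exp_norm_prod_Basis:
  fixes x :: "'a::euclidean_space"
  shows "exp (- ((h * norm x)\<^sup>2 / 2)) = (\<Prod>b\<in>Basis. exp (- ((h * (x \<bullet> b))\<^sup>2 / 2)))"
proof -
  have "(norm x)\<^sup>2 = (\<Sum>b\<in>Basis. (x \<bullet> b)\<^sup>2)"
    unfolding power2_norm_eq_inner by (subst euclidean_inner) (simp add: power2_eq_square)
  then show ?thesis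
    unfolding exp_sum[OF finite_Basis, symmetric]
    by (simp add: power_mult_distrib sum_negf sum_divide_distrib sum_distrib_left)
qed

lemma cis_sum: "finite A \<Longrightarrow> cis (\<Sum>a\<in>A. f a) = (\<Prod>a\<in>A. cis (f a))"
  by (induction A rule: finite_induct) (auto simp: cis_mult[symmetric])

lemma gauss:
  fixes v :: "'a::euclidean_space"
  assumes h: "h > 0"
  shows integrable_gauss: "integrable lborel (\<lambda>x::'a. complex_of_real (exp (- ((h * norm x)\<^sup>2 / 2))))"
    and fourier_gauss: "(LINT x|lborel. cis (v \<bullet> x) * complex_of_real (exp (- ((h * norm x)\<^sup>2 / 2)))) =
       complex_of_real (gauss_kernel h v)"
proof -
  let ?f = "\<lambda>b y. cis ((v \<bullet> b) * y) * complex_of_real (exp (- ((h * y)\<^sup>2 / 2)))"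
  have i: "integrable lborel (?f b)" for b
    by (intro integrable_cis_mult gauss_1d h) simp
  have "integrable lborel (\<lambda>x::'a. \<Prod>b\<in>Basis. complex_of_real (exp (- ((h * (x \<bullet> b))\<^sup>2 / 2))))"
    by (rule integrable_lborel_prod_Basis[where f="\<lambda>b y. complex_of_real (exp (- ((h * y)\<^sup>2 / 2)))"])
      (rule gauss_1d h)+
  then show "integrable lborel (\<lambda>x::'a. complex_of_real (exp (- ((h * norm x)\<^sup>2 / 2))))"
    unfolding exp_norm_prod_Basis by simp
  have "(\<lambda>x. cis (v \<bullet> x) * complex_of_real (exp (- ((h * norm x)\<^sup>2 / 2)))) =
    (\<lambda>x. \<Prod>b\<in>Basis. ?f b (x \<bullet> b))"
    by (subst euclidean_inner) (simp add: exp_norm_prod_Basis prod.distrib cis_sum)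
  then have "(LINT x|lborel. cis (v \<bullet> x) * complex_of_real (exp (- ((h * norm x)\<^sup>2 / 2)))) =
    (\<Prod>b\<in>(Basis::'a set). complex_of_real (sqrt (2 * pi) / h * exp (- (((v \<bullet> b) / h)\<^sup>2 / 2))))"
    using integral_lborel_prod_Basis[of ?f, OF i] by (simp only: fourier_gauss_1d[OF h])
  also have "\<dots> = complex_of_real (gauss_kernel h v)"
    using exp_norm_prod_Basis[of "1/h" v]
    by (simp add: gauss_kernel_def prod.distrib prod_dividef power_divide)
  finally show "(LINT x|lborel. cis (v \<bullet> x) * complex_of_real (exp (- ((h * norm x)\<^sup>2 / 2)))) =
       complex_of_real (gauss_kernel h v)" .
qed

lemma gauss_kernel_nonneg: "h > 0 \<Longrightarrow> 0 \<le> gauss_kernel h v"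
  by (simp add: gauss_kernel_def)

lemma borel_measurable_gauss_kernel [measurable]: "gauss_kernel h \<in> borel_measurable borel"
  unfolding gauss_kernel_def by measurable

lemma gauss_kernel_integral:
  assumes h: "h > 0"
  shows integrable_gauss_kernel: "integrable lborel (gauss_kernel h :: 'a::euclidean_space \<Rightarrow> real)"
    and integral_gauss_kernel: "(LINT v|lborel. gauss_kernel h (v::'a)) = (2 * pi) ^ DIM('a)"
proof -
  have h': "1 / h > 0" using h by simp
  have e: "complex_of_real (gauss_kernel h v) =
     (sqrt (2 * pi) / h) ^ DIM('a) * complex_of_real (exp (- ((1 / h * norm v)\<^sup>2 / 2)))" for v :: 'a
    by (simp add: gauss_kernel_def)
  have "integrable lborel (\<lambda>v::'a. complex_of_real (gauss_kernel h v))"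
    unfolding e by (intro integrable_mult_right integrable_gauss h')
  then show "integrable lborel (gauss_kernel h :: 'a \<Rightarrow> real)"
    using complex_of_real_integrable_eq by blast
  have "complex_of_real (LINT v|lborel. gauss_kernel h (v::'a)) = (LINT v|lborel. complex_of_real (gauss_kernel h (v::'a)))"
    by simp
  also have "\<dots> = (sqrt (2 * pi) / h) ^ DIM('a) * complex_of_real (gauss_kernel (1 / h) (0::'a))"
    unfolding e using fourier_gauss[OF h', of "0::'a"] by simp
  also have "\<dots> = of_real ((sqrt (2 * pi) / h * (sqrt (2 * pi) * h)) ^ DIM('a))"
    by (subst power_mult_distrib) (simp add: gauss_kernel_def)
  also have "sqrt (2 * pi) / h * (sqrt (2 * pi) * h) = 2 * pi"
    using h by (simp add: field_simps)
  finally show "(LINT v|lborel. gauss_kernel h (v::'a)) = (2 * pi) ^ DIM('a)"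
    using of_real_eq_iff by blast
qed

section \<open>Auxiliary facts on Lebesgue integrals\<close>

lemma norm_integral_le_nn_integral:
  fixes f :: "'a \<Rightarrow> 'b::{banach, second_countable_topology}"
  shows "ennreal (norm (LINT x|M. f x)) \<le> (\<integral>\<^sup>+x. ennreal (norm (f x)) \<partial>M)"
proof (cases "integrable M f")
  case True
  then show ?thesis by (rule integral_norm_bound_ennreal)
qed (simp add: not_integrable_integral_eq)

lemma integrable_prod_mult:
  fixes f :: "'a \<Rightarrow> complex" and g :: "'b \<Rightarrow> complex"
  assumes "sigma_finite_measure M1" "sigma_finite_measure M2"
    and f: "integrable M1 f" and g: "integrable M2 g"
  shows "integrable (M1 \<Otimes>\<^sub>M M2) (\<lambda>(x, y). f x * g y)"
proof -
  interpret pair_sigma_finite M1 M2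
    using assms by (simp add: pair_sigma_finite_def)
  have [measurable]: "f \<in> borel_measurable M1" "g \<in> borel_measurable M2"
    using f g by auto
  show ?thesis
  proof (rule Fubini_integrable)
    show "AE x in M1. integrable M2 (\<lambda>y. case (x, y) of (x, y) \<Rightarrow> f x * g y)"
      using g by simp
    show "integrable M1 (\<lambda>x. LINT y|M2. norm (case (x, y) of (x, y) \<Rightarrow> f x * g y))"
      using f by (simp add: norm_mult)
  qed measurable
qed

text \<open>Fatou's lemma with a uniform bound. It removes every regularisation below: the Gaussian
  weight in \<open>bessel\<close>, the cut-off in time in \<open>half_space_estimate\<close>, and
  finite partial sums over cubes.\<close>

lemma nn_integral_le_of_tendsto:
  fixes u :: "nat \<Rightarrow> 'a \<Rightarrow> ennreal"
  assumes [measurable]: "\<And>m. u m \<in> borel_measurable M"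
    and lim: "\<And>x. (\<lambda>m. u m x) \<longlonglongrightarrow> v x" and le: "\<And>m. (\<integral>\<^sup>+x. u m x \<partial>M) \<le> B"
  shows "(\<integral>\<^sup>+x. v x \<partial>M) \<le> B"
proof -
  have "(\<integral>\<^sup>+x. v x \<partial>M) = (\<integral>\<^sup>+x. liminf (\<lambda>m. u m x) \<partial>M)"
    by (intro nn_integral_cong) (simp add: lim_imp_Liminf[OF _ lim])
  also have "\<dots> \<le> liminf (\<lambda>m. \<integral>\<^sup>+x. u m x \<partial>M)"
    by (rule nn_integral_liminf) simp
  also have "\<dots> \<le> liminf (\<lambda>m. B)"
    by (intro Liminf_mono always_eventually allI le)
  finally show ?thesis by (simp add: Liminf_const)
qed

lemma integrable_mult_of_squares:
  fixes a b :: "'a \<Rightarrow> complex"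
  assumes [measurable]: "a \<in> borel_measurable M" "b \<in> borel_measurable M"
    and a: "(\<integral>\<^sup>+x. ennreal ((cmod (a x))\<^sup>2) \<partial>M) < \<infinity>" and b: "(\<integral>\<^sup>+x. ennreal ((cmod (b x))\<^sup>2) \<partial>M) < \<infinity>"
  shows "integrable M (\<lambda>x. a x * b x)"
proof (rule integrableI_bounded)
  have "(\<integral>\<^sup>+x. ennreal (norm (a x * b x)) \<partial>M) \<le> (\<integral>\<^sup>+x. ennreal ((cmod (a x))\<^sup>2) + ennreal ((cmod (b x))\<^sup>2) \<partial>M)"
  proof (intro nn_integral_mono)
    fix x
    have "2 * cmod (a x) * cmod (b x) \<le> (cmod (a x))\<^sup>2 + (cmod (b x))\<^sup>2"
      by (rule sum_squares_bound)
    moreover have "0 \<le> cmod (a x) * cmod (b x)" by simp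
    ultimately have "cmod (a x * b x) \<le> (cmod (a x))\<^sup>2 + (cmod (b x))\<^sup>2"
      unfolding norm_mult by linarith
    then show "ennreal (norm (a x * b x)) \<le> ennreal ((cmod (a x))\<^sup>2) + ennreal ((cmod (b x))\<^sup>2)"
      by (simp add: ennreal_leI flip: ennreal_plus)
  qed
  also have "\<dots> = (\<integral>\<^sup>+x. ennreal ((cmod (a x))\<^sup>2) \<partial>M) + (\<integral>\<^sup>+x. ennreal ((cmod (b x))\<^sup>2) \<partial>M)"
    by (rule nn_integral_add) auto
  also have "\<dots> < \<infinity>" using a b by (simp add: less_top)
  finally show "(\<integral>\<^sup>+x. ennreal (norm (a x * b x)) \<partial>M) < \<infinity>" .
qed simp

lemma nn_integral_lborel_affine:
  fixes f :: "'a::euclidean_space \<Rightarrow> ennreal"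
  assumes [measurable]: "f \<in> borel_measurable borel" and c: "c \<noteq> 0"
  shows "(\<integral>\<^sup>+x. f x \<partial>lborel) = ennreal (\<bar>c\<bar> ^ DIM('a)) * (\<integral>\<^sup>+x. f (t + c *\<^sub>R x) \<partial>lborel)"
  by (subst lborel_affine[OF c, of t])
     (simp add: nn_integral_density nn_integral_distr nn_integral_cmult ennreal_power)

lemma integral_lborel_affine:
  fixes f :: "'a::euclidean_space \<Rightarrow> complex"
  assumes [measurable]: "f \<in> borel_measurable borel" and c: "c \<noteq> 0"
  shows "(LINT x|lborel. f x) = \<bar>c\<bar> ^ DIM('a) *\<^sub>R (LINT x|lborel. f (t + c *\<^sub>R x))"
  by (subst lborel_affine[OF c, of t])
     (simp add: integral_density integral_distr ennreal_power)

lemma integrable_lborel_affine: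
  fixes f :: "'a::euclidean_space \<Rightarrow> complex"
  assumes f: "integrable lborel f" and c: "c \<noteq> 0"
  shows "integrable lborel (\<lambda>x. f (t + c *\<^sub>R x))"
proof -
  have [measurable]: "f \<in> borel_measurable borel" using f by auto
  have "ennreal (\<bar>c\<bar> ^ DIM('a)) \<noteq> 0" using c by simp
  then show ?thesis
    using f unfolding integrable_iff_bounded
    by (subst (asm) nn_integral_lborel_affine[OF _ c, of _ t]) (auto simp: ennreal_mult_less_top)
qed

section \<open>Fourier transforms of integrable functions: Bessel and Parseval\<close>

lemma norm_ft_le: 
  assumes "integrable lborel f"
  shows "cmod (ft f \<xi>) \<le> (LINT x|lborel. cmod (f x))"
  unfolding ft_def by (rule order_trans[OF integral_norm_bound]) (simp add: norm_mult)

lemma borel_measurable_ft [measurable]: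
  assumes [measurable]: "f \<in> borel_measurable borel"
  shows "ft f \<in> borel_measurable borel"
  unfolding ft_def by measurable

lemma ft_mult_formula:
  fixes f P :: "'a::euclidean_space \<Rightarrow> complex"
  assumes f: "integrable lborel f" and P: "integrable lborel P"
  shows "(LINT \<xi>|lborel. P \<xi> * ft f \<xi>) = (LINT x|lborel. f x * ft P x)"
proof -
  have "integrable (lborel \<Otimes>\<^sub>M lborel) (\<lambda>z. cis (- (snd z \<bullet> fst z)) * (case z of (\<xi>, x) \<Rightarrow> P \<xi> * f x))"
    by (intro integrable_cis_mult integrable_prod_mult f P sigma_finite_lborel) measurable
  then have i: "integrable (lborel \<Otimes>\<^sub>M lborel) (\<lambda>(\<xi>, x). P \<xi> * (cis (- (x \<bullet> \<xi>)) * f x))"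
    by (simp add: case_prod_unfold mult.left_commute)
  have "(LINT \<xi>|lborel. P \<xi> * ft f \<xi>) = (LINT \<xi>|lborel. LINT x|lborel. P \<xi> * (cis (- (x \<bullet> \<xi>)) * f x))"
    unfolding ft_def by simp
  also have "\<dots> = (LINT x|lborel. LINT \<xi>|lborel. P \<xi> * (cis (- (x \<bullet> \<xi>)) * f x))"
    by (rule lborel_pair.Fubini_integral[OF i, symmetric])
  also have "\<dots> = (LINT x|lborel. LINT \<xi>|lborel. f x * (cis (- (\<xi> \<bullet> x)) * P \<xi>))"
    by (intro Bochner_Integration.integral_cong refl) (simp add: inner_commute)
  also have "\<dots> = (LINT x|lborel. f x * ft P x)"
    unfolding ft_def by simp
  finally show ?thesis .
qed

abbreviation gauss_weight :: "real \<Rightarrow> 'a::euclidean_space \<Rightarrow> complex" where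
  "gauss_weight h \<xi> \<equiv> complex_of_real (exp (- ((h * norm \<xi>)\<^sup>2 / 2)))"

lemma integrable_gauss_weight_mult:
  assumes h: "h > 0" and [measurable]: "f \<in> borel_measurable borel" and B: "\<And>\<xi>. cmod (f \<xi>) \<le> B"
  shows "integrable lborel (\<lambda>\<xi>. gauss_weight h \<xi> * f \<xi>)"
proof (rule Bochner_Integration.integrable_bound)
  show "integrable lborel (\<lambda>\<xi>. B * gauss_weight h \<xi>)"
    by (intro integrable_mult_right integrable_gauss h)
  show "AE \<xi> in lborel. norm (gauss_weight h \<xi> * f \<xi>) \<le> norm (B * gauss_weight h \<xi>)"
    using B by (auto simp: norm_mult mult.commute[of B] intro!: mult_left_mono order_trans[OF B] abs_ge_self)
qed simp

text \<open>For merely integrable \<open>f\<close> and \<open>g\<close> the product of the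
  transforms need not be integrable. The Gaussian weight makes it so, and the multiplication formula
  then moves both transforms back to physical space, where the weight becomes an approximate
  identity. Bessel, Parseval and \<open>ft_pairing_bounded\<close> all start from this
  identity.\<close>

lemma ft_gauss_regularised:
  fixes f g :: "'a::euclidean_space \<Rightarrow> complex"
  assumes h: "h > 0" and f: "integrable lborel f" and g: "integrable lborel g"
  shows "(LINT \<xi>|lborel. gauss_weight h \<xi> * (ft f \<xi> * cnj (ft g \<xi>))) =
    (LINT y|lborel. cnj (g y) * (LINT x|lborel. f x * of_real (gauss_kernel h (x - y))))"
proof -
  have [measurable]: "f \<in> borel_measurable borel" "g \<in> borel_measurable borel"
    using f g by auto
  define P where "P \<xi> = gauss_weight h \<xi> * ft f \<xi>" for \<xi>
  have P: "integrable lborel P"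
    unfolding P_def by (rule integrable_gauss_weight_mult[OF h _ norm_ft_le[OF f]]) measurable
  have ftP: "ft (\<lambda>\<xi>. cnj (P \<xi>)) y = cnj (LINT x|lborel. f x * of_real (gauss_kernel h (x - y)))" for y
  proof -
    have i: "integrable lborel (\<lambda>\<xi>. cis (\<xi> \<bullet> y) * gauss_weight h \<xi>)"
      by (intro integrable_cis_mult integrable_gauss h) simp
    have "ft (\<lambda>\<xi>. cnj (P \<xi>)) y = (LINT \<xi>|lborel. cnj ((cis (\<xi> \<bullet> y) * gauss_weight h \<xi>) * ft f \<xi>))"
      unfolding ft_def[of "\<lambda>\<xi>. cnj (P \<xi>)"]
      by (rule Bochner_Integration.integral_cong) (simp_all add: cis_cnj P_def mult.assoc)
    also have "\<dots> = cnj (LINT \<xi>|lborel. (cis (\<xi> \<bullet> y) * gauss_weight h \<xi>) * ft f \<xi>)"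
      by (rule Bochner_Integration.integral_cnj)
    also have "(LINT \<xi>|lborel. (cis (\<xi> \<bullet> y) * gauss_weight h \<xi>) * ft f \<xi>)
      = (LINT x|lborel. f x * ft (\<lambda>\<xi>. cis (\<xi> \<bullet> y) * gauss_weight h \<xi>) x)"
      by (rule ft_mult_formula[OF f i])
    also have "(\<lambda>x. ft (\<lambda>\<xi>. cis (\<xi> \<bullet> y) * gauss_weight h \<xi>) x) = (\<lambda>x. of_real (gauss_kernel h (x - y)))"
    proof
      fix x
      have "ft (\<lambda>\<xi>. cis (\<xi> \<bullet> y) * gauss_weight h \<xi>) x = (LINT \<xi>|lborel. cis ((y - x) \<bullet> \<xi>) * gauss_weight h \<xi>)"
        unfolding ft_def
        by (intro Bochner_Integration.integral_cong refl)
           (simp add: mult.assoc[symmetric] cis_mult inner_diff_left inner_commute[of _ x] inner_commute[of _ y])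
      also have "\<dots> = of_real (gauss_kernel h (y - x))"
        by (rule fourier_gauss[OF h])
      also have "gauss_kernel h (y - x) = gauss_kernel h (x - y)"
        by (simp add: gauss_kernel_def norm_minus_commute)
      finally show "ft (\<lambda>\<xi>. cis (\<xi> \<bullet> y) * gauss_weight h \<xi>) x = of_real (gauss_kernel h (x - y))" .
    qed
    finally show ?thesis .
  qed
  have "(LINT \<xi>|lborel. gauss_weight h \<xi> * (ft f \<xi> * cnj (ft g \<xi>))) = (LINT \<xi>|lborel. cnj (cnj (P \<xi>) * ft g \<xi>))"
    by (simp add: P_def mult.assoc)
  also have "\<dots> = cnj (LINT \<xi>|lborel. cnj (P \<xi>) * ft g \<xi>)"
    by (rule Bochner_Integration.integral_cnj)
  also have "(LINT \<xi>|lborel. cnj (P \<xi>) * ft g \<xi>) = (LINT y|lborel. g y * ft (\<lambda>\<xi>. cnj (P \<xi>)) y)"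
    using P by (intro ft_mult_formula g) simp
  also have "cnj \<dots> = (LINT y|lborel. cnj (g y * ft (\<lambda>\<xi>. cnj (P \<xi>)) y))"
    by (rule Bochner_Integration.integral_cnj[symmetric])
  finally show ?thesis by (simp add: ftP)
qed

lemma nn_integral_gauss_kernel_shift:
  fixes y :: "'a::euclidean_space"
  assumes h: "h > 0"
  shows "(\<integral>\<^sup>+x. ennreal (gauss_kernel h (x - y)) \<partial>lborel) = ennreal ((2 * pi) ^ DIM('a))"
proof -
  have "(\<integral>\<^sup>+x. ennreal (gauss_kernel h (x - y)) \<partial>lborel) = (\<integral>\<^sup>+x. ennreal (gauss_kernel h (x::'a)) \<partial>lborel)"
    by (subst nn_integral_lborel_affine[where c=1 and t=y]) auto
  also have "\<dots> = ennreal ((2 * pi) ^ DIM('a))"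
    using gauss_kernel_integral[OF h, where ?'a='a] gauss_kernel_nonneg[OF h]
    by (subst nn_integral_eq_integral) auto
  finally show ?thesis .
qed

text \<open>Schur's test: with \<open>g = f\<close> the right side of
  \<open>ft_gauss_regularised\<close> is a quadratic form whose kernel is symmetric, nonnegative and
  of constant mass \<open>(2 * pi) ^ DIM('a)\<close> in each variable.\<close>

lemma bessel_regularised:
  fixes f :: "'a::euclidean_space \<Rightarrow> complex"
  assumes h: "h > 0" and f: "integrable lborel f"
  shows "(\<integral>\<^sup>+\<xi>. ennreal (exp (- ((h * norm \<xi>)\<^sup>2 / 2)) * (cmod (ft f \<xi>))\<^sup>2) \<partial>lborel)
    \<le> ennreal ((2 * pi) ^ DIM('a)) * (\<integral>\<^sup>+x. ennreal ((cmod (f x))\<^sup>2) \<partial>lborel)"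
proof -
  have [measurable]: "f \<in> borel_measurable borel" using f by auto
  let ?g = "\<lambda>\<xi>. exp (- ((h * norm \<xi>)\<^sup>2 / 2)) * (cmod (ft f \<xi>))\<^sup>2"
  let ?C = "ennreal ((2 * pi) ^ DIM('a))"
  let ?N = "\<integral>\<^sup>+x. ennreal ((cmod (f x))\<^sup>2) \<partial>lborel"
  let ?G = "\<lambda>x y. ennreal (gauss_kernel h (x - y :: 'a))"
  have eq: "gauss_weight h \<xi> * (ft f \<xi> * cnj (ft f \<xi>)) = complex_of_real (?g \<xi>)" for \<xi>
    by (simp add: complex_norm_square[symmetric] flip: of_real_mult of_real_power)
  have "cmod (ft f \<xi> * cnj (ft f \<xi>)) \<le> (LINT x|lborel. cmod (f x)) * (LINT x|lborel. cmod (f x))" for \<xi>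
    using norm_ft_le[OF f, of \<xi>] by (simp add: norm_mult mult_mono)
  then have "integrable lborel (\<lambda>\<xi>. gauss_weight h \<xi> * (ft f \<xi> * cnj (ft f \<xi>)))"
    by (intro integrable_gauss_weight_mult[OF h]) auto
  then have i: "integrable lborel ?g"
    unfolding eq complex_of_real_integrable_eq .
  have "(\<integral>\<^sup>+\<xi>. ennreal (?g \<xi>) \<partial>lborel) = ennreal (LINT \<xi>|lborel. ?g \<xi>)"
    by (rule nn_integral_eq_integral[OF i]) simp
  also have "(LINT \<xi>|lborel. ?g \<xi>) = cmod (LINT \<xi>|lborel. gauss_weight h \<xi> * (ft f \<xi> * cnj (ft f \<xi>)))"
    by (simp only: eq integral_complex_of_real norm_of_real) (simp add: integral_nonneg_AE)
  also have "\<dots> = cmod (LINT y|lborel. cnj (f y) * (LINT x|lborel. f x * of_real (gauss_kernel h (x - y))))"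
    by (simp only: ft_gauss_regularised[OF h f f])
  also have "ennreal \<dots> \<le> (\<integral>\<^sup>+y. ennreal (cmod (cnj (f y) * (LINT x|lborel. f x * of_real (gauss_kernel h (x - y))))) \<partial>lborel)"
    by (rule norm_integral_le_nn_integral)
  also have "\<dots> \<le> (\<integral>\<^sup>+y. \<integral>\<^sup>+x. ennreal (cmod (f y)) * (ennreal (cmod (f x)) * ?G x y) \<partial>lborel \<partial>lborel)"
  proof (intro nn_integral_mono)
    fix y
    have "ennreal (cmod (LINT x|lborel. f x * of_real (gauss_kernel h (x - y)))) \<le>
       (\<integral>\<^sup>+x. ennreal (cmod (f x * of_real (gauss_kernel h (x - y)))) \<partial>lborel)"
      by (rule norm_integral_le_nn_integral)
    also have "\<dots> = (\<integral>\<^sup>+x. ennreal (cmod (f x)) * ?G x y \<partial>lborel)"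
      using gauss_kernel_nonneg[OF h, where ?'a='a]
      by (intro nn_integral_cong) (simp add: norm_mult ennreal_mult')
    finally show "ennreal (cmod (cnj (f y) * (LINT x|lborel. f x * of_real (gauss_kernel h (x - y))))) \<le>
      (\<integral>\<^sup>+x. ennreal (cmod (f y)) * (ennreal (cmod (f x)) * ?G x y) \<partial>lborel)"
      by (subst nn_integral_cmult) (auto simp: norm_mult ennreal_mult' intro!: mult_left_mono)
  qed
  \<comment> \<open>The elementary bound a b \<le> a^2 / 2 + b^2 / 2 leaves the kernel with only one
    factor depending on \<open>f\<close>, so the other variable can be integrated out.\<close>
  also have "\<dots> \<le> (\<integral>\<^sup>+y. \<integral>\<^sup>+x. (ennreal ((cmod (f y))\<^sup>2 / 2) * ?G x y + ennreal ((cmod (f x))\<^sup>2 / 2) * ?G x y) \<partial>lborel \<partial>lborel)"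
  proof (intro nn_integral_mono)
    fix x y
    have "cmod (f y) * cmod (f x) \<le> (cmod (f y))\<^sup>2 / 2 + (cmod (f x))\<^sup>2 / 2"
      using sum_squares_bound[of "cmod (f y)" "cmod (f x)"] by simp
    then have "ennreal (cmod (f y)) * ennreal (cmod (f x)) \<le> ennreal ((cmod (f y))\<^sup>2 / 2) + ennreal ((cmod (f x))\<^sup>2 / 2)"
      by (simp add: ennreal_leI flip: ennreal_plus ennreal_mult')
    then show "ennreal (cmod (f y)) * (ennreal (cmod (f x)) * ?G x y) \<le>
       ennreal ((cmod (f y))\<^sup>2 / 2) * ?G x y + ennreal ((cmod (f x))\<^sup>2 / 2) * ?G x y"
      unfolding mult.assoc[symmetric] distrib_right[symmetric] by (rule mult_right_mono) simp
  qed
  also have "\<dots> = (\<integral>\<^sup>+y. \<integral>\<^sup>+x. ennreal ((cmod (f y))\<^sup>2 / 2) * ?G x y \<partial>lborel \<partial>lborel)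
     + (\<integral>\<^sup>+y. \<integral>\<^sup>+x. ennreal ((cmod (f x))\<^sup>2 / 2) * ?G x y \<partial>lborel \<partial>lborel)"
    by (simp add: nn_integral_add)
  also have "(\<integral>\<^sup>+y. \<integral>\<^sup>+x. ennreal ((cmod (f x))\<^sup>2 / 2) * ?G x y \<partial>lborel \<partial>lborel) =
     (\<integral>\<^sup>+x. \<integral>\<^sup>+y. ennreal ((cmod (f x))\<^sup>2 / 2) * ?G y x \<partial>lborel \<partial>lborel)"
    by (subst lborel_pair.Fubini') (auto simp: gauss_kernel_def norm_minus_commute)
  also have "(\<integral>\<^sup>+y. \<integral>\<^sup>+x. ennreal ((cmod (f y))\<^sup>2 / 2) * ?G x y \<partial>lborel \<partial>lborel)
     = (\<integral>\<^sup>+y. ennreal ((cmod (f y))\<^sup>2 / 2) * ?C \<partial>lborel)"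
    by (simp add: nn_integral_cmult nn_integral_gauss_kernel_shift[OF h])
  also have "\<dots> + \<dots> = (\<integral>\<^sup>+y. ?C * ennreal ((cmod (f y))\<^sup>2) \<partial>lborel)"
  proof -
    have "ennreal ((cmod (f y))\<^sup>2 / 2) * ?C + ennreal ((cmod (f y))\<^sup>2 / 2) * ?C = ?C * ennreal ((cmod (f y))\<^sup>2)" for y
      unfolding distrib_right[symmetric] by (subst ennreal_plus[symmetric]) (simp_all add: mult.commute)
    then show ?thesis by (subst nn_integral_add[symmetric]) simp_all
  qed
  also have "\<dots> = ?C * ?N"
    by (rule nn_integral_cmult) simp
  finally show ?thesis .
qed

lemma gauss_weight_tendsto: "(\<lambda>m. exp (- ((1 / real (Suc m) * norm \<xi>)\<^sup>2 / 2))) \<longlonglongrightarrow> 1"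
proof -
  have "(\<lambda>m. exp (- ((1 / real (Suc m) * norm \<xi>)\<^sup>2 / 2))) \<longlonglongrightarrow> exp (- ((0 * norm \<xi>)\<^sup>2 / 2))"
    by (intro tendsto_exp tendsto_minus tendsto_divide tendsto_power tendsto_mult tendsto_const
        LIMSEQ_Suc[OF lim_1_over_n]) simp
  then show ?thesis by simp
qed

text \<open>Only the inequality is proved: the L^2 norms of transforms are always estimated from
  above, and for that Fatou's lemma suffices as the Gaussian weight tends to 1.\<close>

theorem bessel:
  fixes f :: "'a::euclidean_space \<Rightarrow> complex"
  assumes f: "integrable lborel f"
  shows "(\<integral>\<^sup>+\<xi>. ennreal ((cmod (ft f \<xi>))\<^sup>2) \<partial>lborel)
    \<le> ennreal ((2 * pi) ^ DIM('a)) * (\<integral>\<^sup>+x. ennreal ((cmod (f x))\<^sup>2) \<partial>lborel)"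
proof (rule nn_integral_le_of_tendsto)
  have [measurable]: "f \<in> borel_measurable borel" using f by auto
  show "(\<lambda>\<xi>. ennreal (exp (- ((1 / real (Suc m) * norm \<xi>)\<^sup>2 / 2)) * (cmod (ft f \<xi>))\<^sup>2)) \<in> borel_measurable lborel" for m
    by measurable
  show "(\<lambda>m. ennreal (exp (- ((1 / real (Suc m) * norm \<xi>)\<^sup>2 / 2)) * (cmod (ft f \<xi>))\<^sup>2)) \<longlonglongrightarrow> ennreal ((cmod (ft f \<xi>))\<^sup>2)" for \<xi>
    using tendsto_mult[OF gauss_weight_tendsto[of \<xi>] tendsto_const[of "(cmod (ft f \<xi>))\<^sup>2"]]
    by (intro tendsto_ennrealI) simp
qed (rule bessel_regularised[OF _ f], simp)

lemma ft_pairing_tendsto: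
  fixes f g :: "'a::euclidean_space \<Rightarrow> complex"
  assumes f: "integrable lborel f" and g: "integrable lborel g"
    and fg: "integrable lborel (\<lambda>\<xi>. ft f \<xi> * cnj (ft g \<xi>))"
  shows "(\<lambda>m. LINT y|lborel. cnj (g y) * (LINT x|lborel. f x * of_real (gauss_kernel (1 / real (Suc m)) (x - y))))
    \<longlonglongrightarrow> (LINT \<xi>|lborel. ft f \<xi> * cnj (ft g \<xi>))"
proof -
  have [measurable]: "f \<in> borel_measurable borel" "g \<in> borel_measurable borel" using f g by auto
  have "(\<lambda>m. LINT \<xi>|lborel. gauss_weight (1 / real (Suc m)) \<xi> * (ft f \<xi> * cnj (ft g \<xi>)))
     \<longlonglongrightarrow> (LINT \<xi>|lborel. ft f \<xi> * cnj (ft g \<xi>))"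
  proof (rule integral_dominated_convergence)
    show "integrable lborel (\<lambda>\<xi>. cmod (ft f \<xi> * cnj (ft g \<xi>)))" using fg by simp
    show "AE \<xi> in lborel. (\<lambda>m. gauss_weight (1 / real (Suc m)) \<xi> * (ft f \<xi> * cnj (ft g \<xi>))) \<longlonglongrightarrow> ft f \<xi> * cnj (ft g \<xi>)"
    proof (rule AE_I2)
      fix \<xi> :: 'a
      have "(\<lambda>m. gauss_weight (1 / real (Suc m)) \<xi>) \<longlonglongrightarrow> of_real 1"
        by (intro tendsto_of_real gauss_weight_tendsto)
      from tendsto_mult[OF this tendsto_const[of "ft f \<xi> * cnj (ft g \<xi>)"]]
      show "(\<lambda>m. gauss_weight (1 / real (Suc m)) \<xi> * (ft f \<xi> * cnj (ft g \<xi>))) \<longlonglongrightarrow> ft f \<xi> * cnj (ft g \<xi>)"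
        by simp
    qed
    show "AE \<xi> in lborel. norm (gauss_weight (1 / real (Suc m)) \<xi> * (ft f \<xi> * cnj (ft g \<xi>))) \<le> cmod (ft f \<xi> * cnj (ft g \<xi>))" for m
      by (rule AE_I2) (simp add: norm_mult mult_left_le_one_le)
  qed measurable
  then show ?thesis
    by (subst (asm) ft_gauss_regularised[OF _ f g]) simp_all
qed

lemma norm_gauss_average_le:
  fixes f :: "'a::euclidean_space \<Rightarrow> complex"
  assumes h: "h > 0" and f: "f \<in> borel_measurable borel" and B: "\<And>x. cmod (f x) \<le> B"
  shows "cmod (LINT x|lborel. f x * of_real (gauss_kernel h (x - y))) \<le> (2 * pi) ^ DIM('a) * B"
proof -
  have "0 \<le> B" using B[of undefined] norm_ge_zero order_trans by blast
  have "ennreal (cmod (LINT x|lborel. f x * of_real (gauss_kernel h (x - y)))) \<le>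
    (\<integral>\<^sup>+x. ennreal (cmod (f x * of_real (gauss_kernel h (x - y)))) \<partial>lborel)"
    by (rule norm_integral_le_nn_integral)
  also have "\<dots> \<le> (\<integral>\<^sup>+x. ennreal B * ennreal (gauss_kernel h (x - y)) \<partial>lborel)"
    using gauss_kernel_nonneg[OF h, where ?'a='a] \<open>0 \<le> B\<close>
    by (intro nn_integral_mono) (auto simp: norm_mult ennreal_mult[symmetric] intro!: mult_right_mono ennreal_leI B)
  also have "\<dots> = ennreal B * ennreal ((2 * pi) ^ DIM('a))"
    by (simp add: nn_integral_cmult nn_integral_gauss_kernel_shift[OF h])
  also have "\<dots> = ennreal ((2 * pi) ^ DIM('a) * B)"
    using \<open>0 \<le> B\<close> by (simp add: ennreal_mult mult.commute)
  finally show ?thesis using \<open>0 \<le> B\<close> by simp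
qed

text \<open>L^\<infinity>-L^1 duality read on the frequency side: the averages of \<open>f\<close>
  are bounded by its supremum, and the L^1 norm of \<open>f\<close> does not enter the constant.
  This is how a bounded kernel of uncontrolled mass is exploited in
  \<open>ft_pairing_resolvent\<close>.\<close>

lemma ft_pairing_bounded:
  fixes f g :: "'a::euclidean_space \<Rightarrow> complex"
  assumes f: "integrable lborel f" and g: "integrable lborel g"
    and fg: "integrable lborel (\<lambda>\<xi>. ft f \<xi> * cnj (ft g \<xi>))" and B: "\<And>x. cmod (f x) \<le> B"
  shows "cmod (LINT \<xi>|lborel. ft f \<xi> * cnj (ft g \<xi>)) \<le> (2 * pi) ^ DIM('a) * B * (LINT y|lborel. cmod (g y))"
proof (rule Lim_bounded[OF tendsto_norm[OF ft_pairing_tendsto[OF f g fg]]], intro allI impI)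
  fix m
  let ?F = "\<lambda>y. LINT x|lborel. f x * of_real (gauss_kernel (1 / real (Suc m)) (x - y))"
  have [measurable]: "f \<in> borel_measurable borel" "g \<in> borel_measurable borel" using f g by auto
  have "cmod (LINT y|lborel. cnj (g y) * ?F y) \<le> (LINT y|lborel. cmod (cnj (g y) * ?F y))"
    by (rule integral_norm_bound)
  also have "\<dots> \<le> (LINT y|lborel. cmod (g y) * ((2 * pi) ^ DIM('a) * B))"
  proof (rule Bochner_Integration.integral_mono')
    show "cmod (cnj (g y) * ?F y) \<le> cmod (g y) * ((2 * pi) ^ DIM('a) * B)" for y
      unfolding norm_mult complex_mod_cnj
      by (intro mult_left_mono norm_gauss_average_le B) auto
    show "0 \<le> cmod (g y) * ((2 * pi) ^ DIM('a) * B)" for y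
      using order_trans[OF norm_ge_zero B] by simp
  qed (use g in auto)
  finally show "cmod (LINT y|lborel. cnj (g y) * ?F y) \<le> (2 * pi) ^ DIM('a) * B * (LINT y|lborel. cmod (g y))"
    by (simp add: mult.commute)
qed

text \<open>Continuity of \<open>f\<close> makes its Gaussian averages converge at every point, and
  boundedness of \<open>f\<close> dominates them by a multiple of |g|. Both are at hand for the
  solution, whereas the test function \<open>g\<close> will be a discontinuous cut-off.\<close>

theorem ft_parseval:
  fixes f g :: "'a::euclidean_space \<Rightarrow> complex"
  assumes f: "integrable lborel f" and g: "integrable lborel g"
    and fg: "integrable lborel (\<lambda>\<xi>. ft f \<xi> * cnj (ft g \<xi>))"
    and B: "\<And>x. cmod (f x) \<le> B" and c: "continuous_on UNIV f"
  shows "(LINT \<xi>|lborel. ft f \<xi> * cnj (ft g \<xi>)) = (2 * pi) ^ DIM('a) * (LINT y|lborel. f y * cnj (g y))"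
proof (rule LIMSEQ_unique[OF ft_pairing_tendsto[OF f g fg]])
  have [measurable]: "f \<in> borel_measurable borel" "g \<in> borel_measurable borel" using f g by auto
  let ?h = "\<lambda>m. 1 / real (Suc m)"
  let ?F = "\<lambda>m y. LINT x|lborel. f x * of_real (gauss_kernel (?h m) (x - y))"
  let ?D = "complex_of_real ((2 * pi) ^ DIM('a))"
  \<comment> \<open>The substitution x = y + h v moves the dependence on h from the kernel into the
    argument of \<open>f\<close>, where continuity can act.\<close>
  have F: "?F m y = (LINT v|lborel. f (y + ?h m *\<^sub>R v) * of_real (gauss_kernel 1 v))" for m y
  proof -
    have "(?h m) ^ DIM('a) * gauss_kernel (?h m) (?h m *\<^sub>R v) = gauss_kernel 1 v" for v :: 'a
      by (simp add: gauss_kernel_def power_divide power_mult_distrib)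
    then have e: "?h m ^ DIM('a) *\<^sub>R (f (y + ?h m *\<^sub>R v) * of_real (gauss_kernel (?h m) (?h m *\<^sub>R v)))
       = f (y + ?h m *\<^sub>R v) * of_real (gauss_kernel 1 v)" for v :: 'a
      by (simp only: scaleR_conv_of_real mult.left_commute[of _ "f _"] flip: of_real_mult)
    have "?F m y = ?h m ^ DIM('a) *\<^sub>R (LINT v|lborel. f (y + ?h m *\<^sub>R v) * of_real (gauss_kernel (?h m) (?h m *\<^sub>R v)))"
      by (subst integral_lborel_affine[where c="?h m" and t=y]) auto
    also have "\<dots> = (LINT v|lborel. ?h m ^ DIM('a) *\<^sub>R (f (y + ?h m *\<^sub>R v) * of_real (gauss_kernel (?h m) (?h m *\<^sub>R v))))"
      by (rule integral_scaleR_right[symmetric])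
    finally show ?thesis unfolding e .
  qed
  have lim: "(\<lambda>m. ?F m y) \<longlonglongrightarrow> f y * ?D" for y
  proof -
    have "(\<lambda>m. LINT v|lborel. f (y + ?h m *\<^sub>R v) * of_real (gauss_kernel 1 v)) \<longlonglongrightarrow> (LINT v|lborel. f y * of_real (gauss_kernel 1 (v::'a)))"
    proof (rule integral_dominated_convergence)
      show "integrable lborel (\<lambda>v::'a. B * gauss_kernel 1 v)"
        by (intro integrable_mult_right integrable_gauss_kernel) simp
      show "AE v in lborel. (\<lambda>m. f (y + ?h m *\<^sub>R v) * of_real (gauss_kernel 1 v)) \<longlonglongrightarrow> f y * of_real (gauss_kernel 1 v)"
      proof (rule AE_I2)
        fix v :: 'a
        have "(\<lambda>m. y + ?h m *\<^sub>R v) \<longlonglongrightarrow> y + 0 *\<^sub>R v"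
          by (intro tendsto_intros LIMSEQ_Suc lim_1_over_n)
        then have "(\<lambda>m. f (y + ?h m *\<^sub>R v)) \<longlonglongrightarrow> f y"
          using c by (intro isCont_tendsto_compose[of y f]) (auto simp: continuous_on_eq_continuous_at)
        then show "(\<lambda>m. f (y + ?h m *\<^sub>R v) * of_real (gauss_kernel 1 v)) \<longlonglongrightarrow> f y * of_real (gauss_kernel 1 v)"
          by (intro tendsto_intros)
      qed
      show "AE v in lborel. norm (f (y + ?h m *\<^sub>R v) * of_real (gauss_kernel 1 v)) \<le> B * gauss_kernel 1 v" for m
        using gauss_kernel_nonneg[of 1, where ?'a='a] B by (auto simp: norm_mult mult_right_mono)
    qed measurable
    also have "(LINT v|lborel. f y * of_real (gauss_kernel 1 (v::'a))) = f y * ?D"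
      using integral_gauss_kernel[of 1, where ?'a='a] by simp
    finally show ?thesis unfolding F .
  qed
  have "(\<lambda>m. LINT y|lborel. cnj (g y) * ?F m y) \<longlonglongrightarrow> (LINT y|lborel. cnj (g y) * (f y * ?D))"
  proof (rule integral_dominated_convergence)
    show "integrable lborel (\<lambda>y. cmod (g y) * ((2 * pi) ^ DIM('a) * B))"
      using g by simp
    show "AE y in lborel. (\<lambda>m. cnj (g y) * ?F m y) \<longlonglongrightarrow> cnj (g y) * (f y * ?D)"
      by (intro AE_I2 tendsto_intros lim)
    show "AE y in lborel. norm (cnj (g y) * ?F m y) \<le> cmod (g y) * ((2 * pi) ^ DIM('a) * B)" for m
      unfolding norm_mult complex_mod_cnj
      by (intro AE_I2 mult_left_mono norm_gauss_average_le B) auto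
  qed measurable
  also have "(LINT y|lborel. cnj (g y) * (f y * ?D)) = (LINT y|lborel. ?D * (f y * cnj (g y)))"
    by (rule Bochner_Integration.integral_cong) (simp_all only: mult.assoc mult.commute mult.left_commute)
  also have "\<dots> = ?D * (LINT y|lborel. f y * cnj (g y))"
    by (rule integral_mult_right_zero)
  finally show "(\<lambda>m. LINT y|lborel. cnj (g y) * ?F m y) \<longlonglongrightarrow> (2 * pi) ^ DIM('a) * (LINT y|lborel. f y * cnj (g y))"
    by simp
qed


section \<open>One-dimensional multipliers\<close>

lemma convolution:
  fixes \<kappa> a :: "'a::euclidean_space \<Rightarrow> complex"
  assumes k: "integrable lborel \<kappa>" and a: "integrable lborel a"
  defines "c \<equiv> \<lambda>x. LINT y|lborel. \<kappa> y * a (x - y)"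
  shows integrable_convolution: "integrable lborel c"
    and ft_convolution: "ft c \<xi> = ft \<kappa> \<xi> * ft a \<xi>"
    and norm_convolution: "(LINT x|lborel. cmod (c x)) \<le> (LINT x|lborel. cmod (\<kappa> x)) * (LINT x|lborel. cmod (a x))"
proof -
  have [measurable]: "\<kappa> \<in> borel_measurable borel" "a \<in> borel_measurable borel"
    using k a by auto
  have shift: "integrable lborel (\<lambda>x. a (x - y))" for y
    using integrable_lborel_affine[OF a, of 1 "- y"] by simp
  have shift_eq: "(LINT x|lborel. F (x - y)) = (LINT x|lborel. F x)"
    if [measurable]: "F \<in> borel_measurable borel" for F :: "'a \<Rightarrow> complex" and y
    by (subst integral_lborel_affine[where c=1 and t="y"]) auto
  have shift_norm: "(LINT x|lborel. cmod (a (x - y))) = (LINT x|lborel. cmod (a x))" for y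
  proof -
    have "complex_of_real (LINT x|lborel. cmod (a (x - y))) = complex_of_real (LINT x|lborel. cmod (a x))"
      using shift_eq[of "\<lambda>x. of_real (cmod (a x))" y] by simp
    then show ?thesis using of_real_eq_iff by blast
  qed
  have i: "integrable (lborel \<Otimes>\<^sub>M lborel) (\<lambda>(y, x). \<kappa> y * a (x - y))"
  proof (rule lborel_pair.Fubini_integrable)
    show "integrable lborel (\<lambda>y. LINT x|lborel. norm (case (y, x) of (y, x) \<Rightarrow> \<kappa> y * a (x - y)))"
      using k by (simp add: norm_mult shift_norm)
    show "AE y in lborel. integrable lborel (\<lambda>x. case (y, x) of (y, x) \<Rightarrow> \<kappa> y * a (x - y))"
      using shift by simp
  qed measurable
  show "integrable lborel c"
    unfolding c_def by (rule lborel_pair.integrable_snd[OF i])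
  have "ft c \<xi> = (LINT x|lborel. LINT y|lborel. cis (- (x \<bullet> \<xi>)) * (\<kappa> y * a (x - y)))"
    unfolding ft_def c_def by simp
  also have "\<dots> = (LINT y|lborel. LINT x|lborel. cis (- (x \<bullet> \<xi>)) * (\<kappa> y * a (x - y)))"
  proof (rule lborel_pair.Fubini_integral)
    have "integrable (lborel \<Otimes>\<^sub>M lborel) (\<lambda>z. cis (- (snd z \<bullet> \<xi>)) * (case z of (y, x) \<Rightarrow> \<kappa> y * a (x - y)))"
      by (intro integrable_cis_mult i) measurable
    then show "integrable (lborel \<Otimes>\<^sub>M lborel) (\<lambda>(y, x). cis (- (x \<bullet> \<xi>)) * (\<kappa> y * a (x - y)))"
      by (simp add: case_prod_unfold)
  qed
  also have "\<dots> = (LINT y|lborel. cis (- (y \<bullet> \<xi>)) * \<kappa> y * ft a \<xi>)"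
  proof (intro Bochner_Integration.integral_cong refl)
    fix y
    have "(LINT x|lborel. cis (- (x \<bullet> \<xi>)) * (\<kappa> y * a (x - y)))
      = (LINT x|lborel. (cis (- (y \<bullet> \<xi>)) * \<kappa> y) * (cis (- ((x - y) \<bullet> \<xi>)) * a (x - y)))"
      by (intro Bochner_Integration.integral_cong refl)
        (simp add: mult.assoc[symmetric] cis_mult inner_diff_left mult.commute[of "\<kappa> y"] mult.left_commute)
    also have "\<dots> = (cis (- (y \<bullet> \<xi>)) * \<kappa> y) * (LINT x|lborel. cis (- ((x - y) \<bullet> \<xi>)) * a (x - y))"
      by (rule integral_mult_right_zero)
    also have "(LINT x|lborel. cis (- ((x - y) \<bullet> \<xi>)) * a (x - y)) = ft a \<xi>"
      unfolding ft_def by (rule shift_eq) measurable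
    finally show "(LINT x|lborel. cis (- (x \<bullet> \<xi>)) * (\<kappa> y * a (x - y))) = cis (- (y \<bullet> \<xi>)) * \<kappa> y * ft a \<xi>" .
  qed
  also have "\<dots> = ft \<kappa> \<xi> * ft a \<xi>"
    unfolding ft_def[of \<kappa>] by (rule integral_mult_left_zero)
  finally show "ft c \<xi> = ft \<kappa> \<xi> * ft a \<xi>" .
  have i': "integrable (lborel \<Otimes>\<^sub>M lborel) (\<lambda>(y, x). cmod (\<kappa> y * a (x - y)))"
    using i by (simp add: case_prod_unfold)
  have "(LINT x|lborel. cmod (c x)) \<le> (LINT x|lborel. LINT y|lborel. cmod (\<kappa> y * a (x - y)))"
    unfolding c_def
    by (rule Bochner_Integration.integral_mono'[OF lborel_pair.integrable_snd[OF i']]) auto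
  also have "\<dots> = (LINT y|lborel. LINT x|lborel. cmod (\<kappa> y * a (x - y)))"
    by (rule lborel_pair.Fubini_integral[OF i'])
  also have "\<dots> = (LINT x|lborel. cmod (\<kappa> x)) * (LINT x|lborel. cmod (a x))"
    by (simp add: norm_mult shift_norm)
  finally show "(LINT x|lborel. cmod (c x)) \<le> (LINT x|lborel. cmod (\<kappa> x)) * (LINT x|lborel. cmod (a x))" .
qed

lemma norm_convolution_bounded:
  fixes \<kappa> a :: "'a::euclidean_space \<Rightarrow> complex"
  assumes a: "integrable lborel a" and B: "\<And>x. cmod (\<kappa> x) \<le> B"
  shows "cmod (LINT y|lborel. \<kappa> y * a (x - y)) \<le> B * (LINT x|lborel. cmod (a x))"
proof -
  have [measurable]: "a \<in> borel_measurable borel" using a by auto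
  have "integrable lborel (\<lambda>y. a (x - y))"
    using integrable_lborel_affine[OF a, of "-1" x] by simp
  then have i: "integrable lborel (\<lambda>y. B * cmod (a (x - y)))" by simp
  have "0 \<le> B" using B[of undefined] norm_ge_zero order_trans by blast
  have "cmod (LINT y|lborel. \<kappa> y * a (x - y)) \<le> (LINT y|lborel. cmod (\<kappa> y * a (x - y)))"
    by (rule integral_norm_bound)
  also have "\<dots> \<le> (LINT y|lborel. B * cmod (a (x - y)))"
    by (rule Bochner_Integration.integral_mono'[OF i]) (use B \<open>0 \<le> B\<close> in \<open>auto simp: norm_mult intro!: mult_right_mono\<close>)
  also have "(LINT y|lborel. B * cmod (a (x - y))) = B * (LINT x|lborel. cmod (a x))"
  proof -
    have "complex_of_real (LINT y|lborel. cmod (a (x - y))) = complex_of_real (LINT x|lborel. cmod (a x))"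
      using integral_lborel_affine[of "\<lambda>y. complex_of_real (cmod (a y))" "-1" x] by simp
    then have "(LINT y|lborel. cmod (a (x - y))) = (LINT x|lborel. cmod (a x))"
      unfolding of_real_eq_iff .
    then show ?thesis by simp
  qed
  finally show ?thesis .
qed

text \<open>The causal fundamental solution of d/dy + k. It serves twice: in space it and its
  reflection have the transforms 1 / (k \<plusminus> \<i> \<eta>), and in time it is the damped
  propagator of \<open>duhamel\<close>.\<close>

definition exp_kernel :: "complex \<Rightarrow> real \<Rightarrow> complex" where
  "exp_kernel k y = (if 0 < y then exp (- (k * of_real y)) else 0)"

lemma borel_measurable_exp_kernel [measurable]: "exp_kernel k \<in> borel_measurable borel"
proof -
  have [measurable]: "(\<lambda>y. exp (- (k * complex_of_real y))) \<in> borel_measurable borel"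
    by (intro borel_measurable_continuous_onI continuous_intros)
  show ?thesis unfolding exp_kernel_def by measurable
qed

lemma norm_exp_kernel: "cmod (exp_kernel k y) = indicator {0<..} y * exp (- (y * Re k))"
  by (simp add: exp_kernel_def mult.commute)

lemma norm_exp_kernel_le: "0 \<le> Re k \<Longrightarrow> cmod (exp_kernel k y) \<le> 1"
  by (simp add: norm_exp_kernel indicator_def)

lemma exp_kernel_integral:
  assumes k: "Re k > 0"
  shows integrable_exp_kernel: "integrable lborel (exp_kernel k)"
    and integral_norm_exp_kernel: "(LINT y|lborel. cmod (exp_kernel k y)) = 1 / Re k"
    and integral_exp_kernel: "(LINT y|lborel. exp_kernel k y) = 1 / k"
proof -
  have i: "integrable lborel (\<lambda>y. cmod (exp_kernel k y))"
    using integrable_I0i_exp_mscale[OF k] unfolding norm_exp_kernel set_integrable_def by simp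
  then show ik: "integrable lborel (exp_kernel k)"
    by (subst (asm) integrable_norm_iff) auto
  show "(LINT y|lborel. cmod (exp_kernel k y)) = 1 / Re k"
    using LBINT_I0i_exp_mscale[OF k]
    unfolding norm_exp_kernel by (simp add: interval_lebesgue_integral_0_infty set_lebesgue_integral_def)
  have eq: "indicator (einterval 0 \<infinity>) y *\<^sub>R exp (- (k * of_real y)) = exp_kernel k y" for y
    by (simp add: exp_kernel_def einterval_iff indicator_def)
  have k0: "k \<noteq> 0" using k by auto
  have "(LBINT y=0..\<infinity>. exp (- (k * complex_of_real y))) = 0 - (- (1 / k))"
  proof (rule interval_integral_FTC_integrable)
    show "((\<lambda>y. - (1 / k) * exp (- (k * complex_of_real y))) has_vector_derivative exp (- (k * complex_of_real y))) (at y)" for y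
      using k0 by (auto intro!: derivative_eq_intros has_vector_derivative_real_field)
    show "isCont (\<lambda>y. exp (- (k * complex_of_real y))) y" for y
      by (intro continuous_intros)
    show "set_integrable lborel (einterval 0 \<infinity>) (\<lambda>y. exp (- (k * complex_of_real y)))"
      unfolding set_integrable_def eq by (rule ik)
    have "((\<lambda>y. - (1 / k) * exp (- (k * complex_of_real y))) \<longlongrightarrow> - (1 / k) * exp (- (k * complex_of_real 0))) (at_right 0)"
      by (intro tendsto_intros)
    then show "(((\<lambda>y. - (1 / k) * exp (- (k * complex_of_real y))) \<circ> real_of_ereal) \<longlongrightarrow> - (1 / k)) (at_right 0)"
      unfolding zero_ereal_def ereal_tendsto_simps by simp
    have "((\<lambda>y. exp (- (y * Re k))) \<longlongrightarrow> 0) at_top"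
      using k by (auto intro!: filterlim_compose[OF exp_at_bot] filterlim_compose[OF filterlim_uminus_at_bot_at_top] filterlim_at_top_mult_tendsto_pos[OF tendsto_const _ filterlim_ident] simp: mult.commute)
    then have "((\<lambda>y. exp (- (k * complex_of_real y))) \<longlongrightarrow> 0) at_top"
      by (subst tendsto_norm_zero_iff[symmetric]) (simp add: mult.commute)
    then have "((\<lambda>y. - (1 / k) * exp (- (k * complex_of_real y))) \<longlongrightarrow> 0) at_top"
      by (rule tendsto_mult_right_zero)
    then show "(((\<lambda>y. - (1 / k) * exp (- (k * complex_of_real y))) \<circ> real_of_ereal) \<longlongrightarrow> 0) (at_left \<infinity>)"
      unfolding ereal_tendsto_simps .
  qed simp
  then show "(LINT y|lborel. exp_kernel k y) = 1 / k"
    by (simp add: interval_lebesgue_integral_def set_lebesgue_integral_def eq)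
qed

lemma cis_mult_exp_kernel: "cis (- (y * \<eta>)) * exp_kernel k y = exp_kernel (k + \<i> * of_real \<eta>) y"
  by (simp add: exp_kernel_def cis_conv_exp algebra_simps flip: exp_add)

lemma ft_exp_kernel:
  assumes k: "Re k > 0"
  shows "ft (exp_kernel k) \<eta> = 1 / (k + \<i> * of_real \<eta>)"
    and "ft (\<lambda>y. exp_kernel k (- y)) \<eta> = 1 / (k - \<i> * of_real \<eta>)"
proof -
  show "ft (exp_kernel k) \<eta> = 1 / (k + \<i> * of_real \<eta>)" for \<eta>
    using integral_exp_kernel[of "k + \<i> * of_real \<eta>"] k
    by (simp add: ft_def cis_mult_exp_kernel)
  from this[of "- \<eta>"] show "ft (\<lambda>y. exp_kernel k (- y)) \<eta> = 1 / (k - \<i> * of_real \<eta>)"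
    unfolding ft_def by (subst lborel_integral_real_affine[of "-1" _ 0]) auto
qed

lemma exp_kernel_reflected:
  assumes k: "Re k > 0"
  shows "integrable lborel (\<lambda>y. exp_kernel k (- y))"
    and "(LINT y|lborel. cmod (exp_kernel k (- y))) = 1 / Re k"
  using lborel_integrable_real_affine[OF integrable_exp_kernel[OF k], of "-1" 0]
    lborel_integral_real_affine[of "-1" "\<lambda>y. cmod (exp_kernel k y)" 0] integral_norm_exp_kernel[OF k]
  by simp_all

text \<open>Membership of \<open>p\<close>, up to null sets, in the Wiener algebra of Fourier transforms of finite measures
  with total mass at most \<open>C\<close>, expressed by its action on \<open>L\<^sup>1\<close>.\<close>

definition wiener_mult :: "real \<Rightarrow> (real \<Rightarrow> complex) \<Rightarrow> bool" where
  "wiener_mult C p \<longleftrightarrow> (\<forall>a. integrable lborel a \<longrightarrow> (\<exists>b. integrable lborel b \<and>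
     (AE \<eta> in lborel. ft b \<eta> = p \<eta> * ft a \<eta>) \<and> (LINT x|lborel. cmod (b x)) \<le> C * (LINT x|lborel. cmod (a x))))"

lemma wiener_multE:
  assumes "wiener_mult C p" "integrable lborel a"
  obtains b where "integrable lborel b" "AE \<eta> in lborel. ft b \<eta> = p \<eta> * ft a \<eta>"
    "(LINT x|lborel. cmod (b x)) \<le> C * (LINT x|lborel. cmod (a x))"
  using assms unfolding wiener_mult_def by blast

text \<open>Null sets must be ignored because of the degenerate case r = 0: there \<eta> / (\<i>
  \<eta>) is constant only away from \<eta> = 0.\<close>

lemma wiener_mult_cong:
  assumes "wiener_mult C p" "AE \<eta> in lborel. p \<eta> = q \<eta>"
  shows "wiener_mult C q"
  unfolding wiener_mult_def
proof (intro allI impI)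
  fix a :: "real \<Rightarrow> complex" assume "integrable lborel a"
  then obtain b where b: "integrable lborel b" "AE \<eta> in lborel. ft b \<eta> = p \<eta> * ft a \<eta>"
    "(LINT x|lborel. cmod (b x)) \<le> C * (LINT x|lborel. cmod (a x))"
    using assms(1) wiener_multE by blast
  moreover have "AE \<eta> in lborel. ft b \<eta> = q \<eta> * ft a \<eta>"
    using b(2) assms(2) by eventually_elim simp
  ultimately show "\<exists>b. integrable lborel b \<and> (AE \<eta> in lborel. ft b \<eta> = q \<eta> * ft a \<eta>) \<and>
      (LINT x|lborel. cmod (b x)) \<le> C * (LINT x|lborel. cmod (a x))" by blast
qed

lemma wiener_mult_mono: "wiener_mult C p \<Longrightarrow> C \<le> D \<Longrightarrow> wiener_mult D p"
  unfolding wiener_mult_def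
  by (meson Bochner_Integration.integral_nonneg mult_right_mono norm_ge_zero order_trans)

text \<open>Composing the two actions on L^1 takes the place of convolving the underlying measures,
  so no measure has to be constructed.\<close>

lemma wiener_mult_mult:
  assumes p: "wiener_mult C p" and q: "wiener_mult D q" and C: "0 \<le> C"
  shows "wiener_mult (C * D) (\<lambda>\<eta>. p \<eta> * q \<eta>)"
  unfolding wiener_mult_def
proof (intro allI impI)
  fix a :: "real \<Rightarrow> complex" assume "integrable lborel a"
  then obtain b where b: "integrable lborel b" "AE \<eta> in lborel. ft b \<eta> = q \<eta> * ft a \<eta>"
    "(LINT x|lborel. cmod (b x)) \<le> D * (LINT x|lborel. cmod (a x))"
    using q wiener_multE by blast
  obtain c where c: "integrable lborel c" "AE \<eta> in lborel. ft c \<eta> = p \<eta> * ft b \<eta>"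
    "(LINT x|lborel. cmod (c x)) \<le> C * (LINT x|lborel. cmod (b x))"
    using p b(1) wiener_multE by blast
  have "AE \<eta> in lborel. ft c \<eta> = p \<eta> * q \<eta> * ft a \<eta>"
    using b(2) c(2) by eventually_elim simp
  moreover have "(LINT x|lborel. cmod (c x)) \<le> C * D * (LINT x|lborel. cmod (a x))"
    using order_trans[OF c(3) mult_left_mono[OF b(3) C]] by (simp add: mult.assoc)
  ultimately show "\<exists>b. integrable lborel b \<and> (AE \<eta> in lborel. ft b \<eta> = p \<eta> * q \<eta> * ft a \<eta>) \<and>
      (LINT x|lborel. cmod (b x)) \<le> C * D * (LINT x|lborel. cmod (a x))"
    using c(1) by blast
qed

lemma wiener_mult_add:
  assumes p: "wiener_mult C p" and q: "wiener_mult D q"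
  shows "wiener_mult (C + D) (\<lambda>\<eta>. p \<eta> + q \<eta>)"
  unfolding wiener_mult_def
proof (intro allI impI)
  fix a :: "real \<Rightarrow> complex" assume a: "integrable lborel a"
  then obtain b where b: "integrable lborel b" "AE \<eta> in lborel. ft b \<eta> = q \<eta> * ft a \<eta>"
    "(LINT x|lborel. cmod (b x)) \<le> D * (LINT x|lborel. cmod (a x))"
    using q wiener_multE by blast
  obtain c where c: "integrable lborel c" "AE \<eta> in lborel. ft c \<eta> = p \<eta> * ft a \<eta>"
    "(LINT x|lborel. cmod (c x)) \<le> C * (LINT x|lborel. cmod (a x))"
    using p a wiener_multE by blast
  have "ft (\<lambda>x. c x + b x) \<eta> = ft c \<eta> + ft b \<eta>" for \<eta>
    unfolding ft_def distrib_left
    by (intro Bochner_Integration.integral_add integrable_cis_mult b c) measurable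
  with b(2) c(2) have "AE \<eta> in lborel. ft (\<lambda>x. c x + b x) \<eta> = (p \<eta> + q \<eta>) * ft a \<eta>"
    by (auto elim!: eventually_elim2 simp: distrib_right)
  moreover have "(LINT x|lborel. cmod (c x + b x)) \<le> (LINT x|lborel. cmod (c x) + cmod (b x))"
    using b(1) c(1) by (intro Bochner_Integration.integral_mono) (auto intro: norm_triangle_ineq)
  then have "(LINT x|lborel. cmod (c x + b x)) \<le> (C + D) * (LINT x|lborel. cmod (a x))"
    using b(1,3) c(1,3) by (simp add: distrib_right)
  ultimately show "\<exists>b. integrable lborel b \<and> (AE \<eta> in lborel. ft b \<eta> = (p \<eta> + q \<eta>) * ft a \<eta>) \<and>
      (LINT x|lborel. cmod (b x)) \<le> (C + D) * (LINT x|lborel. cmod (a x))"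
    using b(1) c(1) by (intro exI[of _ "\<lambda>x. c x + b x"]) auto
qed

lemma wiener_mult_const: "wiener_mult (cmod c) (\<lambda>_. c)"
  unfolding wiener_mult_def
proof (intro allI impI)
  fix a :: "real \<Rightarrow> complex" assume a: "integrable lborel a"
  have "ft (\<lambda>x. c * a x) \<eta> = c * ft a \<eta>" for \<eta>
    unfolding ft_def mult.left_commute[of _ c] by (rule integral_mult_right_zero)
  then show "\<exists>b. integrable lborel b \<and> (AE \<eta> in lborel. ft b \<eta> = c * ft a \<eta>) \<and>
      (LINT x|lborel. cmod (b x)) \<le> cmod c * (LINT x|lborel. cmod (a x))"
    using a by (intro exI[of _ "\<lambda>x. c * a x"]) (auto simp: norm_mult)
qed

lemma wiener_mult_ft:
  assumes k: "integrable lborel \<kappa>"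
  shows "wiener_mult (LINT x|lborel. cmod (\<kappa> x)) (ft \<kappa>)"
  unfolding wiener_mult_def using convolution[OF k] by blast

lemma wiener_mult_pole:
  assumes k: "Re k > 0" and s: "s = 1 \<or> s = - 1"
  shows "wiener_mult (1 / Re k) (\<lambda>\<eta>. 1 / (k + \<i> * of_real (s * \<eta>)))"
  using s wiener_mult_ft[OF integrable_exp_kernel[OF k]] wiener_mult_ft[OF exp_kernel_reflected(1)[OF k]]
  by (auto simp: integral_norm_exp_kernel[OF k] exp_kernel_reflected(2)[OF k] ft_exp_kernel[OF k, abs_def])

definition coordinate_or_const :: "real \<Rightarrow> (real \<Rightarrow> real) \<Rightarrow> bool" where
  "coordinate_or_const r x \<longleftrightarrow> (x = (\<lambda>\<eta>. \<eta>)) \<or> (\<exists>c. \<bar>c\<bar> \<le> r \<and> x = (\<lambda>_. c))"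

lemma AE_lborel_neq_0: "AE \<eta> in lborel. (\<eta>::real) \<noteq> 0"
  by (rule AE_lborel_singleton)

text \<open>A constant numerator costs |c| / Re k \<le> |k| / Re k \<le> 2. A numerator \<eta>
  leaves, after division by the denominator, a point mass 1 and a pole of mass |k| / Re k \<le> 2;
  hence 3. The alternative \<open>k = 0\<close> covers frequencies with no component apart from
  \<xi>_j, which in dimension 1 are all of them.\<close>

lemma wiener_mult_coordinate_or_const:
  assumes k: "Re k > 0 \<and> cmod k \<le> 2 * Re k \<and> r \<le> cmod k \<or> k = 0 \<and> r = 0"
    and s: "s = 1 \<or> s = - 1" and x: "coordinate_or_const r x"
  shows "wiener_mult 3 (\<lambda>\<eta>. of_real (x \<eta>) / (k + \<i> * of_real (s * \<eta>)))"
proof -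
  consider (zero) "k = 0" "r = 0" "x = (\<lambda>\<eta>. \<eta>)" | (zero_const) "x = (\<lambda>\<eta>. 0)"
    | (const) c where "Re k > 0" "cmod k \<le> 2 * Re k" "\<bar>c\<bar> \<le> cmod k" "x = (\<lambda>_. c)"
    | (coord) "Re k > 0" "cmod k \<le> 2 * Re k" "x = (\<lambda>\<eta>. \<eta>)"
    using k x unfolding coordinate_or_const_def by force
  then show ?thesis
  proof cases
    case zero
    \<comment> \<open>The quotient is the constant 1 / (\<i> s) = -\<i> s off \<eta> = 0, since s^2
      = 1.\<close>
    have "AE \<eta> in lborel. - \<i> * of_real s = of_real (x \<eta>) / (k + \<i> * of_real (s * \<eta>))"
      by (rule eventually_mono[OF AE_lborel_neq_0]) (use s zero in \<open>auto simp: field_simps\<close>)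
    then have "wiener_mult (cmod (- \<i> * of_real s)) (\<lambda>\<eta>. of_real (x \<eta>) / (k + \<i> * of_real (s * \<eta>)))"
      by (rule wiener_mult_cong[OF wiener_mult_const])
    then show ?thesis
      by (rule wiener_mult_mono) (use s in \<open>auto simp: norm_mult\<close>)
  next
    case zero_const
    have "wiener_mult 3 (\<lambda>_. 0)"
      by (rule wiener_mult_mono[OF wiener_mult_const]) simp
    then show ?thesis using zero_const by simp
  next
    case const
    have "wiener_mult (cmod (of_real c) * (1 / Re k)) (\<lambda>\<eta>. of_real c * (1 / (k + \<i> * of_real (s * \<eta>))))"
      by (intro wiener_mult_mult wiener_mult_const wiener_mult_pole const s) simp
    moreover have "cmod (of_real c) * (1 / Re k) \<le> 3"
      using const by (simp add: field_simps)
    ultimately show ?thesis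
      using wiener_mult_mono const(4) by fastforce
  next
    case coord
    \<comment> \<open>Polynomial division: \<eta> / (k + \<i> s \<eta>) = -\<i> s (1 - k / (k + \<i>
      s \<eta>)).\<close>
    have "wiener_mult (cmod (- k) * (1 / Re k)) (\<lambda>\<eta>. - k * (1 / (k + \<i> * of_real (s * \<eta>))))"
      by (intro wiener_mult_mult wiener_mult_const wiener_mult_pole coord s) simp
    from wiener_mult_mult[OF wiener_mult_const[of "- \<i> * of_real s"] wiener_mult_add[OF wiener_mult_const[of 1] this]]
    have "wiener_mult (cmod (- \<i> * of_real s) * (cmod 1 + cmod (- k) * (1 / Re k)))
      (\<lambda>\<eta>. (- \<i> * of_real s) * (1 + - k * (1 / (k + \<i> * of_real (s * \<eta>)))))" by simp
    moreover have "cmod (- \<i> * of_real s) * (cmod 1 + cmod (- k) * (1 / Re k)) \<le> 3"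
      using coord s by (auto simp: norm_mult field_simps)
    moreover have "(- \<i> * of_real s) * (1 + - k * (1 / (k + \<i> * of_real (s * \<eta>)))) = of_real (x \<eta>) / (k + \<i> * of_real (s * \<eta>))" for \<eta>
    proof -
      have "k + \<i> * of_real (s * \<eta>) \<noteq> 0"
        using coord(1) s by (auto simp: complex_eq_iff)
      then have "1 + - k * (1 / (k + \<i> * of_real (s * \<eta>))) = \<i> * of_real (s * \<eta>) / (k + \<i> * of_real (s * \<eta>))"
        by (simp add: field_simps)
      then show ?thesis using s coord(3) by auto
    qed
    ultimately show ?thesis
      using wiener_mult_mono[where D=3] by (simp only:)
  qed
qed

text \<open>The factor \<open>\<eta> / (\<eta>\<^sup>2 + k\<^sup>2)\<close> is the transform of the kernel \<open>sgn(y) exp(-k |y|)\<close> up to a constant; this kernel is bounded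
  uniformly in \<open>k\<close>, although its mass is not.\<close>

lemma ft_pairing_resolvent:
  assumes k: "Re k > 0" and f: "integrable lborel f" and g: "integrable lborel g"
    and fg: "integrable lborel (\<lambda>\<eta>. of_real \<eta> / (of_real \<eta> ^ 2 + k ^ 2) * ft f \<eta> * cnj (ft g \<eta>))"
  shows "cmod (LINT \<eta>|lborel. of_real \<eta> / (of_real \<eta> ^ 2 + k ^ 2) * ft f \<eta> * cnj (ft g \<eta>))
    \<le> 2 * pi * (LINT x|lborel. cmod (f x)) * (LINT x|lborel. cmod (g x))"
proof -
  \<comment> \<open>The prefactor comes from partial fractions: 1 / (k + \<i> \<eta>) - 1 / (k -
    \<i> \<eta>) = -2 \<i> \<eta> / (\<eta>^2 + k^2).\<close>
  define \<kappa> where "\<kappa> y = \<i> / 2 * (exp_kernel k y - exp_kernel k (- y))" for y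
  have i: "integrable lborel \<kappa>"
    unfolding \<kappa>_def
    by (intro integrable_mult_right Bochner_Integration.integrable_diff integrable_exp_kernel exp_kernel_reflected k)
  \<comment> \<open>At each \<open>y\<close> at most one of the two exponentials is nonzero, so the
    difference is bounded by 1 whatever the size of \<open>Re k\<close>.\<close>
  have "cmod (exp_kernel k y - exp_kernel k (- y)) \<le> 1" for y
    using norm_exp_kernel_le[of k y] norm_exp_kernel_le[of k "-y"] k
    by (cases "y > 0") (simp_all add: exp_kernel_def)
  then have B: "cmod (\<kappa> y) \<le> 1" for y
    unfolding \<kappa>_def norm_mult by (rule order_trans[OF mult_left_mono]) simp_all
  have ftk: "ft \<kappa> \<eta> = of_real \<eta> / (of_real \<eta> ^ 2 + k ^ 2)" for \<eta>
  proof -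
    have "ft \<kappa> \<eta> = (LINT y|lborel. \<i> / 2 * (cis (- (y \<bullet> \<eta>)) * exp_kernel k y - cis (- (y \<bullet> \<eta>)) * exp_kernel k (- y)))"
      unfolding ft_def \<kappa>_def by (intro Bochner_Integration.integral_cong refl) (simp add: algebra_simps)
    also have "\<dots> = \<i> / 2 * (LINT y|lborel. (cis (- (y \<bullet> \<eta>)) * exp_kernel k y - cis (- (y \<bullet> \<eta>)) * exp_kernel k (- y)))"
      by (rule integral_mult_right_zero)
    also have "\<dots> = \<i> / 2 * (ft (exp_kernel k) \<eta> - ft (\<lambda>y. exp_kernel k (- y)) \<eta>)"
      unfolding ft_def
      by (subst Bochner_Integration.integral_diff)
         (auto intro!: integrable_cis_mult integrable_exp_kernel exp_kernel_reflected k)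
    also have "\<dots> = \<i> / 2 * (1 / (k + \<i> * of_real \<eta>) - 1 / (k - \<i> * of_real \<eta>))"
      by (simp add: ft_exp_kernel[OF k])
    also have "\<dots> = of_real \<eta> / (of_real \<eta> ^ 2 + k ^ 2)"
    proof -
      have nz: "k + \<i> * of_real \<eta> \<noteq> 0" "k - \<i> * of_real \<eta> \<noteq> 0"
        using k by (auto simp: complex_eq_iff)
      have "of_real \<eta> ^ 2 + k ^ 2 = (k + \<i> * of_real \<eta>) * (k - \<i> * of_real \<eta>)"
        by (simp add: algebra_simps power2_eq_square)
      then show ?thesis using nz by (simp add: divide_simps)
    qed
    finally show ?thesis .
  qed
  let ?c = "\<lambda>x. LINT y|lborel. \<kappa> y * f (x - y)"
  have "cmod (LINT \<eta>|lborel. ft ?c \<eta> * cnj (ft g \<eta>)) \<le> (2 * pi) ^ DIM(real) * (1 * (LINT x|lborel. cmod (f x))) * (LINT x|lborel. cmod (g x))"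
  proof (rule ft_pairing_bounded[OF integrable_convolution[OF i f] g])
    show "integrable lborel (\<lambda>\<eta>. ft ?c \<eta> * cnj (ft g \<eta>))"
      using fg unfolding ft_convolution[OF i f] ftk .
    show "cmod (?c x) \<le> 1 * (LINT x|lborel. cmod (f x))" for x
      by (rule norm_convolution_bounded[OF f B])
  qed
  then show ?thesis
    unfolding ft_convolution[OF i f] ftk by simp
qed

section \<open>The symbol as a function of one frequency variable\<close>

lemma Re_csqrt_pos: "Im z \<noteq> 0 \<Longrightarrow> 0 < Re (csqrt z)"
proof -
  assume "Im z \<noteq> 0"
  moreover have "Im z = 2 * Re (csqrt z) * Im (csqrt z)"
    by (metis Im_power2 power2_csqrt)
  ultimately have "Re (csqrt z) \<noteq> 0" by (metis mult_zero_left mult_zero_right)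
  moreover have "0 \<le> Re (csqrt z)"
    using csqrt_principal[of z] by auto
  ultimately show ?thesis by simp
qed

text \<open>With X = \<eta>^2 + r^2 and \<sigma>^2 = 1 the denominator is \<i> \<sigma> times (X +
  \<epsilon> / 2)^2 - s^2, a difference of squares whose factors are \<eta>^2 + k1^2 and \<eta>^2 +
  k2^2. Taking the root with Re s > 0 makes \<open>k2\<close> elliptic and leaves all degeneracy to
  \<open>k1\<close>, of which only \<open>Re k1 > 0\<close> is used. The constant is 2 pi from
  \<open>ft_pairing_resolvent\<close> times 3^4 from the four elliptic factors.\<close>

lemma directional_symbol_estimate:
  fixes \<epsilon> \<tau> \<sigma> \<delta> r :: real
  assumes e: "0 \<le> \<epsilon>" and sg: "\<sigma> = 1 \<or> \<sigma> = - 1" and d: "0 < \<delta>" and r: "0 \<le> r"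
    and x: "coordinate_or_const r x1" "coordinate_or_const r x2" "coordinate_or_const r x3"
    and f: "integrable lborel f" and g: "integrable lborel g"
  defines "m \<equiv> \<lambda>\<eta>. of_real (\<eta>\<^sup>2 / (\<eta>\<^sup>2 + r\<^sup>2)) * (\<i> * of_real (x1 \<eta>) * (\<i> * of_real (x2 \<eta>)) * (\<i> * of_real (x3 \<eta>)))
      / (of_real \<delta> + \<i> * of_real (\<tau> + \<sigma> * ((\<eta>\<^sup>2 + r\<^sup>2)\<^sup>2 + \<epsilon> * (\<eta>\<^sup>2 + r\<^sup>2))))"
  assumes int: "integrable lborel (\<lambda>\<eta>. m \<eta> * (ft f \<eta> * cnj (ft g \<eta>)))"
  shows "cmod (LINT \<eta>|lborel. m \<eta> * (ft f \<eta> * cnj (ft g \<eta>)))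
    \<le> 162 * pi * (LINT x|lborel. cmod (f x)) * (LINT x|lborel. cmod (g x))"
proof -
  \<comment> \<open>Completing the square in X. The damping \<open>\<delta> > 0\<close> keeps s^2
    off the real axis, so neither \<open>s\<close> nor the roots below become purely
    imaginary.\<close>
  define s where "s = csqrt (of_real (\<epsilon>\<^sup>2 / 4 - \<sigma> * \<tau>) + \<i> * of_real (\<sigma> * \<delta>))"
  have "0 < Re s"
    unfolding s_def by (rule Re_csqrt_pos) (use sg d in auto)
  have s2: "s\<^sup>2 = of_real (\<epsilon>\<^sup>2 / 4 - \<sigma> * \<tau>) + \<i> * of_real (\<sigma> * \<delta>)"
    by (simp add: s_def)
  have "Im (s\<^sup>2) \<noteq> 0" unfolding s2 using sg d by auto
  then have Im_s: "Im s \<noteq> 0" by (simp add: Im_power2)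
  define k1 where "k1 = csqrt (of_real (r\<^sup>2 + \<epsilon> / 2) - s)"
  define k2 where "k2 = csqrt (of_real (r\<^sup>2 + \<epsilon> / 2) + s)"
  have k1: "0 < Re k1" and k2: "0 < Re k2"
    unfolding k1_def k2_def by (rule Re_csqrt_pos, use Im_s in simp)+
  have k1_sq: "k1\<^sup>2 = of_real (r\<^sup>2 + \<epsilon> / 2) - s" and k2_sq: "k2\<^sup>2 = of_real (r\<^sup>2 + \<epsilon> / 2) + s"
    by (simp_all add: k1_def k2_def)
  \<comment> \<open>The right side is at least r^2 \<ge> 0, which puts \<open>k2\<close> in the
    sector |Im| \<le> Re and gives r \<le> Re k2 at once.\<close>
  have "(Re k2)\<^sup>2 - (Im k2)\<^sup>2 = r\<^sup>2 + \<epsilon> / 2 + Re s"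
    using arg_cong[OF k2_sq, of Re] by (simp add: Re_power2)
  then have k2_Re: "(Im k2)\<^sup>2 \<le> (Re k2)\<^sup>2" "r\<^sup>2 \<le> (Re k2)\<^sup>2"
    using e \<open>0 < Re s\<close> zero_le_power2[of r] zero_le_power2[of "Im k2"] by linarith+
  have "\<bar>Im k2\<bar> \<le> Re k2" "r \<le> Re k2"
    using k2_Re k2 by (auto simp: abs_le_square_iff[symmetric])
  then have k2_props: "cmod k2 \<le> 2 * Re k2" "r \<le> cmod k2"
    using cmod_le[of k2] complex_Re_le_cmod[of k2] k2 by linarith+
  \<comment> \<open>The numerator is \<eta>^2 x1 x2 x3. One \<eta> is reserved for the factor
    \<open>q\<close> with the root \<open>k1\<close>; the other four terms go one each to the linear
    factors r \<plusminus> \<i> \<eta> and k2 \<plusminus> \<i> \<eta>.\<close>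
  define p where "p \<eta> = (of_real (x1 \<eta>) / (of_real r + \<i> * of_real (1 * \<eta>))) * ((of_real (x2 \<eta>) / (of_real r + \<i> * of_real (- 1 * \<eta>)))
     * ((of_real (x3 \<eta>) / (k2 + \<i> * of_real (1 * \<eta>))) * (of_real \<eta> / (k2 + \<i> * of_real (- 1 * \<eta>)))))" for \<eta>
  have "wiener_mult (3 * (3 * (3 * 3))) p"
    unfolding p_def
    by (intro wiener_mult_mult wiener_mult_coordinate_or_const[where r=r] x)
      (use r k2 k2_props in \<open>auto simp: coordinate_or_const_def\<close>)
  then obtain b where b: "integrable lborel b" "AE \<eta> in lborel. ft b \<eta> = p \<eta> * ft f \<eta>"
    "(LINT x|lborel. cmod (b x)) \<le> 81 * (LINT x|lborel. cmod (f x))"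
    using wiener_multE[OF _ f, of "3 * (3 * (3 * 3))" p] by auto
  define q where "q \<eta> = of_real \<eta> / (of_real \<eta> ^ 2 + k1 ^ 2)" for \<eta>
  have m_eq: "m \<eta> = - of_real \<sigma> * (q \<eta> * p \<eta>)" for \<eta>
  proof -
    let ?e = "complex_of_real \<eta>" and ?r = "complex_of_real r"
    have f0: "of_real (\<eta>\<^sup>2 + r\<^sup>2) = (?r + \<i> * ?e) * (?r - \<i> * ?e)"
      and f2: "?e ^ 2 + k2 ^ 2 = (k2 + \<i> * ?e) * (k2 - \<i> * ?e)"
      by (simp_all add: algebra_simps power2_eq_square)
    have "(?e ^ 2 + k1 ^ 2) * (?e ^ 2 + k2 ^ 2) = (of_real (\<eta>\<^sup>2 + r\<^sup>2 + \<epsilon> / 2)) ^ 2 - s ^ 2"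
      unfolding k1_sq k2_sq by (simp add: algebra_simps power2_eq_square)
    also have "\<dots> = of_real ((\<eta>\<^sup>2 + r\<^sup>2)\<^sup>2 + \<epsilon> * (\<eta>\<^sup>2 + r\<^sup>2) + \<sigma> * \<tau>) - \<i> * of_real (\<sigma> * \<delta>)"
      unfolding s2 by (simp add: power2_eq_square) (simp add: field_simps)
    finally have X: "(?e ^ 2 + k1 ^ 2) * (?e ^ 2 + k2 ^ 2) =
      of_real ((\<eta>\<^sup>2 + r\<^sup>2)\<^sup>2 + \<epsilon> * (\<eta>\<^sup>2 + r\<^sup>2) + \<sigma> * \<tau>) - \<i> * of_real (\<sigma> * \<delta>)" .
    \<comment> \<open>Here \<i> \<sigma> (-\<i> \<sigma> \<delta>) = \<delta>: the sign \<sigma> in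
      the definition of \<open>s\<close> was placed so that the damping comes out positive on both
      half-lines.\<close>
    have "\<i> * of_real \<sigma> * ((?e ^ 2 + k1 ^ 2) * (?e ^ 2 + k2 ^ 2)) =
      of_real \<delta> + \<i> * of_real (\<tau> + \<sigma> * ((\<eta>\<^sup>2 + r\<^sup>2)\<^sup>2 + \<epsilon> * (\<eta>\<^sup>2 + r\<^sup>2)))"
      unfolding X using sg by (auto simp: algebra_simps)
    then have m: "m \<eta> = ?e\<^sup>2 / of_real (\<eta>\<^sup>2 + r\<^sup>2) * (- \<i> * (of_real (x1 \<eta>) * of_real (x2 \<eta>) * of_real (x3 \<eta>)))
       / (\<i> * of_real \<sigma> * ((?e ^ 2 + k1 ^ 2) * (?e ^ 2 + k2 ^ 2)))"
      unfolding m_def by (simp add: mult_ac)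
    have "p \<eta> = (of_real (x1 \<eta>) * of_real (x2 \<eta>) * of_real (x3 \<eta>) * ?e) / (of_real (\<eta>\<^sup>2 + r\<^sup>2) * (?e ^ 2 + k2 ^ 2))"
      unfolding p_def f0 f2 by (simp add: mult.assoc)
    moreover have "e\<^sup>2 / A * (- \<i> * X) / (\<i> * of_real \<sigma> * (B * D)) = - of_real \<sigma> * (e / B * (X * e / (A * D)))"
      for e A B D X :: complex
      using sg by (auto simp: divide_inverse power2_eq_square algebra_simps)
    ultimately show ?thesis
      unfolding m q_def by simp
  qed
  \<comment> \<open>The action of \<open>p\<close> is absorbed by passing from \<open>f\<close> to
    \<open>b\<close>, at the price 81 in L^1; what remains is a pairing of \<open>b\<close> with
    \<open>g\<close> through \<open>q\<close> alone.\<close>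
  have "AE \<eta> in lborel. m \<eta> * (ft f \<eta> * cnj (ft g \<eta>)) = - of_real \<sigma> * (q \<eta> * ft b \<eta> * cnj (ft g \<eta>))"
    using b(2) by eventually_elim (simp add: m_eq)
  note AE = this
  have [measurable]: "f \<in> borel_measurable borel" "g \<in> borel_measurable borel" "b \<in> borel_measurable borel"
    using f g b by auto
  have [measurable]: "q \<in> borel_measurable borel"
    unfolding q_def by measurable
  have m_meas: "(\<lambda>\<eta>. m \<eta> * (ft f \<eta> * cnj (ft g \<eta>))) \<in> borel_measurable lborel"
    using int by auto
  have "integrable lborel (\<lambda>\<eta>. - of_real \<sigma> * (q \<eta> * ft b \<eta> * cnj (ft g \<eta>)))"
    by (rule integrable_cong_AE_imp[OF int]) (use AE in \<open>auto elim: eventually_mono\<close>)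
  then have qi: "integrable lborel (\<lambda>\<eta>. q \<eta> * ft b \<eta> * cnj (ft g \<eta>))"
    using sg by auto
  have "(LINT \<eta>|lborel. m \<eta> * (ft f \<eta> * cnj (ft g \<eta>))) = (LINT \<eta>|lborel. - of_real \<sigma> * (q \<eta> * ft b \<eta> * cnj (ft g \<eta>)))"
    by (rule integral_cong_AE[OF m_meas _ AE]) measurable
  also have "\<dots> = - of_real \<sigma> * (LINT \<eta>|lborel. q \<eta> * ft b \<eta> * cnj (ft g \<eta>))"
    by (rule integral_mult_right_zero)
  also have "cmod \<dots> = cmod (LINT \<eta>|lborel. q \<eta> * ft b \<eta> * cnj (ft g \<eta>))"
    using sg by (auto simp: norm_mult)
  also have "\<dots> \<le> 2 * pi * (LINT x|lborel. cmod (b x)) * (LINT x|lborel. cmod (g x))"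
    using ft_pairing_resolvent[OF k1 b(1) g] qi unfolding q_def by blast
  also have "\<dots> \<le> 2 * pi * (81 * (LINT x|lborel. cmod (f x))) * (LINT x|lborel. cmod (g x))"
    by (intro mult_right_mono mult_left_mono b(3)) auto
  finally show ?thesis by (simp add: mult_ac)
qed


section \<open>Estimate of the space-time symbol\<close>

text \<open>The square root hidden in \<open>L2_norm_on\<close>. As the inverse of squaring on all
  of [0, \<infinity>] it lets Cauchy-Schwarz and monotonicity be used without separating infinite
  norms.\<close>

definition esqrt :: "ennreal \<Rightarrow> ennreal" where
  "esqrt I = (if I = \<infinity> then \<infinity> else ennreal (sqrt (enn2real I)))"

lemma L2_norm_on_eq: "L2_norm_on A f = esqrt (\<integral>\<^sup>+z\<in>A. ennreal ((cmod (f z))\<^sup>2) \<partial>lborel)"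
  by (simp add: L2_norm_on_def esqrt_def Let_def)

lemma esqrt_power2: "(esqrt x)\<^sup>2 = x"
  by (cases x) (auto simp: esqrt_def ennreal_power power_top_ennreal)

lemma esqrt_of_power2: "esqrt (x\<^sup>2) = x"
  by (cases x) (auto simp: esqrt_def ennreal_power power_top_ennreal)

lemma esqrt_mono: "x \<le> y \<Longrightarrow> esqrt x \<le> esqrt y"
  by (cases x; cases y) (auto simp: esqrt_def top_unique)

lemma esqrt_mult: "esqrt (x * y) = esqrt x * esqrt y"
proof -
  have "esqrt (x * y) = esqrt ((esqrt x * esqrt y)\<^sup>2)"
    by (simp add: power_mult_distrib esqrt_power2)
  then show ?thesis by (simp only: esqrt_of_power2)
qed

lemma le_esqrt_iff: "x \<le> esqrt y \<longleftrightarrow> x\<^sup>2 \<le> y"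
proof
  assume "x \<le> esqrt y"
  from power_mono[OF this, of 2] show "x\<^sup>2 \<le> y"
    by (simp add: esqrt_power2)
next
  assume "x\<^sup>2 \<le> y"
  from esqrt_mono[OF this] show "x \<le> esqrt y"
    by (simp only: esqrt_of_power2)
qed

lemma borel_measurable_esqrt [measurable]: "esqrt \<in> borel_measurable borel"
  unfolding esqrt_def by measurable

lemma nn_integral_mult_le_esqrt:
  assumes [measurable]: "f \<in> borel_measurable M" "g \<in> borel_measurable M"
  shows "(\<integral>\<^sup>+x. f x * g x \<partial>M) \<le> esqrt (\<integral>\<^sup>+x. (f x)\<^sup>2 \<partial>M) * esqrt (\<integral>\<^sup>+x. (g x)\<^sup>2 \<partial>M)"
  unfolding esqrt_mult[symmetric] le_esqrt_iff by (rule Cauchy_Schwarz_nn_integral) measurable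

lemma nn_integral_mult_nn_integral_le:
  fixes A :: "'z \<Rightarrow> 'y \<Rightarrow> ennreal" and B :: "'z \<Rightarrow> 'y \<Rightarrow> ennreal"
  assumes "sigma_finite_measure M" "sigma_finite_measure N"
    and A [measurable]: "(\<lambda>(z, y). A z y) \<in> borel_measurable (M \<Otimes>\<^sub>M N)"
    and B [measurable]: "(\<lambda>(z, y). B z y) \<in> borel_measurable (M \<Otimes>\<^sub>M N)"
  shows "(\<integral>\<^sup>+z. (\<integral>\<^sup>+y. A z y \<partial>N) * (\<integral>\<^sup>+y. B z y \<partial>N) \<partial>M) \<le>
    (\<integral>\<^sup>+y. esqrt (\<integral>\<^sup>+z. (A z y)\<^sup>2 \<partial>M) \<partial>N) * (\<integral>\<^sup>+y. esqrt (\<integral>\<^sup>+z. (B z y)\<^sup>2 \<partial>M) \<partial>N)"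
proof -
  interpret M: sigma_finite_measure M by fact
  interpret N: sigma_finite_measure N by fact
  interpret pair_sigma_finite M N by standard
  have A1 [measurable]: "z \<in> space M \<Longrightarrow> A z \<in> borel_measurable N" for z
    using measurable_Pair2[OF A] by simp
  have B1 [measurable]: "z \<in> space M \<Longrightarrow> B z \<in> borel_measurable N" for z
    using measurable_Pair2[OF B] by simp
  have A2 [measurable]: "y \<in> space N \<Longrightarrow> (\<lambda>z. A z y) \<in> borel_measurable M" for y
    using measurable_Pair1[OF A] by simp
  have B2 [measurable]: "y \<in> space N \<Longrightarrow> (\<lambda>z. B z y) \<in> borel_measurable M" for y
    using measurable_Pair1[OF B] by simp
  let ?B = "\<lambda>z. \<integral>\<^sup>+y. B z y \<partial>N"
  have [measurable]: "?B \<in> borel_measurable M" by measurable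
  have "(\<integral>\<^sup>+z. (\<integral>\<^sup>+y. A z y \<partial>N) * ?B z \<partial>M) = (\<integral>\<^sup>+z. \<integral>\<^sup>+y. A z y * ?B z \<partial>N \<partial>M)"
    by (intro nn_integral_cong nn_integral_multc[symmetric]) measurable
  also have "\<dots> = (\<integral>\<^sup>+y. \<integral>\<^sup>+z. A z y * ?B z \<partial>M \<partial>N)"
    by (rule Fubini'[symmetric]) measurable
  also have "\<dots> \<le> (\<integral>\<^sup>+y. esqrt (\<integral>\<^sup>+z. (A z y)\<^sup>2 \<partial>M) * (\<integral>\<^sup>+y'. esqrt (\<integral>\<^sup>+z. (B z y')\<^sup>2 \<partial>M) \<partial>N) \<partial>N)"
  proof (rule nn_integral_mono)
    fix y assume y: "y \<in> space N"
    have "(\<integral>\<^sup>+z. A z y * ?B z \<partial>M) = (\<integral>\<^sup>+z. \<integral>\<^sup>+y'. A z y * B z y' \<partial>N \<partial>M)"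
      by (intro nn_integral_cong nn_integral_cmult[symmetric]) measurable
    also have "\<dots> = (\<integral>\<^sup>+y'. \<integral>\<^sup>+z. A z y * B z y' \<partial>M \<partial>N)"
      using y by (intro Fubini'[symmetric]) measurable
    also have "\<dots> \<le> (\<integral>\<^sup>+y'. esqrt (\<integral>\<^sup>+z. (A z y)\<^sup>2 \<partial>M) * esqrt (\<integral>\<^sup>+z. (B z y')\<^sup>2 \<partial>M) \<partial>N)"
      by (intro nn_integral_mono nn_integral_mult_le_esqrt A2 B2 y)
    also have "\<dots> = esqrt (\<integral>\<^sup>+z. (A z y)\<^sup>2 \<partial>M) * (\<integral>\<^sup>+y'. esqrt (\<integral>\<^sup>+z. (B z y')\<^sup>2 \<partial>M) \<partial>N)"
      by (rule nn_integral_cmult) measurable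
    finally show "(\<integral>\<^sup>+z. A z y * ?B z \<partial>M) \<le> esqrt (\<integral>\<^sup>+z. (A z y)\<^sup>2 \<partial>M) * (\<integral>\<^sup>+y'. esqrt (\<integral>\<^sup>+z. (B z y')\<^sup>2 \<partial>M) \<partial>N)" .
  qed
  also have "\<dots> = (\<integral>\<^sup>+y. esqrt (\<integral>\<^sup>+z. (A z y)\<^sup>2 \<partial>M) \<partial>N) * (\<integral>\<^sup>+y'. esqrt (\<integral>\<^sup>+z. (B z y')\<^sup>2 \<partial>M) \<partial>N)"
    by (rule nn_integral_multc) measurable
  finally show ?thesis .
qed

section \<open>Separating one space variable from the others\<close>

lemma ft_prod:
  fixes F :: "'a::euclidean_space \<times> 'b::euclidean_space \<Rightarrow> complex"
  assumes F: "integrable lborel F"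
  shows integrable_ft_snd: "integrable lborel (\<lambda>y. ft (\<lambda>\<omega>. F (y, \<omega>)) \<zeta>)"
    and ft_Pair: "ft F (\<eta>, \<zeta>) = ft (\<lambda>y. ft (\<lambda>\<omega>. F (y, \<omega>)) \<zeta>) \<eta>"
proof -
  have [measurable]: "F \<in> borel_measurable borel" using F by auto
  have F': "integrable (lborel \<Otimes>\<^sub>M lborel) F"
    using F by (simp add: lborel_prod)
  have i1: "integrable (lborel \<Otimes>\<^sub>M lborel) (\<lambda>z. cis (- (snd z \<bullet> \<zeta>)) * F z)"
    by (intro integrable_cis_mult F') measurable
  have i2: "integrable (lborel \<Otimes>\<^sub>M lborel) (\<lambda>z. cis (- (z \<bullet> (\<eta>, \<zeta>))) * F z)"
    by (intro integrable_cis_mult F') (simp add: lborel_prod)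
  show "integrable lborel (\<lambda>y. ft (\<lambda>\<omega>. F (y, \<omega>)) \<zeta>)"
    using lborel_pair.integrable_fst'[OF i1] unfolding ft_def by simp
  have "ft F (\<eta>, \<zeta>) = (LINT y|lborel. LINT \<omega>|lborel. cis (- ((y, \<omega>) \<bullet> (\<eta>, \<zeta>))) * F (y, \<omega>))"
    unfolding ft_def lborel_pair.integral_fst'[OF i2] lborel_prod ..
  also have "\<dots> = (LINT y|lborel. LINT \<omega>|lborel. cis (- (y \<bullet> \<eta>)) * (cis (- (\<omega> \<bullet> \<zeta>)) * F (y, \<omega>)))"
    by (intro Bochner_Integration.integral_cong refl)
      (simp add: mult.assoc[symmetric] cis_mult)
  also have "\<dots> = ft (\<lambda>y. ft (\<lambda>\<omega>. F (y, \<omega>)) \<zeta>) \<eta>"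
    unfolding ft_def by simp
  finally show "ft F (\<eta>, \<zeta>) = ft (\<lambda>y. ft (\<lambda>\<omega>. F (y, \<omega>)) \<zeta>) \<eta>" .
qed

text \<open>Exchanging the time variable with the \<open>j\<close>-th space variable keeps the type \<open>real \<times> (real ^ 'n)\<close>, so that the splitting
  \<open>x = (x\<^sub>j, x')\<close> needs no space of dimension \<open>n - 1\<close>.\<close>

definition swap_time :: "'n::finite \<Rightarrow> real \<times> (real ^ 'n) \<Rightarrow> real \<times> (real ^ 'n)" where
  "swap_time j z = (snd z $ j, \<chi> i. if i = j then fst z else snd z $ i)"

lemma swap_time_swap_time [simp]: "swap_time j (swap_time j z) = z"
  by (cases z) (auto simp: swap_time_def vec_eq_iff)

lemma linear_swap_time: "linear (swap_time j)"
  by (rule linearI) (auto simp: swap_time_def vec_eq_iff)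

lemma borel_measurable_swap_time [measurable]: "swap_time j \<in> borel_measurable borel"
  using linear_continuous_on[OF linear_conv_bounded_linear[THEN iffD1, OF linear_swap_time[of j]], of UNIV]
  by (rule borel_measurable_continuous_onI)

text \<open>Being symmetric and an involution, the exchange is orthogonal; hence it commutes with
  the Fourier transform.\<close>

lemma inner_swap_time: "swap_time j a \<bullet> b = a \<bullet> swap_time j b"
proof -
  have "swap_time j a \<bullet> b = snd a $ j * fst b + (fst a * snd b $ j + (\<Sum>i\<in>UNIV - {j}. snd a $ i * snd b $ i))"
    unfolding swap_time_def inner_prod_def inner_vec_def
    by (subst sum.remove[of _ j]) (auto intro!: sum.cong)
  moreover have "a \<bullet> swap_time j b = fst a * snd b $ j + (snd a $ j * fst b + (\<Sum>i\<in>UNIV - {j}. snd a $ i * snd b $ i))"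
    unfolding swap_time_def inner_prod_def inner_vec_def
    by (subst sum.remove[of _ j]) (auto intro!: sum.cong)
  ultimately show ?thesis by simp
qed

lemma swap_time_Basis: "b \<in> Basis \<Longrightarrow> swap_time j b \<in> Basis"
proof -
  assume "b \<in> Basis"
  then consider "b = (1, 0)" | i where "b = (0, axis i 1)"
    by (auto simp: Basis_prod_def Basis_vec_def)
  then show ?thesis
  proof cases
    case 1
    then have "swap_time j b = (0, axis j 1)"
      by (auto simp: swap_time_def vec_eq_iff axis_def)
    then show ?thesis by (auto simp: Basis_prod_def Basis_vec_def)
  next
    case 2
    then have "swap_time j b = (if i = j then (1, 0) else (0, axis i 1))"
      by (auto simp: swap_time_def vec_eq_iff axis_def)
    then show ?thesis by (auto simp: Basis_prod_def Basis_vec_def)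
  qed
qed

lemma swap_time_image_Basis: "swap_time j ` Basis = Basis"
proof
  show "swap_time j ` Basis \<subseteq> Basis" using swap_time_Basis by auto
  show "Basis \<subseteq> swap_time j ` Basis"
    using swap_time_Basis by (intro subsetI image_eqI[of _ _ "swap_time j _"]) auto
qed

text \<open>Lebesgue measure is determined by boxes, and a permutation of the standard basis only
  permutes the side lengths of a box.\<close>

lemma distr_swap_time: "distr lborel borel (swap_time j) = lborel"
proof (rule lborel_eqI[symmetric])
  fix l u :: "real \<times> (real ^ 'a)"
  assume le: "\<And>b. b \<in> Basis \<Longrightarrow> l \<bullet> b \<le> u \<bullet> b"
  have inj: "inj_on (swap_time j) Basis"
    by (rule inj_on_inverseI[of _ "swap_time j"]) simp
  have "swap_time j -` box l u = box (swap_time j l) (swap_time j u)"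
  proof -
    have "(\<forall>b\<in>Basis. P (swap_time j b)) \<longleftrightarrow> (\<forall>b\<in>Basis. P b)" for P :: "real \<times> (real ^ 'a) \<Rightarrow> bool"
      using swap_time_image_Basis[of j] by (metis imageE imageI)
    from this[of "\<lambda>b. l \<bullet> b < z \<bullet> swap_time j b \<and> z \<bullet> swap_time j b < u \<bullet> b" for z]
    show ?thesis unfolding box_def by (auto simp: inner_swap_time)
  qed
  then have "emeasure (distr lborel borel (swap_time j)) (box l u) = emeasure lborel (box (swap_time j l) (swap_time j u))"
    by (simp add: emeasure_distr)
  also have "\<dots> = (\<Prod>b\<in>Basis. (swap_time j u - swap_time j l) \<bullet> b)"
    using le by (auto simp: emeasure_lborel_box_eq inner_swap_time swap_time_Basis)
  also have "(\<Prod>b\<in>Basis. (swap_time j u - swap_time j l) \<bullet> b) = (\<Prod>b\<in>Basis. (u - l) \<bullet> swap_time j b)"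
    by (simp add: inner_diff_left inner_swap_time)
  also have "\<dots> = (\<Prod>b\<in>swap_time j ` Basis. (u - l) \<bullet> b)"
    by (simp add: prod.reindex[OF inj])
  finally show "emeasure (distr lborel borel (swap_time j)) (box l u) = (\<Prod>b\<in>Basis. (u - l) \<bullet> b)"
    by (simp only: swap_time_image_Basis)
qed simp

lemma integrable_swap_time:
  fixes f :: "_ \<Rightarrow> complex"
  assumes "integrable lborel f"
  shows "integrable lborel (\<lambda>z. f (swap_time j z))"
proof -
  have [measurable]: "f \<in> borel_measurable borel" using assms by auto
  show ?thesis
    using assms by (subst integrable_distr_eq[of "swap_time j" lborel borel f, symmetric])
      (simp_all add: distr_swap_time)
qed

lemma integral_swap_time:
  fixes f :: "_ \<Rightarrow> complex"
  assumes [measurable]: "f \<in> borel_measurable borel"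
  shows "(LINT z|lborel. f (swap_time j z)) = (LINT z|lborel. f z)"
  by (subst integral_distr[of "swap_time j" lborel borel f, symmetric]) (simp_all add: distr_swap_time)

lemma nn_integral_swap_time:
  assumes [measurable]: "f \<in> borel_measurable borel"
  shows "(\<integral>\<^sup>+z. f (swap_time j z) \<partial>lborel) = (\<integral>\<^sup>+z. f z \<partial>lborel)"
  by (subst nn_integral_distr[of "swap_time j" lborel borel f, symmetric]) (simp_all add: distr_swap_time)

lemma ft_swap_time:
  assumes [measurable]: "F \<in> borel_measurable borel"
  shows "ft (\<lambda>z. F (swap_time j z)) z = ft F (swap_time j z)"
proof -
  have "ft F (swap_time j z) = (LINT x|lborel. cis (- (swap_time j x \<bullet> swap_time j z)) * F (swap_time j x))"
    unfolding ft_def by (rule integral_swap_time[symmetric]) measurable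
  then show ?thesis
    by (simp add: ft_def inner_swap_time)
qed

text \<open>The mixed norm L^1(dx_j; L^2) with the L^2 norm over time and the remaining space
  variables: after the exchange \<open>y\<close> is x_j, and \<open>\<omega>\<close> carries time in
  its j-th slot.\<close>

definition slab_norm :: "'n::finite \<Rightarrow> (real \<times> (real ^ 'n) \<Rightarrow> complex) \<Rightarrow> ennreal" where
  "slab_norm j F = (\<integral>\<^sup>+y. esqrt (\<integral>\<^sup>+\<omega>. ennreal ((cmod (F (swap_time j (y, \<omega>))))\<^sup>2) \<partial>lborel) \<partial>lborel)"

lemma borel_measurable_ft_snd [measurable]:
  fixes F :: "'a::euclidean_space \<times> 'b::euclidean_space \<Rightarrow> complex"
  assumes [measurable]: "F \<in> borel_measurable borel"
  shows "(\<lambda>p. ft (\<lambda>\<omega>. F (snd p, \<omega>)) (fst p)) \<in> borel_measurable (borel \<Otimes>\<^sub>M borel)"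
  unfolding ft_def by measurable

text \<open>The multiplier from the damped source to the damped third derivative, up to the factor
  -\<i> \<sigma>, which reappears in \<open>pairing_identity\<close>.\<close>

definition symbol :: "real \<Rightarrow> real \<Rightarrow> real \<Rightarrow> 'n::finite \<Rightarrow> 'n \<Rightarrow> 'n \<Rightarrow> real \<times> (real ^ 'n) \<Rightarrow> complex" where
  "symbol \<epsilon> \<sigma> \<delta> i1 i2 i3 z = \<i> * of_real (snd z $ i1) * (\<i> * of_real (snd z $ i2)) * (\<i> * of_real (snd z $ i3)) /
     (of_real \<delta> + \<i> * of_real (fst z + \<sigma> * ((norm (snd z)) ^ 4 + \<epsilon> * (norm (snd z))\<^sup>2)))"

lemma borel_measurable_space_time [measurable]:
  shows "(\<lambda>z::real \<times> (real ^ 'n::finite). snd z $ i) \<in> borel_measurable borel"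
    and "(\<lambda>z::real \<times> (real ^ 'n::finite). norm (snd z)) \<in> borel_measurable borel"
    and "(\<lambda>z::real \<times> (real ^ 'n::finite). fst z) \<in> borel_measurable borel"
  by (intro borel_measurable_continuous_onI continuous_intros)+

lemma borel_measurable_symbol [measurable]: "symbol \<epsilon> \<sigma> \<delta> i1 i2 i3 \<in> borel_measurable borel"
  unfolding symbol_def by measurable

lemma norm_vec_remove: "(norm x)\<^sup>2 = (x $ j)\<^sup>2 + (\<Sum>i\<in>UNIV - {j}. (x $ i)\<^sup>2)"
  for x :: "real ^ 'n::finite"
  unfolding norm_vec_def L2_set_def
  by (subst real_sqrt_pow2) (auto simp: sum_nonneg sum.remove[of UNIV j])

lemma directional_estimate:
  fixes F G :: "real \<times> (real ^ 'n::finite) \<Rightarrow> complex" and j i1 i2 i3 :: 'n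
  assumes e: "0 \<le> \<epsilon>" and sg: "\<sigma> = 1 \<or> \<sigma> = - 1" and d: "0 < \<delta>"
    and F: "integrable lborel F" and G: "integrable lborel G"
  defines "H \<equiv> \<lambda>z. of_real ((snd z $ j)\<^sup>2 / (norm (snd z))\<^sup>2) * symbol \<epsilon> \<sigma> \<delta> i1 i2 i3 z * (ft F z * cnj (ft G z))"
  assumes H: "integrable lborel H"
  shows "ennreal (cmod (LINT z|lborel. H z)) \<le>
    ennreal (162 * pi * (2 * pi) ^ CARD('n)) * slab_norm j F * slab_norm j G"
proof -
  \<comment> \<open>The partial transform in all variables except x_j, at frozen frequencies
    \<zeta>; the slot \<zeta>_j holds the time frequency \<tau>.\<close>
  define A where "A = (\<lambda>K :: real \<times> (real ^ 'n) \<Rightarrow> complex. \<lambda>\<zeta> y. ft (\<lambda>\<omega>. K (swap_time j (y, \<omega>))) \<zeta>)"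
  have [measurable]: "F \<in> borel_measurable borel" "G \<in> borel_measurable borel" "H \<in> borel_measurable borel"
    using F G H by auto
  have A_int: "integrable lborel (A K \<zeta>)" if "integrable lborel K" for K \<zeta>
    unfolding A_def using integrable_ft_snd[OF integrable_swap_time[OF that, of j]] by simp
  have ft_A: "ft K (swap_time j (\<eta>, \<zeta>)) = ft (A K \<zeta>) \<eta>" if "integrable lborel K" for K \<eta> \<zeta>
  proof -
    have [measurable]: "K \<in> borel_measurable borel" using that by auto
    show ?thesis unfolding A_def using ft_Pair[OF integrable_swap_time[OF that, of j]]
      by (simp add: ft_swap_time)
  qed
  have A_meas: "(\<lambda>p. A K (fst p) (snd p)) \<in> borel_measurable (borel \<Otimes>\<^sub>M borel)" if "integrable lborel K" for K
  proof -
    have [measurable]: "K \<in> borel_measurable borel" using that by auto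
    show ?thesis unfolding A_def
      by (rule borel_measurable_ft_snd[of "\<lambda>z. K (swap_time j z)"]) measurable
  qed
  define m where "m \<zeta> \<eta> = of_real ((snd (swap_time j (\<eta>, \<zeta>)) $ j)\<^sup>2 / (norm (snd (swap_time j (\<eta>, \<zeta>))))\<^sup>2)
    * symbol \<epsilon> \<sigma> \<delta> i1 i2 i3 (swap_time j (\<eta>, \<zeta>))" for \<zeta> \<eta>
  have H_eq: "H (swap_time j (\<eta>, \<zeta>)) = m \<zeta> \<eta> * (ft (A F \<zeta>) \<eta> * cnj (ft (A G \<zeta>) \<eta>))" for \<eta> \<zeta>
    by (simp add: H_def m_def ft_A[OF F] ft_A[OF G] mult.assoc)
  have Hi: "integrable (lborel \<Otimes>\<^sub>M lborel) (\<lambda>(\<eta>, \<zeta>). H (swap_time j (\<eta>, \<zeta>)))"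
    unfolding lborel_prod using integrable_swap_time[OF H, of j] by (simp add: case_prod_unfold)
  have inner: "cmod (LINT \<eta>|lborel. H (swap_time j (\<eta>, \<zeta>))) \<le>
      162 * pi * (LINT y|lborel. cmod (A F \<zeta> y)) * (LINT y|lborel. cmod (A G \<zeta> y))"
    if int: "integrable lborel (\<lambda>\<eta>. H (swap_time j (\<eta>, \<zeta>)))" for \<zeta>
  proof -
    define r where "r = sqrt (\<Sum>i\<in>UNIV - {j}. (\<zeta> $ i)\<^sup>2)"
    have r2: "r\<^sup>2 = (\<Sum>i\<in>UNIV - {j}. (\<zeta> $ i)\<^sup>2)"
      by (simp add: r_def sum_nonneg)
    have r0: "0 \<le> r" by (simp add: r_def sum_nonneg)
    define x where "x i \<eta> = (if i = j then \<eta> else \<zeta> $ i)" for i \<eta>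
    have sw: "snd (swap_time j (\<eta>, \<zeta>)) $ i = x i \<eta>" "fst (swap_time j (\<eta>, \<zeta>)) = \<zeta> $ j" "x j \<eta> = \<eta>" for i \<eta>
      by (simp_all add: x_def swap_time_def)
    have nrm: "(norm (snd (swap_time j (\<eta>, \<zeta>))))\<^sup>2 = \<eta>\<^sup>2 + r\<^sup>2" for \<eta>
      unfolding norm_vec_remove[of _ j] r2 by (simp add: swap_time_def)
    have nrm4: "norm (snd (swap_time j (\<eta>, \<zeta>))) ^ 4 = (\<eta>\<^sup>2 + r\<^sup>2)\<^sup>2" for \<eta>
      unfolding nrm[symmetric] by (simp flip: power_mult)
    have x: "coordinate_or_const r (x i)" for i
    proof (cases "i = j")
      case True
      then show ?thesis by (simp add: coordinate_or_const_def x_def fun_eq_iff)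
    next
      case False
      then have "(\<zeta> $ i)\<^sup>2 \<le> r\<^sup>2"
        unfolding r2 by (intro member_le_sum) auto
      then have "\<bar>\<zeta> $ i\<bar> \<le> r"
        using r0 by (simp add: abs_le_square_iff[symmetric])
      then show ?thesis
        unfolding coordinate_or_const_def by (intro disjI2 exI[of _ "\<zeta> $ i"]) (simp add: False x_def fun_eq_iff)
    qed
    have m: "m \<zeta> = (\<lambda>\<eta>. of_real (\<eta>\<^sup>2 / (\<eta>\<^sup>2 + r\<^sup>2)) * (\<i> * of_real (x i1 \<eta>) * (\<i> * of_real (x i2 \<eta>)) * (\<i> * of_real (x i3 \<eta>)))
      / (of_real \<delta> + \<i> * of_real (\<zeta> $ j + \<sigma> * ((\<eta>\<^sup>2 + r\<^sup>2)\<^sup>2 + \<epsilon> * (\<eta>\<^sup>2 + r\<^sup>2)))))"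
      by (rule ext) (simp only: m_def symbol_def nrm nrm4 sw times_divide_eq_right)
    show ?thesis
      using directional_symbol_estimate[OF e sg d r0 x[of i1] x[of i2] x[of i3] A_int[OF F, of \<zeta>] A_int[OF G, of \<zeta>], of "\<zeta> $ j"] int
      unfolding H_eq m by blast
  qed
  \<comment> \<open>Bessel in \<open>\<omega>\<close> for almost every fixed \<open>y\<close>. Each
    of the two functions pays the square root of (2 pi)^n, which together give the power in the
    constant.\<close>
  have slab: "(\<integral>\<^sup>+y. esqrt (\<integral>\<^sup>+\<zeta>. (ennreal (cmod (A K \<zeta> y)))\<^sup>2 \<partial>lborel) \<partial>lborel)
      \<le> esqrt (ennreal ((2 * pi) ^ CARD('n))) * slab_norm j K" if K: "integrable lborel K" for K
  proof -
    have [measurable]: "K \<in> borel_measurable borel" using K by auto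
    have "integrable (lborel \<Otimes>\<^sub>M lborel) (\<lambda>z. K (swap_time j z))"
      unfolding lborel_prod by (rule integrable_swap_time[OF K])
    from lborel_pair.AE_integrable_fst'[OF this]
    have "AE y in lborel. esqrt (\<integral>\<^sup>+\<zeta>. (ennreal (cmod (A K \<zeta> y)))\<^sup>2 \<partial>lborel) \<le>
       esqrt (ennreal ((2 * pi) ^ CARD('n))) * esqrt (\<integral>\<^sup>+\<omega>. ennreal ((cmod (K (swap_time j (y, \<omega>))))\<^sup>2) \<partial>lborel)"
    proof eventually_elim
      case (elim y)
      have "(\<integral>\<^sup>+\<zeta>. (ennreal (cmod (A K \<zeta> y)))\<^sup>2 \<partial>lborel) \<le>
        ennreal ((2 * pi) ^ DIM(real ^ 'n)) * (\<integral>\<^sup>+\<omega>. ennreal ((cmod (K (swap_time j (y, \<omega>))))\<^sup>2) \<partial>lborel)"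
        using bessel[OF elim] by (simp add: A_def ennreal_power)
      from esqrt_mono[OF this] show ?case
        by (simp add: esqrt_mult)
    qed
    then have "(\<integral>\<^sup>+y. esqrt (\<integral>\<^sup>+\<zeta>. (ennreal (cmod (A K \<zeta> y)))\<^sup>2 \<partial>lborel) \<partial>lborel) \<le>
       (\<integral>\<^sup>+y. esqrt (ennreal ((2 * pi) ^ CARD('n))) * esqrt (\<integral>\<^sup>+\<omega>. ennreal ((cmod (K (swap_time j (y, \<omega>))))\<^sup>2) \<partial>lborel) \<partial>lborel)"
      by (rule nn_integral_mono_AE)
    also have "\<dots> = esqrt (ennreal ((2 * pi) ^ CARD('n))) * slab_norm j K"
      unfolding slab_norm_def by (rule nn_integral_cmult) measurable
    finally show ?thesis .
  qed
  have nn: "ennreal (LINT y|lborel. cmod (A K \<zeta> y)) = (\<integral>\<^sup>+y. ennreal (cmod (A K \<zeta> y)) \<partial>lborel)"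
    if "integrable lborel K" for K \<zeta>
    by (rule nn_integral_eq_integral[symmetric]) (use A_int[OF that] in auto)
  have meas: "(\<lambda>(\<zeta>, y). ennreal (cmod (A K \<zeta> y))) \<in> borel_measurable (lborel \<Otimes>\<^sub>M lborel)"
    if "integrable lborel K" for K
    using A_meas[OF that] by (simp add: case_prod_unfold)
  have "(LINT z|lborel. H z) = (LINT z|(lborel \<Otimes>\<^sub>M lborel). (\<lambda>(\<eta>, \<zeta>). H (swap_time j (\<eta>, \<zeta>))) z)"
    unfolding lborel_prod by (simp add: case_prod_unfold integral_swap_time)
  also have "\<dots> = (LINT \<zeta>|lborel. LINT \<eta>|lborel. H (swap_time j (\<eta>, \<zeta>)))"
    by (rule lborel_pair.integral_snd[OF Hi, symmetric])
  finally have "ennreal (cmod (LINT z|lborel. H z)) \<le> (\<integral>\<^sup>+\<zeta>. ennreal (cmod (LINT \<eta>|lborel. H (swap_time j (\<eta>, \<zeta>)))) \<partial>lborel)"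
    by (simp only: norm_integral_le_nn_integral)
  also have "\<dots> \<le> (\<integral>\<^sup>+\<zeta>. ennreal (162 * pi) * ((\<integral>\<^sup>+y. ennreal (cmod (A F \<zeta> y)) \<partial>lborel) * (\<integral>\<^sup>+y. ennreal (cmod (A G \<zeta> y)) \<partial>lborel)) \<partial>lborel)"
  proof (rule nn_integral_mono_AE)
    from lborel_pair.AE_integrable_snd[OF Hi]
    show "AE \<zeta> in lborel. ennreal (cmod (LINT \<eta>|lborel. H (swap_time j (\<eta>, \<zeta>)))) \<le>
      ennreal (162 * pi) * ((\<integral>\<^sup>+y. ennreal (cmod (A F \<zeta> y)) \<partial>lborel) * (\<integral>\<^sup>+y. ennreal (cmod (A G \<zeta> y)) \<partial>lborel))"
    proof eventually_elim
      case (elim \<zeta>)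
      have "ennreal (cmod (LINT \<eta>|lborel. H (swap_time j (\<eta>, \<zeta>)))) \<le>
        ennreal (162 * pi * (LINT y|lborel. cmod (A F \<zeta> y)) * (LINT y|lborel. cmod (A G \<zeta> y)))"
        by (rule ennreal_leI[OF inner[OF elim]])
      then show ?case
        unfolding nn[OF F, symmetric] nn[OF G, symmetric] by (simp add: ennreal_mult mult.assoc)
    qed
  qed
  also have "\<dots> = ennreal (162 * pi) * (\<integral>\<^sup>+\<zeta>. (\<integral>\<^sup>+y. ennreal (cmod (A F \<zeta> y)) \<partial>lborel) * (\<integral>\<^sup>+y. ennreal (cmod (A G \<zeta> y)) \<partial>lborel) \<partial>lborel)"
  proof (rule nn_integral_cmult)
    have [measurable]: "(\<lambda>(\<zeta>, y). ennreal (cmod (A F \<zeta> y))) \<in> borel_measurable (lborel \<Otimes>\<^sub>M lborel)"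
      "(\<lambda>(\<zeta>, y). ennreal (cmod (A G \<zeta> y))) \<in> borel_measurable (lborel \<Otimes>\<^sub>M lborel)"
      by (rule meas[OF F], rule meas[OF G])
    show "(\<lambda>\<zeta>. (\<integral>\<^sup>+y. ennreal (cmod (A F \<zeta> y)) \<partial>lborel) * (\<integral>\<^sup>+y. ennreal (cmod (A G \<zeta> y)) \<partial>lborel)) \<in> borel_measurable lborel"
      by measurable
  qed
  also have "\<dots> \<le> ennreal (162 * pi) * ((\<integral>\<^sup>+y. esqrt (\<integral>\<^sup>+\<zeta>. (ennreal (cmod (A F \<zeta> y)))\<^sup>2 \<partial>lborel) \<partial>lborel)
      * (\<integral>\<^sup>+y. esqrt (\<integral>\<^sup>+\<zeta>. (ennreal (cmod (A G \<zeta> y)))\<^sup>2 \<partial>lborel) \<partial>lborel))"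
    by (intro mult_left_mono nn_integral_mult_nn_integral_le meas F G sigma_finite_lborel) simp
  also have "\<dots> \<le> ennreal (162 * pi) * ((esqrt (ennreal ((2 * pi) ^ CARD('n))) * slab_norm j F) * (esqrt (ennreal ((2 * pi) ^ CARD('n))) * slab_norm j G))"
    by (intro mult_left_mono mult_mono slab F G) auto
  also have "\<dots> = ennreal (162 * pi) * (esqrt (ennreal ((2 * pi) ^ CARD('n))))\<^sup>2 * slab_norm j F * slab_norm j G"
    by (simp add: power2_eq_square mult_ac)
  also have "ennreal (162 * pi) * (esqrt (ennreal ((2 * pi) ^ CARD('n))))\<^sup>2 = ennreal (162 * pi * (2 * pi) ^ CARD('n))"
    by (simp only: esqrt_power2) (simp add: ennreal_mult)
  finally show ?thesis .
qed

lemma AE_space_frequency_nonzero: "AE z in lborel. snd (z :: real \<times> (real ^ 'n::finite)) \<noteq> 0"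
proof -
  have "((0, axis i 1) :: real \<times> (real ^ 'n)) \<in> Basis" for i
    by (auto simp: Basis_prod_def Basis_vec_def)
  from AE_lborel_inner_neq[OF this, of _ 0] show ?thesis
    by eventually_elim auto
qed

text \<open>The weights are at most 1, so every directional piece inherits integrability from the
  full integrand.\<close>

lemma symbol_estimate:
  fixes F G :: "real \<times> (real ^ 'n::finite) \<Rightarrow> complex"
  assumes e: "0 \<le> \<epsilon>" and sg: "\<sigma> = 1 \<or> \<sigma> = - 1" and d: "0 < \<delta>"
    and F: "integrable lborel F" and G: "integrable lborel G"
    and H: "integrable lborel (\<lambda>z. symbol \<epsilon> \<sigma> \<delta> i1 i2 i3 z * (ft F z * cnj (ft G z)))"
  shows "ennreal (cmod (LINT z|lborel. symbol \<epsilon> \<sigma> \<delta> i1 i2 i3 z * (ft F z * cnj (ft G z)))) \<le>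
    (\<Sum>j\<in>UNIV. ennreal (162 * pi * (2 * pi) ^ CARD('n)) * slab_norm j F * slab_norm j G)"
proof -
  let ?H = "\<lambda>z. symbol \<epsilon> \<sigma> \<delta> i1 i2 i3 z * (ft F z * cnj (ft G z))"
  define K where "K j z = of_real ((snd z $ j)\<^sup>2 / (norm (snd z))\<^sup>2) * symbol \<epsilon> \<sigma> \<delta> i1 i2 i3 z * (ft F z * cnj (ft G z))" for j z
  have [measurable]: "F \<in> borel_measurable borel" "G \<in> borel_measurable borel"
    using F G by auto
  have [measurable]: "K j \<in> borel_measurable borel" for j
  proof -
    have [measurable]: "(\<lambda>z::real \<times> (real ^ 'n). (snd z $ j)\<^sup>2 / (norm (snd z))\<^sup>2) \<in> borel_measurable borel"
      by measurable
    show ?thesis unfolding K_def by measurable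
  qed
  have K: "integrable lborel (K j)" for j
  proof (rule Bochner_Integration.integrable_bound[OF H])
    have "(snd z $ j)\<^sup>2 / (norm (snd z))\<^sup>2 \<le> 1" for z :: "real \<times> (real ^ 'n)"
    proof -
      have "(snd z $ j)\<^sup>2 \<le> (norm (snd z))\<^sup>2"
        by (simp add: norm_vec_remove[of _ j] sum_nonneg)
      then show ?thesis by (auto simp: divide_le_eq_1)
    qed
    then have "cmod (of_real ((snd z $ j)\<^sup>2 / (norm (snd z))\<^sup>2)) \<le> 1" for z :: "real \<times> (real ^ 'n)"
      by (simp only: norm_of_real) simp
    from mult_right_mono[OF this norm_ge_zero]
    show "AE z in lborel. norm (K j z) \<le> norm (?H z)"
      unfolding K_def mult.assoc norm_mult[of "of_real (_ / _)"] by (intro AE_I2) simp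
  qed simp
  \<comment> \<open>At \<xi> = 0 all weights are 0 / 0 = 0 and do not sum to 1; that set is
    null.\<close>
  have "AE z in lborel. ?H z = (\<Sum>j\<in>UNIV. K j z)"
    using AE_space_frequency_nonzero
  proof eventually_elim
    case (elim z)
    have "(\<Sum>j\<in>UNIV. (snd z $ j)\<^sup>2 / (norm (snd z))\<^sup>2) = 1"
      using elim by (simp add: sum_divide_distrib[symmetric] norm_vec_def L2_set_def sum_nonneg)
         (simp add: vec_eq_iff sum_nonneg_eq_0_iff)
    then have "(\<Sum>j\<in>UNIV. complex_of_real ((snd z $ j)\<^sup>2 / (norm (snd z))\<^sup>2)) = 1"
      by (metis of_real_1 of_real_sum)
    then show ?case
      unfolding K_def sum_distrib_right[symmetric] by simp
  qed
  then have "(LINT z|lborel. ?H z) = (LINT z|lborel. (\<Sum>j\<in>UNIV. K j z))"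
    by (intro integral_cong_AE) measurable
  also have "\<dots> = (\<Sum>j\<in>UNIV. LINT z|lborel. K j z)"
    by (rule Bochner_Integration.integral_sum) (rule K)
  finally have "cmod (LINT z|lborel. ?H z) \<le> (\<Sum>j\<in>UNIV. cmod (LINT z|lborel. K j z))"
    by (simp only: norm_sum)
  then have "ennreal (cmod (LINT z|lborel. ?H z)) \<le> ennreal (\<Sum>j\<in>UNIV. cmod (LINT z|lborel. K j z))"
    by (rule ennreal_leI)
  also have "\<dots> = (\<Sum>j\<in>UNIV. ennreal (cmod (LINT z|lborel. K j z)))"
    by (rule sum_ennreal[symmetric]) simp
  also have "\<dots> \<le> (\<Sum>j\<in>UNIV. ennreal (162 * pi * (2 * pi) ^ CARD('n)) * slab_norm j F * slab_norm j G)"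
    using K unfolding K_def
    by (intro sum_mono directional_estimate e sg d F G)
  finally show ?thesis .
qed


section \<open>The equation in Fourier variables\<close>

lemma has_vector_derivative_iff_quotient:
  fixes f :: "real \<Rightarrow> 'b::real_normed_vector"
  shows "(f has_vector_derivative D) (at t) \<longleftrightarrow> ((\<lambda>s. (f s - f t) /\<^sub>R (s - t)) \<longlongrightarrow> D) (at t)"
proof -
  have "(f has_vector_derivative D) (at t) \<longleftrightarrow>
    ((\<lambda>s. norm (f s - f t - (s - t) *\<^sub>R D) / norm (s - t)) \<longlongrightarrow> 0) (at t)"
    unfolding has_vector_derivative_def has_derivative_iff_norm
    by (simp add: bounded_linear_scaleR_left)
  also have "\<dots> \<longleftrightarrow> ((\<lambda>s. norm ((f s - f t) /\<^sub>R (s - t) - D)) \<longlongrightarrow> 0) (at t)"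
  proof (rule filterlim_cong[OF refl refl])
    show "\<forall>\<^sub>F s in at t. norm (f s - f t - (s - t) *\<^sub>R D) / norm (s - t) = norm ((f s - f t) /\<^sub>R (s - t) - D)"
      unfolding eventually_at_filter
    proof (intro always_eventually allI impI)
      fix s assume "s \<noteq> t"
      then have "(f s - f t) /\<^sub>R (s - t) - D = (f s - f t - (s - t) *\<^sub>R D) /\<^sub>R (s - t)"
        by (simp add: scaleR_diff_right)
      then show "norm (f s - f t - (s - t) *\<^sub>R D) / norm (s - t) = norm ((f s - f t) /\<^sub>R (s - t) - D)"
        by (simp add: divide_inverse mult.commute)
    qed
  qed
  also have "\<dots> \<longleftrightarrow> ((\<lambda>s. (f s - f t) /\<^sub>R (s - t)) \<longlongrightarrow> D) (at t)"
    by (simp add: tendsto_norm_zero_iff LIM_zero_iff)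
  finally show ?thesis .
qed

text \<open>Dominated convergence along sequences, with the difference quotients bounded by
  \<open>D\<close> through the mean value inequality. Derivatives are controlled only within
  distance 1 of \<open>t\<close>, to suit bounds that are locally uniform in time.\<close>

lemma has_vector_derivative_integral:
  fixes f g :: "real \<Rightarrow> 'a \<Rightarrow> complex"
  assumes int: "\<And>s. \<bar>s - t\<bar> \<le> 1 \<Longrightarrow> integrable M (f s)"
    and der: "\<And>s x. \<bar>s - t\<bar> \<le> 1 \<Longrightarrow> ((\<lambda>s. f s x) has_vector_derivative g s x) (at s)"
    and bd: "\<And>s x. \<bar>s - t\<bar> \<le> 1 \<Longrightarrow> cmod (g s x) \<le> D x" and D: "integrable M D"
    and gm [measurable]: "g t \<in> borel_measurable M"
  shows "((\<lambda>s. LINT x|M. f s x) has_vector_derivative (LINT x|M. g t x)) (at t)"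
  unfolding has_vector_derivative_iff_quotient tendsto_at_iff_sequentially
proof (intro allI impI)
  fix X :: "nat \<Rightarrow> real"
  assume X: "\<forall>i. X i \<in> UNIV - {t}" and lim: "X \<longlonglongrightarrow> t"
  obtain N where N: "\<And>i. N \<le> i \<Longrightarrow> \<bar>X i - t\<bar> \<le> 1"
    using LIMSEQ_D[OF lim, of 1] by (metis less_eq_real_def real_norm_def zero_less_one)
  \<comment> \<open>Dropping finitely many terms keeps the sequence in the neighbourhood where the
    bound holds.\<close>
  define Y where "Y i = X (i + N)" for i
  have Y: "\<bar>Y i - t\<bar> \<le> 1" "Y i \<noteq> t" for i
    using N X by (auto simp: Y_def)
  have Ylim: "Y \<longlonglongrightarrow> t"
    unfolding Y_def by (rule LIMSEQ_ignore_initial_segment[OF lim])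
  have meas: "f s \<in> borel_measurable M" if "\<bar>s - t\<bar> \<le> 1" for s
    using int[OF that] by auto
  have "(\<lambda>i. LINT x|M. (f (Y i) x - f t x) /\<^sub>R (Y i - t)) \<longlonglongrightarrow> (LINT x|M. g t x)"
  proof (rule integral_dominated_convergence[OF _ _ D])
    show "(\<lambda>x. (f (Y i) x - f t x) /\<^sub>R (Y i - t)) \<in> borel_measurable M" for i
      using meas[OF Y(1)[of i]] meas[of t] by simp
    have "((\<lambda>s. (f s x - f t x) /\<^sub>R (s - t)) \<longlongrightarrow> g t x) (at t)" for x
      using der[of t x] by (simp add: has_vector_derivative_iff_quotient)
    then show "AE x in M. (\<lambda>i. (f (Y i) x - f t x) /\<^sub>R (Y i - t)) \<longlonglongrightarrow> g t x"
      using Y(2) Ylim unfolding tendsto_at_iff_sequentially comp_def by auto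
    show "AE x in M. norm ((f (Y i) x - f t x) /\<^sub>R (Y i - t)) \<le> D x" for i
    proof (rule AE_I2)
      fix x
      have "cmod (f (Y i) x - f t x) \<le> D x * norm (Y i - t)"
      proof (rule differentiable_bound[where S="{t - 1..t + 1}" and f'="\<lambda>s h. h *\<^sub>R g s x"])
        show "((\<lambda>s. f s x) has_derivative (\<lambda>h. h *\<^sub>R g s x)) (at s within {t - 1..t + 1})" if "s \<in> {t - 1..t + 1}" for s
        proof (rule has_derivative_at_withinI)
          have "\<bar>s - t\<bar> \<le> 1" using that unfolding atLeastAtMost_iff by linarith
          from der[OF this] show "((\<lambda>s. f s x) has_derivative (\<lambda>h. h *\<^sub>R g s x)) (at s)"
            unfolding has_vector_derivative_def .
        qed
        show "onorm (\<lambda>h. h *\<^sub>R g s x) \<le> D x" if "s \<in> {t - 1..t + 1}" for s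
        proof (rule onorm_le)
          have "\<bar>s - t\<bar> \<le> 1" using that unfolding atLeastAtMost_iff by linarith
          then have "cmod (g s x) \<le> D x" by (rule bd)
          then show "norm (h *\<^sub>R g s x) \<le> D x * norm h" for h
            by (simp add: mult.commute[of "D x"] mult_left_mono)
        qed
        have "\<bar>Y i - t\<bar> \<le> 1" by (rule Y)
        then show "Y i \<in> {t - 1..t + 1}" unfolding atLeastAtMost_iff by linarith
      qed simp_all
      then show "norm ((f (Y i) x - f t x) /\<^sub>R (Y i - t)) \<le> D x"
        using Y(2)[of i] by (simp add: divide_inverse_commute[symmetric] pos_divide_le_eq)
    qed
  qed measurable
  also have "(\<lambda>i. LINT x|M. (f (Y i) x - f t x) /\<^sub>R (Y i - t)) =
    (\<lambda>i. ((LINT x|M. f (Y i) x) - (LINT x|M. f t x)) /\<^sub>R (Y i - t))"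
    using int Y(1) by (auto simp: fun_eq_iff)
  finally have "(\<lambda>i. ((\<lambda>s. ((LINT x|M. f s x) - (LINT x|M. f t x)) /\<^sub>R (s - t)) \<circ> X) (i + N)) \<longlonglongrightarrow> (LINT x|M. g t x)"
    by (simp add: Y_def comp_def)
  then show "((\<lambda>s. ((LINT x|M. f s x) - (LINT x|M. f t x)) /\<^sub>R (s - t)) \<circ> X) \<longlonglongrightarrow> (LINT x|M. g t x)"
    by (rule LIMSEQ_offset)
qed

text \<open>A standard integrable majorant. With exponent \<open>DIM('a)\<close> each coordinate
  receives one factor, and the product of the functions 1 / (1 + (x \<bullet> b)^2)
  dominates.\<close>

definition decay :: "'a::euclidean_space \<Rightarrow> real" where
  "decay x = 1 / (1 + (norm x)\<^sup>2) ^ DIM('a)"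

lemma decay_pos: "0 < decay x"
  by (simp add: decay_def add_pos_nonneg)

lemma borel_measurable_decay [measurable]: "decay \<in> borel_measurable borel"
  unfolding decay_def by measurable

lemma decay_le_1: "decay (x :: 'a::euclidean_space) \<le> 1"
proof -
  have "1 \<le> (1 + (norm x)\<^sup>2) ^ DIM('a)" by (rule one_le_power) simp
  moreover have "1 / P \<le> 1" if "1 \<le> P" for P :: real
    using that by simp
  ultimately show ?thesis unfolding decay_def by blast
qed

lemma integrable_inverse_one_plus_square: "integrable lborel (\<lambda>y::real. 1 / (1 + y\<^sup>2))"
proof -
  let ?f = "\<lambda>y::real. 1 / (1 + y\<^sup>2)"
  have "set_integrable lborel {0<..} ?f"
    using integrable_I0i_1_div_plus_square
    by (simp add: interval_lebesgue_integrable_def zero_ereal_def einterval_def greaterThan_def)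
  then have i: "integrable lborel (\<lambda>y. indicator {0<..} y * ?f y)"
    by (simp add: set_integrable_def)
  have "integrable lborel (\<lambda>y. indicator {0<..} (0 + -1 * y) * ?f (0 + -1 * y))"
    by (rule lborel_integrable_real_affine[OF i]) simp
  with i have "integrable lborel (\<lambda>y. indicator {0<..} y * ?f y + indicator {0<..} (0 + -1 * y) * ?f (0 + -1 * y))"
    by (rule Bochner_Integration.integrable_add)
  then show ?thesis
  proof (rule integrable_cong_AE_imp)
    show "AE y in lborel. indicator {0<..} y * ?f y + indicator {0<..} (0 + -1 * y) * ?f (0 + -1 * y) = ?f y"
      using AE_lborel_neq_0 by eventually_elim (auto simp: indicator_def)
  qed measurable
qed

lemma integrable_decay: "integrable lborel (decay :: 'a::euclidean_space \<Rightarrow> real)"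
proof -
  have "integrable lborel (\<lambda>x::'a. \<Prod>b\<in>Basis. complex_of_real (1 / (1 + (x \<bullet> b)\<^sup>2)))"
    using integrable_inverse_one_plus_square
    by (intro integrable_lborel_prod_Basis[where f="\<lambda>b y. complex_of_real (1 / (1 + y\<^sup>2))"])
      (simp only: complex_of_real_integrable_eq)
  then show ?thesis
  proof (rule Bochner_Integration.integrable_bound)
    show "AE x::'a in lborel. norm (decay x) \<le> norm (\<Prod>b\<in>Basis. complex_of_real (1 / (1 + (x \<bullet> b)\<^sup>2)))"
    proof (rule AE_I2)
      fix x :: 'a
      have "(\<Prod>b\<in>(Basis::'a set). 1 / (1 + (norm x)\<^sup>2)) \<le> (\<Prod>b\<in>Basis. 1 / (1 + (x \<bullet> b)\<^sup>2))"
      proof (rule prod_mono)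
        fix b :: 'a assume "b \<in> Basis"
        then have "\<bar>x \<bullet> b\<bar> \<le> norm x" by (rule Basis_le_norm)
        then have "(x \<bullet> b)\<^sup>2 \<le> (norm x)\<^sup>2" by (simp add: abs_le_square_iff[symmetric])
        then show "0 \<le> 1 / (1 + (norm x)\<^sup>2) \<and> 1 / (1 + (norm x)\<^sup>2) \<le> 1 / (1 + (x \<bullet> b)\<^sup>2)"
          by (auto intro!: divide_left_mono add_pos_nonneg mult_pos_pos)
      qed
      moreover have "norm (\<Prod>b\<in>Basis. complex_of_real (1 / (1 + (x \<bullet> b)\<^sup>2))) = (\<Prod>b\<in>Basis. 1 / (1 + (x \<bullet> b)\<^sup>2))"
        unfolding of_real_prod[symmetric] norm_of_real by (intro abs_of_nonneg prod_nonneg) simp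
      ultimately show "norm (decay x) \<le> norm (\<Prod>b\<in>Basis. complex_of_real (1 / (1 + (x \<bullet> b)\<^sup>2)))"
        using decay_pos[of x] by (simp add: decay_def power_divide)
    qed
  qed measurable
qed

lemma integrable_of_decay:
  fixes f :: "'a::euclidean_space \<Rightarrow> complex"
  assumes f: "f \<in> borel_measurable borel" and B: "\<And>x. cmod (f x) \<le> B * decay x"
  shows "integrable lborel f"
proof (rule Bochner_Integration.integrable_bound)
  show "integrable lborel (\<lambda>x::'a. B * decay x)"
    by (intro integrable_mult_right integrable_decay)
  show "AE x in lborel. norm (f x) \<le> norm (B * decay x)"
    using order_trans[OF B abs_ge_self] by auto
qed (use f in simp)

text \<open>Since |x|^2 \<le> (|x + v| + 1)^2 \<le> 2 |x + v|^2 + 2, one has 1 + |x|^2 \<le> 3 (1 +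
  |x + v|^2). This keeps a majorant valid along the unit translations in
  \<open>ft_directional_derivative\<close>.\<close>

lemma decay_shift:
  fixes x v :: "'a::euclidean_space"
  assumes "norm v \<le> 1"
  shows "decay (x + v) \<le> 3 ^ DIM('a) * decay x"
proof -
  have "norm x \<le> norm (x + v) + 1"
    using norm_triangle_ineq4[of "x + v" v] assms by simp
  then have "(norm x)\<^sup>2 \<le> (norm (x + v) + 1)\<^sup>2"
    by (intro power_mono) auto
  also have "\<dots> \<le> 2 * (norm (x + v))\<^sup>2 + 2"
    using zero_le_power2[of "norm (x + v) - 1"] by (simp add: power2_eq_square algebra_simps)
  finally have "1 + (norm x)\<^sup>2 \<le> 3 * (1 + (norm (x + v))\<^sup>2)"
    using zero_le_power2[of "norm (x + v)"] by (simp only: distrib_left)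
  then have "(1 + (norm x)\<^sup>2) ^ DIM('a) \<le> (3 * (1 + (norm (x + v))\<^sup>2)) ^ DIM('a)"
    by (intro power_mono) auto
  moreover have "1 / Q \<le> c * (1 / P)" if "P \<le> c * Q" "0 < P" "0 < Q" for P Q c :: real
    using that by (simp add: field_simps)
  ultimately show ?thesis
    unfolding decay_def power_mult_distrib by (simp add: add_pos_nonneg)
qed

lemma decay_bound:
  fixes f :: "'a::euclidean_space \<Rightarrow> complex"
  assumes 0: "cmod (f x) \<le> B0" and 1: "norm x ^ (2 * DIM('a)) * cmod (f x) \<le> B1"
  shows "cmod (f x) \<le> 2 ^ DIM('a) * (B0 + B1) * decay x"
proof -
  have "1 + (norm x)\<^sup>2 \<le> 2 * max 1 ((norm x)\<^sup>2)" by simp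
  then have "(1 + (norm x)\<^sup>2) ^ DIM('a) \<le> (2 * max 1 ((norm x)\<^sup>2)) ^ DIM('a)"
    by (intro power_mono) auto
  also have "\<dots> \<le> 2 ^ DIM('a) * (1 + norm x ^ (2 * DIM('a)))"
    by (simp add: power_mult_distrib max_def power_mult)
  finally have "cmod (f x) * (1 + (norm x)\<^sup>2) ^ DIM('a) \<le> cmod (f x) * (2 ^ DIM('a) * (1 + norm x ^ (2 * DIM('a))))"
    by (intro mult_left_mono) auto
  also have "\<dots> = 2 ^ DIM('a) * (cmod (f x) + norm x ^ (2 * DIM('a)) * cmod (f x))"
    by (simp add: algebra_simps)
  also have "\<dots> \<le> 2 ^ DIM('a) * (B0 + B1)"
    using 0 1 by (intro mult_left_mono add_mono) auto
  finally show ?thesis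
    by (simp add: decay_def field_simps add_pos_nonneg)
qed

text \<open>No integration by parts: the transform of the translates of \<open>f\<close> is
  differentiated at s = 0 in two ways, under the integral sign and after translation invariance has
  turned it into cis(s (e \<bullet> \<xi>)) times the transform of \<open>f\<close>.\<close>

lemma ft_directional_derivative:
  fixes f g :: "'a::euclidean_space \<Rightarrow> complex"
  assumes f: "integrable lborel f" and e: "norm e \<le> 1"
    and der: "\<And>x. ((\<lambda>s. f (x + s *\<^sub>R e)) has_vector_derivative g x) (at 0)"
    and gm [measurable]: "g \<in> borel_measurable borel" and B: "\<And>x. cmod (g x) \<le> B * decay x"
  shows "ft g \<xi> = \<i> * of_real (e \<bullet> \<xi>) * ft f \<xi>"
proof -
  have [measurable]: "f \<in> borel_measurable borel" using f by auto
  have "0 \<le> B * decay (undefined::'a)" using order_trans[OF norm_ge_zero B] .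
  then have "0 \<le> B" using decay_pos[of "undefined::'a"] by (simp add: zero_le_mult_iff)
  have fi: "integrable lborel (\<lambda>x. f (x + s *\<^sub>R e))" for s
    using integrable_lborel_affine[OF f, of 1 "s *\<^sub>R e"] by (simp add: add.commute)
  have "((\<lambda>s. LINT x|lborel. cis (- (x \<bullet> \<xi>)) * f (x + s *\<^sub>R e)) has_vector_derivative
      (LINT x|lborel. cis (- (x \<bullet> \<xi>)) * g (x + 0 *\<^sub>R e))) (at 0)"
  proof (rule has_vector_derivative_integral)
    show "integrable lborel (\<lambda>x. cis (- (x \<bullet> \<xi>)) * f (x + s *\<^sub>R e))" for s
      by (intro integrable_cis_mult fi) measurable
    show "((\<lambda>s. cis (- (x \<bullet> \<xi>)) * f (x + s *\<^sub>R e)) has_vector_derivative cis (- (x \<bullet> \<xi>)) * g (x + s *\<^sub>R e)) (at s)" for s x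
    proof -
      have "((\<lambda>r. f ((x + s *\<^sub>R e) + r *\<^sub>R e)) has_vector_derivative g (x + s *\<^sub>R e)) (at (s - s))"
        using der[of "x + s *\<^sub>R e"] by simp
      moreover have "((\<lambda>r. r - s) has_vector_derivative 1) (at s)"
        by (auto intro!: derivative_eq_intros)
      ultimately have "((\<lambda>r. f ((x + s *\<^sub>R e) + r *\<^sub>R e)) \<circ> (\<lambda>r. r - s) has_vector_derivative 1 *\<^sub>R g (x + s *\<^sub>R e)) (at s)"
        by (rule vector_diff_chain_at[rotated])
      then have "((\<lambda>r. f (x + r *\<^sub>R e)) has_vector_derivative g (x + s *\<^sub>R e)) (at s)"
        by (simp add: comp_def algebra_simps)
      then show ?thesis by (intro has_vector_derivative_mult_right)
    qed
    show "integrable lborel (\<lambda>x::'a. B * (3 ^ DIM('a) * decay x))"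
      by (intro integrable_mult_right integrable_decay)
    show "cmod (cis (- (x \<bullet> \<xi>)) * g (x + s *\<^sub>R e)) \<le> B * (3 ^ DIM('a) * decay x)" if "\<bar>s - 0\<bar> \<le> 1" for s x
    proof -
      have "norm (s *\<^sub>R e) \<le> 1"
        using that e by (simp add: mult_le_one)
      then have "B * decay (x + s *\<^sub>R e) \<le> B * (3 ^ DIM('a) * decay x)"
        using \<open>0 \<le> B\<close> by (intro mult_left_mono decay_shift)
      then show ?thesis
        using B[of "x + s *\<^sub>R e"] by (simp add: norm_mult)
    qed
  qed measurable
  then have 1: "((\<lambda>s. LINT x|lborel. cis (- (x \<bullet> \<xi>)) * f (x + s *\<^sub>R e)) has_vector_derivative ft g \<xi>) (at 0)"
    by (simp add: ft_def)
  have "(LINT x|lborel. cis (- (x \<bullet> \<xi>)) * f (x + s *\<^sub>R e)) = cis (s * (e \<bullet> \<xi>)) * ft f \<xi>" for s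
  proof -
    have "cis (s * (e \<bullet> \<xi>)) * ft f \<xi> = cis (s * (e \<bullet> \<xi>)) * (LINT x|lborel. cis (- ((s *\<^sub>R e + 1 *\<^sub>R x) \<bullet> \<xi>)) * f (s *\<^sub>R e + 1 *\<^sub>R x))"
      unfolding ft_def by (subst integral_lborel_affine[where c=1 and t="s *\<^sub>R e"]) auto
    also have "\<dots> = (LINT x|lborel. cis (s * (e \<bullet> \<xi>)) * (cis (- ((s *\<^sub>R e + 1 *\<^sub>R x) \<bullet> \<xi>)) * f (s *\<^sub>R e + 1 *\<^sub>R x)))"
      by (rule integral_mult_right_zero[symmetric])
    also have "\<dots> = (LINT x|lborel. cis (- (x \<bullet> \<xi>)) * f (x + s *\<^sub>R e))"
      by (intro Bochner_Integration.integral_cong refl)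
        (simp add: mult.assoc[symmetric] cis_mult inner_add_left add.commute)
    finally show ?thesis ..
  qed
  moreover have "((\<lambda>s. cis (s * (e \<bullet> \<xi>)) * ft f \<xi>) has_vector_derivative \<i> * of_real (e \<bullet> \<xi>) * ft f \<xi>) (at 0)"
    unfolding cis_conv_exp
    by (auto intro!: derivative_eq_intros has_vector_derivative_real_field)
  ultimately have "((\<lambda>s. LINT x|lborel. cis (- (x \<bullet> \<xi>)) * f (x + s *\<^sub>R e)) has_vector_derivative \<i> * of_real (e \<bullet> \<xi>) * ft f \<xi>) (at 0)"
    by simp
  with 1 show ?thesis
    by (rule vector_derivative_unique_at)
qed

section \<open>Iterated derivatives and Schwartz bounds\<close>

lemma iter_deriv_Nil [simp]: "iter_deriv [] u = u"
  and iter_deriv_Cons: "iter_deriv (b # bs) u = dir_deriv b (iter_deriv bs u)"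
  by (simp_all add: iter_deriv_def)

lemma has_vector_derivative_dir_deriv:
  fixes h :: "'a::real_normed_vector \<Rightarrow> complex"
  assumes h: "h differentiable (at z)"
  shows "((\<lambda>s. h (z + s *\<^sub>R b)) has_vector_derivative dir_deriv b h z) (at 0)"
proof -
  obtain h' where "(h has_derivative h') (at z)"
    using h by (auto simp: differentiable_def)
  then have "(h has_derivative h') (at ((\<lambda>s. z + s *\<^sub>R b) 0))" by simp
  moreover have "((\<lambda>s. z + s *\<^sub>R b) has_derivative (\<lambda>s. s *\<^sub>R b)) (at (0::real))"
    by (auto intro!: derivative_eq_intros)
  ultimately have "(h \<circ> (\<lambda>s. z + s *\<^sub>R b)) differentiable (at (0::real))"
    by (intro differentiableI[OF diff_chain_at])
  then have "((h \<circ> (\<lambda>s. z + s *\<^sub>R b)) has_vector_derivative vector_derivative (h \<circ> (\<lambda>s. z + s *\<^sub>R b)) (at 0)) (at 0)"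
    by (simp add: vector_derivative_works)
  then show ?thesis by (simp add: dir_deriv_def comp_def)
qed

lemma dir_deriv_sum:
  fixes h :: "'i \<Rightarrow> 'a::real_normed_vector \<Rightarrow> complex"
  assumes "\<And>i. i \<in> I \<Longrightarrow> h i differentiable (at z)"
  shows "dir_deriv b (\<lambda>z. \<Sum>i\<in>I. h i z) z = (\<Sum>i\<in>I. dir_deriv b (h i) z)"
  unfolding dir_deriv_def[of b "\<lambda>z. \<Sum>i\<in>I. h i z"]
  by (intro vector_derivative_at has_vector_derivative_sum has_vector_derivative_dir_deriv assms)

lemma smooth_differentiable: "smooth u \<Longrightarrow> set bs \<subseteq> Basis \<Longrightarrow> iter_deriv bs u differentiable (at z)"
  by (simp add: smooth_def)

lemma smooth_continuous: "smooth u \<Longrightarrow> set bs \<subseteq> Basis \<Longrightarrow> continuous_on UNIV (iter_deriv bs u)"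
  by (simp add: continuous_on_eq_continuous_within differentiable_imp_continuous_within smooth_differentiable)

lemma space_time_Basis: "time_dir \<in> Basis" "space_dir i \<in> Basis"
  by (auto simp: Basis_prod_def Basis_vec_def)

lemma set_space_dirs: "set (map space_dir is) \<subseteq> Basis"
  using space_time_Basis by auto

lemma laplacian_x_eq: "laplacian_x u z = (\<Sum>i\<in>UNIV. iter_deriv [space_dir i, space_dir i] u z)"
  by (simp add: laplacian_x_def iter_deriv_Cons)

lemma laplacian_x_laplacian_x:
  assumes u: "smooth u"
  shows "laplacian_x (laplacian_x u) z =
    (\<Sum>i\<in>UNIV. \<Sum>j\<in>UNIV. iter_deriv [space_dir i, space_dir i, space_dir j, space_dir j] u z)"
proof -
  have d: "iter_deriv bs u differentiable (at z)" if "set bs \<subseteq> Basis" for bs z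
    by (rule smooth_differentiable[OF u that])
  have "dir_deriv (space_dir i) (laplacian_x u) = (\<lambda>z. \<Sum>j\<in>UNIV. iter_deriv [space_dir i, space_dir j, space_dir j] u z)" for i
    unfolding laplacian_x_eq[abs_def] iter_deriv_Cons[of "space_dir i"]
    by (intro ext dir_deriv_sum d) (simp add: space_time_Basis)
  then have "dir_deriv (space_dir i) (dir_deriv (space_dir i) (laplacian_x u)) z =
     (\<Sum>j\<in>UNIV. iter_deriv [space_dir i, space_dir i, space_dir j, space_dir j] u z)" for i
    unfolding iter_deriv_Cons[of "space_dir i" "[space_dir i, _, _]"]
    by (simp only:) (intro dir_deriv_sum d, simp add: space_time_Basis)
  then show ?thesis unfolding laplacian_x_def[of "laplacian_x u"] by simp
qed

lemma schwartz_decay: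
  fixes F :: "'a::euclidean_space \<Rightarrow> complex"
  assumes F: "schwartz F" and bs: "set bs \<subseteq> Basis"
  obtains B where "\<And>z. cmod (iter_deriv bs F z) \<le> B * decay z"
proof -
  have "\<exists>B. \<forall>z. norm z ^ k * cmod (iter_deriv bs F z) \<le> B" for k
    using F bs by (simp add: schwartz_def)
  from this[of 0] this[of "2 * DIM('a)"] obtain B0 B1
    where "\<And>z. cmod (iter_deriv bs F z) \<le> B0" "\<And>z. norm z ^ (2 * DIM('a)) * cmod (iter_deriv bs F z) \<le> B1"
    by auto
  then show ?thesis using decay_bound that by blast
qed

lemma schwartz_integrable:
  assumes F: "schwartz F" and bs: "set bs \<subseteq> Basis"
  shows "integrable lborel (iter_deriv bs F)"
proof -
  obtain B where "\<And>z. cmod (iter_deriv bs F z) \<le> B * decay z"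
    using schwartz_decay[OF F bs] by blast
  moreover have "iter_deriv bs F \<in> borel_measurable borel"
    using F bs by (intro borel_measurable_continuous_onI smooth_continuous) (auto simp: schwartz_def)
  ultimately show ?thesis by (intro integrable_of_decay)
qed

abbreviation "schwartz_in_space \<equiv> smooth_in_time_schwartz_in_space"

lemma schwartz_imp_schwartz_in_space:
  fixes F :: "real \<times> (real ^ 'n::finite) \<Rightarrow> complex"
  assumes F: "schwartz F"
  shows "schwartz_in_space F"
  unfolding smooth_in_time_schwartz_in_space_def
proof (intro conjI allI impI)
  show "smooth F" using F by (simp add: schwartz_def)
  fix T :: real and bs :: "(real \<times> (real ^ 'n)) list" and k
  assume "set bs \<subseteq> Basis"
  then obtain B where B: "\<And>z. norm z ^ k * cmod (iter_deriv bs F z) \<le> B"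
    using F unfolding schwartz_def by blast
  have "norm x ^ k * cmod (iter_deriv bs F (t, x)) \<le> B" for t x
  proof -
    have "norm x \<le> norm (t, x)" by (metis norm_snd_le)
    then have "norm x ^ k * cmod (iter_deriv bs F (t, x)) \<le> norm (t, x) ^ k * cmod (iter_deriv bs F (t, x))"
      by (intro mult_right_mono power_mono) auto
    then show ?thesis using B order_trans by blast
  qed
  then show "\<exists>B. \<forall>t x. \<bar>t\<bar> \<le> T \<longrightarrow> norm x ^ k * cmod (iter_deriv bs F (t, x)) \<le> B" by blast
qed

lemma schwartz_in_space_decay:
  fixes u :: "real \<times> (real ^ 'n::finite) \<Rightarrow> complex"
  assumes u: "schwartz_in_space u" and bs: "set bs \<subseteq> Basis"
  obtains B where "\<And>t x. \<bar>t\<bar> \<le> T \<Longrightarrow> cmod (iter_deriv bs u (t, x)) \<le> B * decay x"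
proof -
  have "\<exists>B. \<forall>t x. \<bar>t\<bar> \<le> T \<longrightarrow> norm x ^ k * cmod (iter_deriv bs u (t, x)) \<le> B" for k
    using u bs by (simp add: smooth_in_time_schwartz_in_space_def)
  note bound = this
  obtain B0 where "\<forall>t x. \<bar>t\<bar> \<le> T \<longrightarrow> norm x ^ 0 * cmod (iter_deriv bs u (t, x)) \<le> B0"
    using bound[of 0] by blast
  moreover obtain B1 where "\<forall>t x. \<bar>t\<bar> \<le> T \<longrightarrow> norm x ^ (2 * DIM(real ^ 'n)) * cmod (iter_deriv bs u (t, x)) \<le> B1"
    using bound[of "2 * DIM(real ^ 'n)"] by blast
  ultimately have "\<And>t x. \<bar>t\<bar> \<le> T \<Longrightarrow> cmod (iter_deriv bs u (t, x)) \<le> B0"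
      "\<And>t x. \<bar>t\<bar> \<le> T \<Longrightarrow> norm x ^ (2 * DIM(real ^ 'n)) * cmod (iter_deriv bs u (t, x)) \<le> B1"
    by simp_all
  then have "\<And>t x. \<bar>t\<bar> \<le> T \<Longrightarrow> cmod (iter_deriv bs u (t, x)) \<le> 2 ^ DIM(real ^ 'n) * (B0 + B1) * decay x"
    by (rule decay_bound)
  then show ?thesis using that by blast
qed

section \<open>Spatial transform of a function that is smooth in time and Schwartz in space\<close>

context
  fixes u :: "real \<times> (real ^ 'n::finite) \<Rightarrow> complex"
  assumes u: "schwartz_in_space u"
begin

lemma smooth_u: "smooth u"
  using u by (simp add: smooth_in_time_schwartz_in_space_def)

lemma continuous_space_section:
  assumes bs: "set bs \<subseteq> Basis"
  shows "continuous_on UNIV (\<lambda>x. iter_deriv bs u (t, x))"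
  by (rule continuous_on_compose2[OF smooth_continuous[OF smooth_u bs]]) (auto intro!: continuous_intros)

lemma borel_measurable_space_section:
  assumes bs: "set bs \<subseteq> Basis"
  shows "(\<lambda>x. iter_deriv bs u (t, x)) \<in> borel_measurable borel"
  by (intro borel_measurable_continuous_onI continuous_space_section bs)

lemma integrable_space_section:
  assumes bs: "set bs \<subseteq> Basis"
  shows "integrable lborel (\<lambda>x. iter_deriv bs u (t, x))"
proof -
  obtain B where "\<And>s x. \<bar>s\<bar> \<le> \<bar>t\<bar> \<Longrightarrow> cmod (iter_deriv bs u (s, x)) \<le> B * decay x"
    using schwartz_in_space_decay[OF u bs] by blast
  then show ?thesis
    by (intro integrable_of_decay borel_measurable_space_section bs) auto
qed

lemma ft_space_dir:
  assumes bs: "set bs \<subseteq> Basis"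
  shows "ft (\<lambda>x. iter_deriv (space_dir i # bs) u (t, x)) \<xi> = \<i> * of_real (\<xi> $ i) * ft (\<lambda>x. iter_deriv bs u (t, x)) \<xi>"
proof -
  have bs': "set (space_dir i # bs) \<subseteq> Basis"
    using bs space_time_Basis by auto
  obtain B where B: "\<And>s x. \<bar>s\<bar> \<le> \<bar>t\<bar> \<Longrightarrow> cmod (iter_deriv (space_dir i # bs) u (s, x)) \<le> B * decay x"
    using schwartz_in_space_decay[OF u bs'] by blast
  have "ft (\<lambda>x. iter_deriv (space_dir i # bs) u (t, x)) \<xi> = \<i> * of_real (axis i 1 \<bullet> \<xi>) * ft (\<lambda>x. iter_deriv bs u (t, x)) \<xi>"
  proof (rule ft_directional_derivative)
    show "((\<lambda>s. iter_deriv bs u (t, x + s *\<^sub>R axis i 1)) has_vector_derivative iter_deriv (space_dir i # bs) u (t, x)) (at 0)" for x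
      using has_vector_derivative_dir_deriv[OF smooth_differentiable[OF smooth_u bs], of "(t, x)" "space_dir i"]
      by (simp add: iter_deriv_Cons)
  qed (use B in \<open>auto intro!: integrable_space_section borel_measurable_space_section bs bs'\<close>)
  then show ?thesis by (simp add: inner_axis inner_commute)
qed

lemma ft_space_dirs:
  "ft (\<lambda>x. iter_deriv (map space_dir is) u (t, x)) \<xi> = (\<Prod>i\<leftarrow>is. \<i> * of_real (\<xi> $ i)) * ft (\<lambda>x. u (t, x)) \<xi>"
  by (induction "is") (simp_all add: ft_space_dir[OF set_space_dirs])

lemma ft_laplacian_x:
  shows "ft (\<lambda>x. laplacian_x u (t, x)) \<xi> = - of_real ((norm \<xi>)\<^sup>2) * ft (\<lambda>x. u (t, x)) \<xi>"
    and "ft (\<lambda>x. laplacian_x (laplacian_x u) (t, x)) \<xi> = of_real ((norm \<xi>) ^ 4) * ft (\<lambda>x. u (t, x)) \<xi>"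
proof -
  have ii: "\<i> * a * (\<i> * a) = - a\<^sup>2" for a :: complex
    by (simp add: power_mult_distrib flip: power2_eq_square)
  have iiii: "\<i> * a * (\<i> * a * (\<i> * b * (\<i> * b))) = a\<^sup>2 * b\<^sup>2" for a b :: complex
  proof -
    have "\<i> * a * (\<i> * a * (\<i> * b * (\<i> * b))) = (\<i> * a * (\<i> * a)) * (\<i> * b * (\<i> * b))"
      by (simp only: mult.assoc)
    then show ?thesis unfolding ii by simp
  qed
  have n2: "(norm \<xi>)\<^sup>2 = (\<Sum>i\<in>UNIV. (\<xi> $ i)\<^sup>2)"
    by (simp add: norm_vec_def L2_set_def sum_nonneg)
  have n4: "(norm \<xi>) ^ 4 = (\<Sum>i\<in>UNIV. \<Sum>j\<in>UNIV. (\<xi> $ i)\<^sup>2 * (\<xi> $ j)\<^sup>2)"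
  proof -
    have "(norm \<xi>) ^ 4 = (norm \<xi>)\<^sup>2 * (norm \<xi>)\<^sup>2" by (simp flip: power_add)
    then show ?thesis by (simp add: n2 sum_product)
  qed
  have ft_sum: "ft (\<lambda>x. \<Sum>i\<in>I. f i x) \<xi> = (\<Sum>i\<in>I. ft (f i) \<xi>)"
    if "\<And>i. i \<in> I \<Longrightarrow> integrable lborel (f i)" for I :: "'i set" and f :: "'i \<Rightarrow> real ^ 'n \<Rightarrow> complex"
    unfolding ft_def sum_distrib_left
    by (intro Bochner_Integration.integral_sum integrable_cis_mult that) measurable
  have i: "integrable lborel (\<lambda>x. iter_deriv (map space_dir is) u (t, x))" for "is"
    by (rule integrable_space_section[OF set_space_dirs])
  have "ft (\<lambda>x. laplacian_x u (t, x)) \<xi> = (\<Sum>i\<in>UNIV. ft (\<lambda>x. iter_deriv (map space_dir [i, i]) u (t, x)) \<xi>)"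
    unfolding laplacian_x_eq using i[of "[_, _]"] by (subst ft_sum) simp_all
  also have "\<dots> = - of_real ((norm \<xi>)\<^sup>2) * ft (\<lambda>x. u (t, x)) \<xi>"
    unfolding ft_space_dirs n2 of_real_sum sum_negf[symmetric] sum_distrib_right
    by (intro sum.cong refl) (simp add: ii)
  finally show "ft (\<lambda>x. laplacian_x u (t, x)) \<xi> = - of_real ((norm \<xi>)\<^sup>2) * ft (\<lambda>x. u (t, x)) \<xi>" .
  have "ft (\<lambda>x. laplacian_x (laplacian_x u) (t, x)) \<xi> =
     (\<Sum>i\<in>UNIV. \<Sum>j\<in>UNIV. ft (\<lambda>x. iter_deriv (map space_dir [i, i, j, j]) u (t, x)) \<xi>)"
    unfolding laplacian_x_laplacian_x[OF smooth_u] using i[of "[_, _, _, _]"]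
    by (subst ft_sum) (auto simp: ft_sum)
  also have "\<dots> = of_real ((norm \<xi>) ^ 4) * ft (\<lambda>x. u (t, x)) \<xi>"
    unfolding ft_space_dirs n4 of_real_sum sum_distrib_right
    by (intro sum.cong refl) (simp add: iiii)
  finally show "ft (\<lambda>x. laplacian_x (laplacian_x u) (t, x)) \<xi> = of_real ((norm \<xi>) ^ 4) * ft (\<lambda>x. u (t, x)) \<xi>" .
qed

lemma ft_has_time_derivative:
  "((\<lambda>t. ft (\<lambda>x. u (t, x)) \<xi>) has_vector_derivative ft (\<lambda>x. dir_deriv time_dir u (t, x)) \<xi>) (at t)"
proof -
  have bs: "set [time_dir] \<subseteq> (Basis :: (real \<times> (real ^ 'n)) set)"
    using space_time_Basis by auto
  \<comment> \<open>The bound on |s| \<le> |t| + 1 covers the unit neighbourhood of \<open>t\<close>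
    over which the derivative must be dominated.\<close>
  obtain B where B: "\<And>s x. \<bar>s\<bar> \<le> \<bar>t\<bar> + 1 \<Longrightarrow> cmod (iter_deriv [time_dir] u (s, x)) \<le> B * decay x"
    using schwartz_in_space_decay[OF u bs] by blast
  show ?thesis
    unfolding ft_def
  proof (rule has_vector_derivative_integral)
    show "integrable lborel (\<lambda>x. cis (- (x \<bullet> \<xi>)) * u (s, x))" for s
      using integrable_space_section[of "[]" s] by (intro integrable_cis_mult) simp_all
    show "integrable lborel (\<lambda>x::real ^ 'n. B * decay x)"
      by (intro integrable_mult_right integrable_decay)
    show "((\<lambda>s. cis (- (x \<bullet> \<xi>)) * u (s, x)) has_vector_derivative cis (- (x \<bullet> \<xi>)) * dir_deriv time_dir u (s, x)) (at s)" for s x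
    proof -
      have "((\<lambda>r. u ((s, x) + r *\<^sub>R time_dir)) has_vector_derivative dir_deriv time_dir u (s, x)) (at (s - s))"
        using has_vector_derivative_dir_deriv[OF smooth_differentiable[OF smooth_u, of "[]"], of "(s, x)" time_dir]
        by simp
      moreover have "((\<lambda>r. r - s) has_vector_derivative 1) (at s)"
        by (auto intro!: derivative_eq_intros)
      ultimately have "((\<lambda>r. u ((s, x) + r *\<^sub>R time_dir)) \<circ> (\<lambda>r. r - s) has_vector_derivative 1 *\<^sub>R dir_deriv time_dir u (s, x)) (at s)"
        by (rule vector_diff_chain_at[rotated])
      then have "((\<lambda>r. u (r, x)) has_vector_derivative dir_deriv time_dir u (s, x)) (at s)"
        by (simp add: comp_def)
      then show ?thesis by (intro has_vector_derivative_mult_right)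
    qed
    show "cmod (cis (- (x \<bullet> \<xi>)) * dir_deriv time_dir u (s, x)) \<le> B * decay x" if "\<bar>s - t\<bar> \<le> 1" for s x
      using B[of s x] that by (simp add: norm_mult iter_deriv_Cons)
    have [measurable]: "(\<lambda>x. dir_deriv time_dir u (t, x)) \<in> borel_measurable borel"
      using borel_measurable_space_section[OF bs, of t] by (simp add: iter_deriv_Cons)
    show "(\<lambda>x. cis (- (x \<bullet> \<xi>)) * dir_deriv time_dir u (t, x)) \<in> borel_measurable lborel"
      by measurable
  qed
qed

lemma continuous_ft_time: "continuous_on UNIV (\<lambda>t. ft (\<lambda>x. u (t, x)) \<xi>)"
  using ft_has_time_derivative
  by (auto simp: continuous_on_eq_continuous_within intro: has_vector_derivative_continuous)

end

text \<open>At each fixed \<xi> the equation is a scalar linear ODE in time with the real frequency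
  |\<xi>|^4 + \<epsilon> |\<xi>|^2, the sign of \<epsilon> being that of -\<epsilon> times the
  Laplacian.\<close>

lemma ft_cauchy_solution:
  fixes u :: "real \<times> (real ^ 'n::finite) \<Rightarrow> complex"
  assumes sol: "cauchy_solution \<epsilon> F u" and F: "schwartz F"
  shows "((\<lambda>t. ft (\<lambda>x. u (t, x)) \<xi>) has_vector_derivative
     - \<i> * (of_real ((norm \<xi>) ^ 4 + \<epsilon> * (norm \<xi>)\<^sup>2) * ft (\<lambda>x. u (t, x)) \<xi> + ft (\<lambda>x. F (t, x)) \<xi>)) (at t)"
proof -
  have u: "schwartz_in_space u" using sol by (simp add: cauchy_solution_def)
  have "\<i> * dir_deriv time_dir u (t, x) =
        laplacian_x (laplacian_x u) (t, x) - of_real \<epsilon> * laplacian_x u (t, x) + F (t, x)" for x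
    using sol by (simp add: cauchy_solution_def)
  note pde = this
  have eq: "dir_deriv time_dir u (t, x) =
      - \<i> * (laplacian_x (laplacian_x u) (t, x) - of_real \<epsilon> * laplacian_x u (t, x) + F (t, x))" for x
    unfolding pde[symmetric] by simp
  have i: "integrable lborel (\<lambda>x. iter_deriv (map space_dir is) u (t, x))" for "is"
    by (rule integrable_space_section[OF u set_space_dirs])
  have iF: "integrable lborel (\<lambda>x. F (t, x))"
    using integrable_space_section[OF schwartz_imp_schwartz_in_space[OF F], of "[]" t] by simp
  have i2: "integrable lborel (\<lambda>x. laplacian_x u (t, x))"
    unfolding laplacian_x_eq using i[of "[_, _]"] by simp
  have i4: "integrable lborel (\<lambda>x. laplacian_x (laplacian_x u) (t, x))"
    unfolding laplacian_x_laplacian_x[OF smooth_u[OF u]] using i[of "[_, _, _, _]"] by simp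
  have "ft (\<lambda>x. dir_deriv time_dir u (t, x)) \<xi> = (LINT x|lborel. - \<i> *
     (cis (- (x \<bullet> \<xi>)) * laplacian_x (laplacian_x u) (t, x) - of_real \<epsilon> * (cis (- (x \<bullet> \<xi>)) * laplacian_x u (t, x)) + cis (- (x \<bullet> \<xi>)) * F (t, x)))"
    unfolding ft_def eq
    by (intro Bochner_Integration.integral_cong refl) (simp add: algebra_simps)
  also have "\<dots> = - \<i> * (LINT x|lborel.
     (cis (- (x \<bullet> \<xi>)) * laplacian_x (laplacian_x u) (t, x) - of_real \<epsilon> * (cis (- (x \<bullet> \<xi>)) * laplacian_x u (t, x)) + cis (- (x \<bullet> \<xi>)) * F (t, x)))"
    by (rule integral_mult_right_zero)
  also have "(LINT x|lborel.
     (cis (- (x \<bullet> \<xi>)) * laplacian_x (laplacian_x u) (t, x) - of_real \<epsilon> * (cis (- (x \<bullet> \<xi>)) * laplacian_x u (t, x)) + cis (- (x \<bullet> \<xi>)) * F (t, x)))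
     = ft (\<lambda>x. laplacian_x (laplacian_x u) (t, x)) \<xi> - of_real \<epsilon> * ft (\<lambda>x. laplacian_x u (t, x)) \<xi> + ft (\<lambda>x. F (t, x)) \<xi>"
    unfolding ft_def using i2 i4 iF by simp
  also have "\<dots> = of_real ((norm \<xi>) ^ 4 + \<epsilon> * (norm \<xi>)\<^sup>2) * ft (\<lambda>x. u (t, x)) \<xi> + ft (\<lambda>x. F (t, x)) \<xi>"
    unfolding ft_laplacian_x[OF u] by (simp add: algebra_simps)
  finally show ?thesis
    using ft_has_time_derivative[OF u, of \<xi> t] by simp
qed


section \<open>Duhamel representation and the pairing identity\<close>

lemma integrable_bounded_square:
  fixes f :: "'a \<Rightarrow> complex"
  assumes f: "integrable M f" and B: "\<And>x. cmod (f x) \<le> B"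
  shows "(\<integral>\<^sup>+x. ennreal ((cmod (f x))\<^sup>2) \<partial>M) < \<infinity>"
proof -
  have [measurable]: "f \<in> borel_measurable M" using f by auto
  have "(\<integral>\<^sup>+x. ennreal ((cmod (f x))\<^sup>2) \<partial>M) \<le> (\<integral>\<^sup>+x. ennreal B * ennreal (cmod (f x)) \<partial>M)"
    using B by (intro nn_integral_mono) (auto simp: power2_eq_square ennreal_mult''[symmetric] intro!: ennreal_leI mult_right_mono)
  also have "\<dots> = ennreal B * (\<integral>\<^sup>+x. ennreal (cmod (f x)) \<partial>M)"
    by (rule nn_integral_cmult) simp
  also have "\<dots> < \<infinity>"
    using f unfolding integrable_iff_bounded by (simp add: ennreal_mult_less_top)
  finally show ?thesis .
qed

lemma integrable_ft_mult_ft: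
  fixes f g :: "'a::euclidean_space \<Rightarrow> complex"
  assumes f: "integrable lborel f" "(\<integral>\<^sup>+x. ennreal ((cmod (f x))\<^sup>2) \<partial>lborel) < \<infinity>"
    and g: "integrable lborel g" "(\<integral>\<^sup>+x. ennreal ((cmod (g x))\<^sup>2) \<partial>lborel) < \<infinity>"
  shows "integrable lborel (\<lambda>\<xi>. ft f \<xi> * cnj (ft g \<xi>))"
proof -
  have [measurable]: "f \<in> borel_measurable borel" "g \<in> borel_measurable borel" using f g by auto
  have "(\<integral>\<^sup>+\<xi>. ennreal ((cmod (ft h \<xi>))\<^sup>2) \<partial>lborel) < \<infinity>"
    if "integrable lborel h" "(\<integral>\<^sup>+x. ennreal ((cmod (h x))\<^sup>2) \<partial>lborel) < \<infinity>" for h :: "'a \<Rightarrow> complex"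
    using that by (intro le_less_trans[OF bessel]) (auto simp: ennreal_mult_less_top)
  then show ?thesis
    using f g by (intro integrable_mult_of_squares) auto
qed

text \<open>The source reflected by \<open>\<sigma>\<close>, cut off to positive times and damped.
  With \<open>\<sigma> = - 1\<close> negative times are moved to the positive half-line, so one
  argument serves both.\<close>

definition damped :: "real \<Rightarrow> real \<Rightarrow> (real \<times> 'a \<Rightarrow> complex) \<Rightarrow> real \<times> 'a \<Rightarrow> complex" where
  "damped \<sigma> \<delta> F z = of_real (if 0 < fst z then exp (- (\<delta> * fst z)) else 0) * F (\<sigma> * fst z, snd z)"

lemma norm_damped_le:
  assumes "0 \<le> \<delta>"
  shows "cmod (damped \<sigma> \<delta> F z) \<le> cmod (F (\<sigma> * fst z, snd z))"
  using assms by (auto simp: damped_def norm_mult intro!: mult_left_le_one_le)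

lemma borel_measurable_time_scale [measurable]:
  "(\<lambda>z::real \<times> 'a::euclidean_space. (\<sigma> * fst z, snd z)) \<in> borel \<rightarrow>\<^sub>M borel"
  by (intro borel_measurable_continuous_onI continuous_intros)

lemma borel_measurable_damped [measurable]:
  fixes F :: "real \<times> 'a::euclidean_space \<Rightarrow> complex"
  assumes [measurable]: "F \<in> borel_measurable borel"
  shows "damped \<sigma> \<delta> F \<in> borel_measurable borel"
proof -
  have [measurable]: "(\<lambda>z::real \<times> 'a. fst z) \<in> borel_measurable borel"
    by (intro borel_measurable_continuous_onI continuous_intros)
  show ?thesis unfolding damped_def by measurable
qed

lemma nn_integral_time_reflection:
  fixes f :: "real \<times> 'a::euclidean_space \<Rightarrow> ennreal"
  assumes [measurable]: "f \<in> borel_measurable borel" and sg: "\<sigma> = 1 \<or> \<sigma> = - 1"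
  shows "(\<integral>\<^sup>+z. f (\<sigma> * fst z, snd z) \<partial>lborel) = (\<integral>\<^sup>+z. f z \<partial>lborel)"
proof -
  have [measurable]: "f \<in> borel_measurable (borel \<Otimes>\<^sub>M borel)" by (simp add: borel_prod)
  have "(\<integral>\<^sup>+z. f (\<sigma> * fst z, snd z) \<partial>lborel) = (\<integral>\<^sup>+z. f (\<sigma> * fst z, snd z) \<partial>(lborel \<Otimes>\<^sub>M lborel))"
    by (simp only: lborel_prod)
  also have "\<dots> = (\<integral>\<^sup>+t. \<integral>\<^sup>+x. f (\<sigma> * t, x) \<partial>lborel \<partial>lborel)"
    by (subst lborel.nn_integral_fst[symmetric]) simp_all
  also have "\<dots> = (\<integral>\<^sup>+t. \<integral>\<^sup>+x. f (t, x) \<partial>lborel \<partial>lborel)"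
    using sg by (subst (2) nn_integral_real_affine[where c="\<sigma>" and t=0]) auto
  also have "\<dots> = (\<integral>\<^sup>+z. f z \<partial>(lborel \<Otimes>\<^sub>M lborel))"
    by (rule lborel.nn_integral_fst) simp
  finally show ?thesis by (simp only: lborel_prod)
qed

lemma integrable_damped:
  fixes F :: "real \<times> 'a::euclidean_space \<Rightarrow> complex"
  assumes F: "integrable lborel F" and sg: "\<sigma> = 1 \<or> \<sigma> = - 1" and d: "0 \<le> \<delta>"
  shows "integrable lborel (damped \<sigma> \<delta> F)"
proof (rule integrableI_bounded)
  have [measurable]: "F \<in> borel_measurable borel" using F by auto
  show "damped \<sigma> \<delta> F \<in> borel_measurable lborel" by simp
  have "(\<integral>\<^sup>+z. ennreal (norm (damped \<sigma> \<delta> F z)) \<partial>lborel) \<le> (\<integral>\<^sup>+z. ennreal (norm (F (\<sigma> * fst z, snd z))) \<partial>lborel)"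
    by (intro nn_integral_mono ennreal_leI norm_damped_le d)
  also have "\<dots> = (\<integral>\<^sup>+z. ennreal (norm (F z)) \<partial>lborel)"
    by (rule nn_integral_time_reflection[OF _ sg]) simp
  also have "\<dots> < \<infinity>" using F by (simp add: integrable_iff_bounded)
  finally show "(\<integral>\<^sup>+z. ennreal (norm (damped \<sigma> \<delta> F z)) \<partial>lborel) < \<infinity>" .
qed

lemma ft_damped_section:
  "ft (\<lambda>x. damped \<sigma> \<delta> F (s, x)) \<xi> = of_real (if 0 < s then exp (- (\<delta> * s)) else 0) * ft (\<lambda>x. F (\<sigma> * s, x)) \<xi>"
  unfolding ft_def damped_def fst_conv snd_conv mult.left_commute[of "cis _"] by (rule integral_mult_right_zero)

text \<open>Duhamel's formula as a convolution in time over the whole line. For t \<le> 0 both sides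
  vanish, because kernel and source both live on positive times; for t > 0 the integrating factor
  and the initial value 0 give the claim.\<close>

lemma duhamel:
  fixes u :: "real \<times> (real ^ 'n::finite) \<Rightarrow> complex" and \<delta> :: real
  assumes sol: "cauchy_solution \<epsilon> F u" and F: "schwartz F" and sg: "\<sigma> = 1 \<or> \<sigma> = - 1"
  defines "k \<equiv> \<lambda>\<xi> :: real ^ 'n. of_real \<delta> + \<i> * of_real (\<sigma> * ((norm \<xi>) ^ 4 + \<epsilon> * (norm \<xi>)\<^sup>2))"
  shows "(LINT y|lborel. exp_kernel (k \<xi>) y * ft (\<lambda>x. damped \<sigma> \<delta> F (t - y, x)) \<xi>) =
    \<i> * of_real \<sigma> * (of_real (if 0 < t then exp (- (\<delta> * t)) else 0) * ft (\<lambda>x. u (\<sigma> * t, x)) \<xi>)"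
proof -
  define a where "a s = ft (\<lambda>x. damped \<sigma> \<delta> F (s, x)) \<xi>" for s
  define Fh where "Fh s = ft (\<lambda>x. F (s, x)) \<xi>" for s
  define uh where "uh s = ft (\<lambda>x. u (s, x)) \<xi>" for s
  let ?w = "complex_of_real ((norm \<xi>) ^ 4 + \<epsilon> * (norm \<xi>)\<^sup>2)"
  have a: "a s = of_real (if 0 < s then exp (- (\<delta> * s)) else 0) * Fh (\<sigma> * s)" for s
    by (simp add: a_def ft_damped_section Fh_def)
  have Fh_cont: "continuous_on UNIV Fh"
    unfolding Fh_def by (rule continuous_ft_time[OF schwartz_imp_schwartz_in_space[OF F]])
  have [measurable]: "Fh \<in> borel_measurable borel"
    by (rule borel_measurable_continuous_onI[OF Fh_cont])
  have [measurable]: "a \<in> borel_measurable borel" unfolding a by measurable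
  have "(LINT y|lborel. exp_kernel (k \<xi>) y * a (t - y)) = (LINT s|lborel. exp_kernel (k \<xi>) (t - s) * a s)"
    by (subst lborel_integral_real_affine[where c="-1" and t=t]) auto
  also have "\<dots> = \<i> * of_real \<sigma> * (of_real (if 0 < t then exp (- (\<delta> * t)) else 0) * uh (\<sigma> * t))"
  proof (cases "0 < t")
    case False
    then have zero: "exp_kernel (k \<xi>) (t - s) * a s = 0" for s
      by (auto simp: exp_kernel_def a)
    show ?thesis using False unfolding zero by simp
  next
    case True
    define c where "c = \<i> * of_real \<sigma> * ?w"
    have k: "k \<xi> = of_real \<delta> + c" by (simp add: k_def c_def)
    \<comment> \<open>By the ODE, exp(c s) uh(\<sigma> s) has derivative -\<i> \<sigma> exp(c s)
      Fh(\<sigma> s); the factor \<i> \<sigma> in \<open>?W\<close> cancels -\<i> \<sigma>, so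
      \<open>?W\<close> is a primitive of \<open>?f\<close>.\<close>
    let ?f = "\<lambda>s. exp (- (k \<xi> * of_real t)) * (exp (c * of_real s) * Fh (\<sigma> * s))"
    let ?W = "\<lambda>s. \<i> * of_real \<sigma> * exp (- (k \<xi> * of_real t)) * (exp (c * of_real s) * uh (\<sigma> * s))"
    \<comment> \<open>The kernel vanishes at s = t and the source at s = 0, while the closed
      interval contains both points. In between, the dampings of kernel and source multiply to
      exp(-\<delta> t), which is free of \<open>s\<close>.\<close>
    have "AE s in lborel. exp_kernel (k \<xi>) (t - s) * a s = indicator {0..t} s *\<^sub>R ?f s"
      using AE_lborel_singleton[of "0::real"] AE_lborel_singleton[of t]
    proof eventually_elim
      case (elim s)
      have "exp (- (k \<xi> * of_real (t - s))) * of_real (exp (- (\<delta> * s))) = exp (- (k \<xi> * of_real t)) * exp (c * of_real s)"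
        by (simp add: k algebra_simps flip: exp_of_real exp_add)
      then show ?case
        using elim by (auto simp: exp_kernel_def a indicator_def mult.assoc[symmetric])
    qed
    then have "(LINT s|lborel. exp_kernel (k \<xi>) (t - s) * a s) = (LINT s|lborel. indicator {0..t} s *\<^sub>R ?f s)"
    proof (rule integral_cong_AE[rotated 2])
      have [measurable]: "?f \<in> borel_measurable borel"
        using continuous_on_compose2[OF Fh_cont, of UNIV "\<lambda>s. \<sigma> * s"]
        by (intro borel_measurable_continuous_onI continuous_intros) (auto intro!: continuous_intros)
      show "(\<lambda>s. indicator {0..t} s *\<^sub>R ?f s) \<in> borel_measurable lborel" by measurable
    qed measurable
    also have "\<dots> = ?W t - ?W 0"
    proof (rule integral_FTC_atLeastAtMost)
      show "continuous_on {0..t} ?f"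
        using continuous_on_compose2[OF Fh_cont, of "{0..t}" "\<lambda>s. \<sigma> * s"]
        by (intro continuous_intros) (auto intro!: continuous_intros)
      fix s
      have "(uh has_vector_derivative - \<i> * (?w * uh (\<sigma> * s) + Fh (\<sigma> * s))) (at (\<sigma> * s))"
        using ft_cauchy_solution[OF sol F, of \<xi> "\<sigma> * s"] by (simp add: uh_def[abs_def] Fh_def)
      moreover have "((\<lambda>s. \<sigma> * s) has_vector_derivative \<sigma>) (at s)"
        by (auto intro!: derivative_eq_intros)
      ultimately have "(uh \<circ> (\<lambda>s. \<sigma> * s) has_vector_derivative \<sigma> *\<^sub>R (- \<i> * (?w * uh (\<sigma> * s) + Fh (\<sigma> * s)))) (at s)"
        by (rule vector_diff_chain_at[rotated])
      then have uh: "((\<lambda>s. uh (\<sigma> * s)) has_vector_derivative \<sigma> *\<^sub>R (- \<i> * (?w * uh (\<sigma> * s) + Fh (\<sigma> * s)))) (at s)"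
        unfolding comp_def .
      have "((\<lambda>s. exp (c * complex_of_real s)) has_vector_derivative c * exp (c * of_real s)) (at s)"
        by (auto intro!: derivative_eq_intros has_vector_derivative_real_field)
      from has_vector_derivative_mult[OF this uh]
      have "(?W has_vector_derivative \<i> * of_real \<sigma> * exp (- (k \<xi> * of_real t)) *
          (exp (c * of_real s) * (\<sigma> *\<^sub>R (- \<i> * (?w * uh (\<sigma> * s) + Fh (\<sigma> * s)))) + c * exp (c * of_real s) * uh (\<sigma> * s))) (at s)"
        by (intro has_vector_derivative_mult_right)
      also have "\<i> * of_real \<sigma> * exp (- (k \<xi> * of_real t)) *
          (exp (c * of_real s) * (\<sigma> *\<^sub>R (- \<i> * (?w * uh (\<sigma> * s) + Fh (\<sigma> * s)))) + c * exp (c * of_real s) * uh (\<sigma> * s)) = ?f s"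
      proof -
        have "\<i> * of_real \<sigma> * E * (e * (\<sigma> *\<^sub>R (- \<i> * (w * v + f))) + (\<i> * of_real \<sigma> * w) * e * v) = E * (e * f)"
          for E e w v f :: complex
          using sg by (auto simp: scaleR_conv_of_real algebra_simps)
        then show ?thesis unfolding c_def .
      qed
      finally show "(?W has_vector_derivative ?f s) (at s within {0..t})"
        by (rule has_vector_derivative_at_within)
    qed (use True in simp)
    also have "uh (\<sigma> * 0) = 0"
      using sol by (simp add: uh_def ft_def cauchy_solution_def)
    also have "?W t - \<i> * of_real \<sigma> * exp (- (k \<xi> * of_real t)) * (exp (c * of_real 0) * 0) =
      \<i> * of_real \<sigma> * (of_real (exp (- (\<delta> * t))) * uh (\<sigma> * t))"
    proof -
      have "exp (- (k \<xi> * of_real t)) * exp (c * of_real t) = of_real (exp (- (\<delta> * t)))"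
        by (simp add: k algebra_simps flip: exp_of_real exp_add)
      then show ?thesis by (simp add: mult.assoc[symmetric])
    qed
    finally show ?thesis using True by simp
  qed
  finally show ?thesis unfolding a_def uh_def .
qed

text \<open>Parseval in time at fixed \<xi>, applied to the convolution of \<open>duhamel\<close>,
  whose transform is that of the source divided by \<open>k + \<i> * of_real \<tau>\<close>.\<close>

lemma time_pairing:
  fixes u :: "real \<times> (real ^ 'n::finite) \<Rightarrow> complex" and g :: "real \<times> (real ^ 'n) \<Rightarrow> complex"
  assumes sol: "cauchy_solution \<epsilon> F u" and F: "schwartz F" and sg: "\<sigma> = 1 \<or> \<sigma> = - 1" and d: "0 < \<delta>"
    and g: "integrable lborel g" and B: "\<And>t. cmod (ft (\<lambda>x. g (t, x)) \<xi>) \<le> B"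
  shows "(LINT t|lborel. of_real (if 0 < t then exp (- (\<delta> * t)) else 0) * ft (\<lambda>x. u (\<sigma> * t, x)) \<xi> * cnj (ft (\<lambda>x. g (t, x)) \<xi>)) =
    - \<i> * of_real \<sigma> / (2 * pi) * (LINT \<tau>|lborel. ft (damped \<sigma> \<delta> F) (\<tau>, \<xi>) /
      (of_real \<delta> + \<i> * of_real (\<tau> + \<sigma> * ((norm \<xi>) ^ 4 + \<epsilon> * (norm \<xi>)\<^sup>2))) * cnj (ft g (\<tau>, \<xi>)))"
proof -
  define k where "k = of_real \<delta> + \<i> * of_real (\<sigma> * ((norm \<xi>) ^ 4 + \<epsilon> * (norm \<xi>)\<^sup>2))"
  have k: "0 < Re k" using d by (simp add: k_def)
  define a where "a s = ft (\<lambda>x. damped \<sigma> \<delta> F (s, x)) \<xi>" for s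
  define b where "b t = ft (\<lambda>x. g (t, x)) \<xi>" for t
  define c where "c t = (LINT y|lborel. exp_kernel k y * a (t - y))" for t
  have iF: "integrable lborel (damped \<sigma> \<delta> F)"
    using schwartz_integrable[OF F, of "[]"] d by (intro integrable_damped sg) auto
  have a: "integrable lborel a"
    unfolding a_def by (rule integrable_ft_snd[OF iF])
  have b: "integrable lborel b"
    unfolding b_def by (rule integrable_ft_snd[OF g])
  have c: "integrable lborel c"
    unfolding c_def by (rule integrable_convolution[OF integrable_exp_kernel[OF k] a])
  have c_bd: "cmod (c t) \<le> 1 * (LINT x|lborel. cmod (a x))" for t
    unfolding c_def using k by (intro norm_convolution_bounded a norm_exp_kernel_le) simp
  have ft_c: "ft c \<tau> = ft (damped \<sigma> \<delta> F) (\<tau>, \<xi>) / (k + \<i> * of_real \<tau>)" for \<tau>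
  proof -
    have "ft c \<tau> = ft (exp_kernel k) \<tau> * ft a \<tau>"
      unfolding c_def by (rule ft_convolution[OF integrable_exp_kernel[OF k] a])
    then show ?thesis
      by (simp add: ft_exp_kernel[OF k] ft_Pair[OF iF] a_def[abs_def])
  qed
  have ft_b: "ft b \<tau> = ft g (\<tau>, \<xi>)" for \<tau>
    by (simp add: ft_Pair[OF g] b_def[abs_def])
  have c_eq: "c t = \<i> * of_real \<sigma> * (of_real (if 0 < t then exp (- (\<delta> * t)) else 0) * ft (\<lambda>x. u (\<sigma> * t, x)) \<xi>)" for t
    unfolding c_def a_def k_def by (rule duhamel[OF sol F sg])
  \<comment> \<open>Since the solution vanishes at time 0, freezing time at \<open>max 0 t\<close>
    reproduces the cut-off. This shows that \<open>c\<close> has no jump at t = 0, as the continuity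
    hypothesis of \<open>ft_parseval\<close> demands.\<close>
  have "c = (\<lambda>t. \<i> * of_real \<sigma> * (of_real (exp (- (\<delta> * t))) * ft (\<lambda>x. u (\<sigma> * max 0 t, x)) \<xi>))"
  proof
    fix t
    have "ft (\<lambda>x. u (0, x)) \<xi> = 0"
      using sol by (simp add: ft_def cauchy_solution_def)
    then show "c t = \<i> * of_real \<sigma> * (of_real (exp (- (\<delta> * t))) * ft (\<lambda>x. u (\<sigma> * max 0 t, x)) \<xi>)"
      by (simp add: c_eq max_def)
  qed
  moreover have "continuous_on UNIV (\<lambda>t. ft (\<lambda>x. u (\<sigma> * max 0 t, x)) \<xi>)"
    using sol by (intro continuous_on_compose2[OF continuous_ft_time[of u \<xi>], of UNIV "\<lambda>t. \<sigma> * max 0 t"] continuous_intros)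
      (auto simp: cauchy_solution_def)
  ultimately have c_cont: "continuous_on UNIV c"
    by (auto intro!: continuous_intros)
  have "(LINT \<tau>|lborel. ft c \<tau> * cnj (ft b \<tau>)) = (2 * pi) ^ DIM(real) * (LINT t|lborel. c t * cnj (b t))"
  proof (rule ft_parseval[OF c b _ c_bd c_cont])
    show "integrable lborel (\<lambda>\<tau>. ft c \<tau> * cnj (ft b \<tau>))"
    proof (rule integrable_ft_mult_ft[OF c integrable_bounded_square[OF c c_bd] b])
      show "(\<integral>\<^sup>+t. ennreal ((cmod (b t))\<^sup>2) \<partial>lborel) < \<infinity>"
        by (rule integrable_bounded_square[OF b, of B]) (simp add: b_def B)
    qed
  qed
  then have 1: "(LINT t|lborel. c t * cnj (b t)) = 1 / (2 * pi) * (LINT \<tau>|lborel. ft c \<tau> * cnj (ft b \<tau>))"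
    by simp
  have "(LINT t|lborel. of_real (if 0 < t then exp (- (\<delta> * t)) else 0) * ft (\<lambda>x. u (\<sigma> * t, x)) \<xi> * cnj (b t)) =
     (LINT t|lborel. - \<i> * of_real \<sigma> * (c t * cnj (b t)))"
    using sg by (intro Bochner_Integration.integral_cong refl) (auto simp: c_eq mult.assoc)
  also have "\<dots> = - \<i> * of_real \<sigma> * (LINT t|lborel. c t * cnj (b t))"
    by (rule integral_mult_right_zero)
  also have "\<dots> = - \<i> * of_real \<sigma> / (2 * pi) * (LINT \<tau>|lborel. ft c \<tau> * cnj (ft b \<tau>))"
    unfolding 1 by simp
  also have "(\<lambda>\<tau>. ft c \<tau> * cnj (ft b \<tau>)) = (\<lambda>\<tau>. ft (damped \<sigma> \<delta> F) (\<tau>, \<xi>) /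
      (of_real \<delta> + \<i> * of_real (\<tau> + \<sigma> * ((norm \<xi>) ^ 4 + \<epsilon> * (norm \<xi>)\<^sup>2))) * cnj (ft g (\<tau>, \<xi>)))"
    by (simp add: ft_c ft_b k_def algebra_simps)
  finally show ?thesis unfolding b_def .
qed

text \<open>The numerator of the symbol turns the transform of the damped source into that of its
  damped third derivative, which is square integrable, and the denominator has real part \<delta>.
  The bound blows up with 1 / \<delta>, but only integrability is taken from it.\<close>

lemma integrable_symbol_mult:
  fixes F g :: "real \<times> (real ^ 'n::finite) \<Rightarrow> complex"
  assumes F: "schwartz F" and sg: "\<sigma> = 1 \<or> \<sigma> = - 1" and d: "0 < \<delta>"
    and g: "integrable lborel g" "(\<integral>\<^sup>+z. ennreal ((cmod (g z))\<^sup>2) \<partial>lborel) < \<infinity>"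
  shows "integrable lborel (\<lambda>z. symbol \<epsilon> \<sigma> \<delta> i1 i2 i3 z * (ft (damped \<sigma> \<delta> F) z * cnj (ft g z)))"
proof -
  define D where "D = iter_deriv (map space_dir [i1, i2, i3]) F"
  have iF: "integrable lborel (damped \<sigma> \<delta> F)"
    using schwartz_integrable[OF F, of "[]"] d by (intro integrable_damped sg) auto
  have iD: "integrable lborel (damped \<sigma> \<delta> D)"
    unfolding D_def by (intro integrable_damped schwartz_integrable F set_space_dirs sg) (use d in simp)
  obtain B where B: "\<And>z. cmod (D z) \<le> B * decay z"
    using schwartz_decay[OF F set_space_dirs] unfolding D_def by blast
  have "0 \<le> B * decay (0 :: real \<times> (real ^ 'n))" using order_trans[OF norm_ge_zero B] .
  then have "0 \<le> B" by (simp add: decay_def)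
  then have DB: "cmod (D z) \<le> B" for z
    using order_trans[OF B mult_left_mono[OF decay_le_1]] by simp
  have "cmod (damped \<sigma> \<delta> D z) \<le> B" for z
    by (rule order_trans[OF norm_damped_le DB]) (use d in simp)
  then have "(\<integral>\<^sup>+z. ennreal ((cmod (damped \<sigma> \<delta> D z))\<^sup>2) \<partial>lborel) < \<infinity>"
    by (rule integrable_bounded_square[OF iD])
  then have i: "integrable lborel (\<lambda>z. ft (damped \<sigma> \<delta> D) z * cnj (ft g z))"
    by (rule integrable_ft_mult_ft[OF iD _ g])
  have ft_D: "ft (damped \<sigma> \<delta> D) z = \<i> * of_real (snd z $ i1) * (\<i> * of_real (snd z $ i2)) * (\<i> * of_real (snd z $ i3)) * ft (damped \<sigma> \<delta> F) z" for z
  proof (cases z)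
    case (Pair \<tau> \<xi>)
    let ?p = "\<i> * of_real (\<xi> $ i1) * (\<i> * of_real (\<xi> $ i2)) * (\<i> * of_real (\<xi> $ i3))"
    have "ft (\<lambda>x. damped \<sigma> \<delta> D (s, x)) \<xi> = ?p * ft (\<lambda>x. damped \<sigma> \<delta> F (s, x)) \<xi>" for s
      unfolding ft_damped_section D_def
      using ft_space_dirs[OF schwartz_imp_schwartz_in_space[OF F], of "[i1, i2, i3]" "\<sigma> * s" \<xi>]
      by (simp add: mult.assoc mult.left_commute)
    then have "ft (damped \<sigma> \<delta> D) (\<tau>, \<xi>) = ft (\<lambda>s. ?p * ft (\<lambda>x. damped \<sigma> \<delta> F (s, x)) \<xi>) \<tau>"
      by (simp only: ft_Pair[OF iD])
    also have "\<dots> = ?p * ft (\<lambda>s. ft (\<lambda>x. damped \<sigma> \<delta> F (s, x)) \<xi>) \<tau>"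
      unfolding ft_def[of _ \<tau>] mult.left_commute[of "cis _" ?p] by (rule integral_mult_right_zero)
    finally show ?thesis
      by (simp add: Pair ft_Pair[OF iF])
  qed
  have [measurable]: "damped \<sigma> \<delta> F \<in> borel_measurable borel" "g \<in> borel_measurable borel"
    using iF g by auto
  have "integrable lborel (\<lambda>z. of_real (1 / \<delta>) * (ft (damped \<sigma> \<delta> D) z * cnj (ft g z)))"
    using i by simp
  then show ?thesis
  proof (rule Bochner_Integration.integrable_bound)
    show "AE z in lborel. norm (symbol \<epsilon> \<sigma> \<delta> i1 i2 i3 z * (ft (damped \<sigma> \<delta> F) z * cnj (ft g z)))
      \<le> norm (of_real (1 / \<delta>) * (ft (damped \<sigma> \<delta> D) z * cnj (ft g z)))"
    proof (rule AE_I2)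
      fix z :: "real \<times> (real ^ 'n)"
      let ?q = "of_real \<delta> + \<i> * of_real (fst z + \<sigma> * ((norm (snd z)) ^ 4 + \<epsilon> * (norm (snd z))\<^sup>2))"
      have "\<delta> \<le> cmod ?q" using complex_Re_le_cmod[of ?q] by simp
      then have "cmod (1 / ?q) \<le> cmod (of_real (1 / \<delta>))"
        using d by (simp add: norm_divide frac_le)
      moreover have "symbol \<epsilon> \<sigma> \<delta> i1 i2 i3 z * (ft (damped \<sigma> \<delta> F) z * cnj (ft g z)) =
        1 / ?q * (ft (damped \<sigma> \<delta> D) z * cnj (ft g z))"
        by (simp add: symbol_def ft_D)
      ultimately show "norm (symbol \<epsilon> \<sigma> \<delta> i1 i2 i3 z * (ft (damped \<sigma> \<delta> F) z * cnj (ft g z)))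
        \<le> norm (of_real (1 / \<delta>) * (ft (damped \<sigma> \<delta> D) z * cnj (ft g z)))"
        by (simp only: norm_mult) (intro mult_right_mono, auto)
    qed
  qed measurable
qed

text \<open>The decay of the solution is only locally uniform in time, so Parseval is applied one
  group of variables at a time: in x at each fixed t, and, after exchanging the integrals, in t at
  each fixed \<xi>. The test function vanishes outside (0, T], which makes the exchange legitimate.
  The two applications account for (2 pi)^(n+1).\<close>

lemma pairing_identity:
  fixes u F :: "real \<times> (real ^ 'n::finite) \<Rightarrow> complex" and i1 i2 i3 :: 'n
  assumes sol: "cauchy_solution \<epsilon> F u" and F: "schwartz F" and sg: "\<sigma> = 1 \<or> \<sigma> = - 1" and d: "0 < \<delta>"
    and T: "0 < T" and g [measurable]: "g \<in> borel_measurable borel"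
  defines "P \<equiv> \<lambda>z. iter_deriv (map space_dir [i1, i2, i3]) u (\<sigma> * fst z, snd z)"
  assumes g_le: "\<And>z. cmod (g z) \<le> (if 0 < fst z \<and> fst z \<le> T then cmod (P z) else 0)"
    and gi: "integrable lborel g" and gB: "\<And>t. (LINT x|lborel. cmod (g (t, x))) \<le> B"
  shows "(LINT t|lborel. LINT x|lborel. of_real (if 0 < t then exp (- (\<delta> * t)) else 0) * (P (t, x) * cnj (g (t, x)))) =
    - \<i> * of_real \<sigma> / (2 * pi) ^ (CARD('n) + 1) *
      (LINT z|lborel. symbol \<epsilon> \<sigma> \<delta> i1 i2 i3 z * (ft (damped \<sigma> \<delta> F) z * cnj (ft g z)))"
proof -
  have u: "schwartz_in_space u" using sol by (simp add: cauchy_solution_def)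
  let ?bs = "map space_dir [i1, i2, i3]"
  let ?e = "\<lambda>t. complex_of_real (if 0 < t then exp (- (\<delta> * t)) else 0)"
  let ?K = "complex_of_real ((2 * pi) ^ CARD('n))"
  obtain A where A: "\<And>t x. \<bar>t\<bar> \<le> T \<Longrightarrow> cmod (iter_deriv ?bs u (t, x)) \<le> A * decay x"
    using schwartz_in_space_decay[OF u set_space_dirs] by blast
  have "0 \<le> A * decay (0 :: real ^ 'n)" using order_trans[OF norm_ge_zero A[of 0 0]] T by simp
  then have A0: "0 \<le> A" by (simp add: decay_def)
  have P_decay: "cmod (P (t, x)) \<le> A * decay x" if "0 < t" "t \<le> T" for t x
    using A[of "\<sigma> * t" x] that sg by (auto simp: P_def)
  have P_bd: "cmod (P (t, x)) \<le> A" if "0 < t" "t \<le> T" for t x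
    using order_trans[OF P_decay[OF that] mult_left_mono[OF decay_le_1 A0]] by simp
  have g0: "g (t, x) = 0" if "\<not> (0 < t \<and> t \<le> T)" for t x
    using g_le[of "(t, x)"] that by auto
  have P_meas [measurable]: "P \<in> borel_measurable borel"
  proof -
    have [measurable]: "iter_deriv ?bs u \<in> borel_measurable borel"
      by (intro borel_measurable_continuous_onI smooth_continuous smooth_u u set_space_dirs)
    show ?thesis unfolding P_def by measurable
  qed
  have P_sect: "integrable lborel (\<lambda>x. P (t, x))" "continuous_on UNIV (\<lambda>x. P (t, x))" for t
    unfolding P_def by (simp_all only: fst_conv snd_conv integrable_space_section[OF u set_space_dirs] continuous_space_section[OF u set_space_dirs])
  have g_sect: "integrable lborel (\<lambda>x. g (t, x))" for t
  proof (cases "0 < t \<and> t \<le> T")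
    case True
    show ?thesis
    proof (rule Bochner_Integration.integrable_bound[OF P_sect(1)[of t]])
      show "AE x in lborel. norm (g (t, x)) \<le> norm (P (t, x))"
        using g_le[of "(t, _)"] True by auto
    qed simp
  qed (simp add: g0)
  have P_L2: "(\<integral>\<^sup>+x. ennreal ((cmod (P (t, x)))\<^sup>2) \<partial>lborel) \<le> (ennreal A)\<^sup>2 * (\<integral>\<^sup>+x. ennreal (decay (x :: real ^ 'n)) \<partial>lborel)"
    if t: "0 < t" "t \<le> T" for t
  proof -
    have "(\<integral>\<^sup>+x. ennreal ((cmod (P (t, x)))\<^sup>2) \<partial>lborel) \<le> (\<integral>\<^sup>+x. (ennreal A)\<^sup>2 * ennreal (decay (x :: real ^ 'n)) \<partial>lborel)"
    proof (rule nn_integral_mono)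
      fix x :: "real ^ 'n"
      have "(cmod (P (t, x)))\<^sup>2 \<le> A * (A * decay x)"
        unfolding power2_eq_square by (intro mult_mono P_decay P_bd t A0) auto
      then show "ennreal ((cmod (P (t, x)))\<^sup>2) \<le> (ennreal A)\<^sup>2 * ennreal (decay x)"
        using A0 decay_pos[of x] by (simp add: power2_eq_square ennreal_mult[symmetric] ennreal_leI mult.assoc)
    qed
    also have "\<dots> = (ennreal A)\<^sup>2 * (\<integral>\<^sup>+x. ennreal (decay (x :: real ^ 'n)) \<partial>lborel)"
      by (rule nn_integral_cmult) measurable
    finally show ?thesis .
  qed
  define L where "L = (ennreal A)\<^sup>2 * (\<integral>\<^sup>+x. ennreal (decay (x :: real ^ 'n)) \<partial>lborel)"
  have decay_nn: "(\<integral>\<^sup>+x. ennreal (decay (x :: real ^ 'n)) \<partial>lborel) < \<infinity>"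
    using integrable_decay[where ?'a="real ^ 'n"] decay_pos[where ?'a="real ^ 'n"]
    by (simp add: integrable_iff_bounded less_imp_le)
  have L: "L < \<infinity>"
    unfolding L_def using decay_nn by (simp add: ennreal_mult_less_top power2_eq_square)
  have g_L2: "(\<integral>\<^sup>+x. ennreal ((cmod (g (t, x)))\<^sup>2) \<partial>lborel) \<le> L" for t
  proof (cases "0 < t \<and> t \<le> T")
    case True
    have "(\<integral>\<^sup>+x. ennreal ((cmod (g (t, x)))\<^sup>2) \<partial>lborel) \<le> (\<integral>\<^sup>+x. ennreal ((cmod (P (t, x)))\<^sup>2) \<partial>lborel)"
      using g_le[of "(t, _)"] True by (intro nn_integral_mono ennreal_leI power_mono) auto
    also have "\<dots> \<le> L" unfolding L_def using P_L2 True by blast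
    finally show ?thesis .
  qed (simp add: g0)
  \<comment> \<open>The intermediate integrand, transformed in x but not yet in t.\<close>
  define \<Phi> where "\<Phi> t \<xi> = ?e t * (ft (\<lambda>x. P (t, x)) \<xi> * cnj (ft (\<lambda>x. g (t, x)) \<xi>))" for t \<xi>
  have space: "(LINT x|lborel. ?e t * (P (t, x) * cnj (g (t, x)))) = 1 / ?K * (LINT \<xi>|lborel. \<Phi> t \<xi>)" for t
  proof (cases "0 < t \<and> t \<le> T")
    case True
    have "(LINT \<xi>|lborel. ft (\<lambda>x. P (t, x)) \<xi> * cnj (ft (\<lambda>x. g (t, x)) \<xi>)) =
      (2 * pi) ^ DIM(real ^ 'n) * (LINT x|lborel. P (t, x) * cnj (g (t, x)))"
    proof (rule ft_parseval[OF P_sect(1) g_sect _ _ P_sect(2)])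
      show "integrable lborel (\<lambda>\<xi>. ft (\<lambda>x. P (t, x)) \<xi> * cnj (ft (\<lambda>x. g (t, x)) \<xi>))"
        using P_L2[of t] True L g_L2[of t]
        by (intro integrable_ft_mult_ft P_sect g_sect) (auto simp: L_def intro: le_less_trans)
      show "cmod (P (t, x)) \<le> A" for x using P_bd True by blast
    qed
    then have "(LINT x|lborel. P (t, x) * cnj (g (t, x))) = 1 / ?K * (LINT \<xi>|lborel. ft (\<lambda>x. P (t, x)) \<xi> * cnj (ft (\<lambda>x. g (t, x)) \<xi>))"
      by simp
    moreover have "(LINT x|lborel. ?e t * (P (t, x) * cnj (g (t, x)))) = ?e t * (LINT x|lborel. P (t, x) * cnj (g (t, x)))"
      by (rule integral_mult_right_zero)
    moreover have "(LINT \<xi>|lborel. \<Phi> t \<xi>) = ?e t * (LINT \<xi>|lborel. ft (\<lambda>x. P (t, x)) \<xi> * cnj (ft (\<lambda>x. g (t, x)) \<xi>))"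
      unfolding \<Phi>_def by (rule integral_mult_right_zero)
    ultimately show ?thesis by simp
  next
    case False
    have "\<Phi> t \<xi> = 0" for \<xi>
      unfolding \<Phi>_def g0[OF False] by (simp add: ft_def)
    then show ?thesis by (simp add: g0[OF False])
  qed
  \<comment> \<open>Cauchy-Schwarz and Bessel bound the integral over \<xi> by (2 pi)^n L uniformly
    for t in (0, T], an interval of finite length.\<close>
  have \<Phi>_int: "integrable (lborel \<Otimes>\<^sub>M lborel) (case_prod \<Phi>)"
  proof (rule integrableI_bounded)
    have [measurable]: "P \<in> borel_measurable (borel \<Otimes>\<^sub>M borel)" "g \<in> borel_measurable (borel \<Otimes>\<^sub>M borel)"
      by (simp_all add: borel_prod)
    show m: "case_prod \<Phi> \<in> borel_measurable (lborel \<Otimes>\<^sub>M lborel)"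
      unfolding \<Phi>_def ft_def by measurable
    have "(\<integral>\<^sup>+p. ennreal (norm (case_prod \<Phi> p)) \<partial>(lborel \<Otimes>\<^sub>M lborel)) = (\<integral>\<^sup>+t. \<integral>\<^sup>+\<xi>. ennreal (cmod (\<Phi> t \<xi>)) \<partial>lborel \<partial>lborel)"
      using m by (subst lborel.nn_integral_fst[symmetric]) (simp_all add: case_prod_unfold)
    also have "\<dots> \<le> (\<integral>\<^sup>+t. (ennreal ((2 * pi) ^ CARD('n)) * L) * indicator {0..T} t \<partial>lborel)"
    proof (rule nn_integral_mono)
      fix t
      show "(\<integral>\<^sup>+\<xi>. ennreal (cmod (\<Phi> t \<xi>)) \<partial>lborel) \<le> (ennreal ((2 * pi) ^ CARD('n)) * L) * indicator {0..T} t"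
      proof (cases "0 < t \<and> t \<le> T")
        case True
        let ?a = "\<lambda>\<xi>. ennreal (cmod (ft (\<lambda>x. P (t, x)) \<xi>))" and ?b = "\<lambda>\<xi>. ennreal (cmod (ft (\<lambda>x. g (t, x)) \<xi>))"
        have [measurable]: "(\<lambda>x. P (t, x)) \<in> borel_measurable borel" "(\<lambda>x. g (t, x)) \<in> borel_measurable borel"
          using P_sect(1)[of t] g_sect[of t] by auto
        have "(\<integral>\<^sup>+\<xi>. ennreal (cmod (\<Phi> t \<xi>)) \<partial>lborel) \<le> (\<integral>\<^sup>+\<xi>. ?a \<xi> * ?b \<xi> \<partial>lborel)"
          using d True by (intro nn_integral_mono)
            (auto simp: \<Phi>_def norm_mult ennreal_mult'[symmetric] intro!: ennreal_leI mult_left_le_one_le)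
        also have "\<dots> \<le> esqrt (\<integral>\<^sup>+\<xi>. (?a \<xi>)\<^sup>2 \<partial>lborel) * esqrt (\<integral>\<^sup>+\<xi>. (?b \<xi>)\<^sup>2 \<partial>lborel)"
          by (rule nn_integral_mult_le_esqrt) measurable
        also have "\<dots> \<le> esqrt (ennreal ((2 * pi) ^ CARD('n)) * L) * esqrt (ennreal ((2 * pi) ^ CARD('n)) * L)"
        proof (intro mult_mono esqrt_mono)
          have "(\<integral>\<^sup>+\<xi>. (?a \<xi>)\<^sup>2 \<partial>lborel) \<le> ennreal ((2 * pi) ^ CARD('n)) * (\<integral>\<^sup>+x. ennreal ((cmod (P (t, x)))\<^sup>2) \<partial>lborel)"
            using bessel[OF P_sect(1)[of t]] by (simp add: ennreal_power)
          also have "\<dots> \<le> ennreal ((2 * pi) ^ CARD('n)) * L"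
            using P_L2[of t] True by (intro mult_left_mono) (auto simp: L_def)
          finally show "(\<integral>\<^sup>+\<xi>. (?a \<xi>)\<^sup>2 \<partial>lborel) \<le> ennreal ((2 * pi) ^ CARD('n)) * L" .
          have "(\<integral>\<^sup>+\<xi>. (?b \<xi>)\<^sup>2 \<partial>lborel) \<le> ennreal ((2 * pi) ^ CARD('n)) * (\<integral>\<^sup>+x. ennreal ((cmod (g (t, x)))\<^sup>2) \<partial>lborel)"
            using bessel[OF g_sect[of t]] by (simp add: ennreal_power)
          also have "\<dots> \<le> ennreal ((2 * pi) ^ CARD('n)) * L"
            by (intro mult_left_mono g_L2) simp
          finally show "(\<integral>\<^sup>+\<xi>. (?b \<xi>)\<^sup>2 \<partial>lborel) \<le> ennreal ((2 * pi) ^ CARD('n)) * L" .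
        qed auto
        also have "\<dots> = ennreal ((2 * pi) ^ CARD('n)) * L"
          by (simp only: power2_eq_square[symmetric] esqrt_power2)
        finally show ?thesis using True by simp
      next
        case False
        have "\<Phi> t \<xi> = 0" for \<xi>
          unfolding \<Phi>_def g0[OF False] by (simp add: ft_def)
        then show ?thesis by simp
      qed
    qed
    also have "\<dots> = (ennreal ((2 * pi) ^ CARD('n)) * L) * emeasure lborel {0..T}"
      by (rule nn_integral_cmult_indicator) simp
    also have "\<dots> < \<infinity>"
      using L T by (simp add: ennreal_mult_less_top)
    finally show "(\<integral>\<^sup>+p. ennreal (norm (case_prod \<Phi> p)) \<partial>(lborel \<Otimes>\<^sub>M lborel)) < \<infinity>" .
  qed
  have g_sq: "(\<integral>\<^sup>+z. ennreal ((cmod (g z))\<^sup>2) \<partial>lborel) < \<infinity>"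
  proof (rule integrable_bounded_square[OF gi])
    show "cmod (g z) \<le> A" for z
      using g_le[of z] P_bd[of "fst z" "snd z"] A0 by (auto split: if_splits intro: order_trans)
  qed
  let ?H = "\<lambda>z. symbol \<epsilon> \<sigma> \<delta> i1 i2 i3 z * (ft (damped \<sigma> \<delta> F) z * cnj (ft g z))"
  have H: "integrable (lborel \<Otimes>\<^sub>M lborel) (\<lambda>(\<tau>, \<xi>). ?H (\<tau>, \<xi>))"
    using integrable_symbol_mult[OF F sg d gi g_sq] by (simp add: lborel_prod case_prod_unfold)
  have time: "(LINT t|lborel. \<Phi> t \<xi>) = - \<i> * of_real \<sigma> / (2 * pi) * (LINT \<tau>|lborel. ?H (\<tau>, \<xi>))" for \<xi>
  proof -
    let ?p = "\<i> * of_real (\<xi> $ i1) * (\<i> * of_real (\<xi> $ i2)) * (\<i> * of_real (\<xi> $ i3))"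
    let ?q = "\<lambda>\<tau>. of_real \<delta> + \<i> * of_real (\<tau> + \<sigma> * ((norm \<xi>) ^ 4 + \<epsilon> * (norm \<xi>)\<^sup>2))"
    have "ft (\<lambda>x. P (t, x)) \<xi> = ?p * ft (\<lambda>x. u (\<sigma> * t, x)) \<xi>" for t
      unfolding P_def fst_conv snd_conv ft_space_dirs[OF u] by (simp add: mult.assoc)
    then have "\<Phi> t \<xi> = ?p * (?e t * ft (\<lambda>x. u (\<sigma> * t, x)) \<xi> * cnj (ft (\<lambda>x. g (t, x)) \<xi>))" for t
      unfolding \<Phi>_def by (simp only: mult.assoc mult.left_commute)
    then have "(LINT t|lborel. \<Phi> t \<xi>) = (LINT t|lborel. ?p * (?e t * ft (\<lambda>x. u (\<sigma> * t, x)) \<xi> * cnj (ft (\<lambda>x. g (t, x)) \<xi>)))"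
      by simp
    also have "\<dots> = ?p * (LINT t|lborel. ?e t * ft (\<lambda>x. u (\<sigma> * t, x)) \<xi> * cnj (ft (\<lambda>x. g (t, x)) \<xi>))"
      by (rule integral_mult_right_zero)
    also have "(LINT t|lborel. ?e t * ft (\<lambda>x. u (\<sigma> * t, x)) \<xi> * cnj (ft (\<lambda>x. g (t, x)) \<xi>)) =
       - \<i> * of_real \<sigma> / (2 * pi) * (LINT \<tau>|lborel. ft (damped \<sigma> \<delta> F) (\<tau>, \<xi>) / ?q \<tau> * cnj (ft g (\<tau>, \<xi>)))"
    proof (rule time_pairing[OF sol F sg d gi])
      show "cmod (ft (\<lambda>x. g (t, x)) \<xi>) \<le> B" for t
        using norm_ft_le[OF g_sect] gB order_trans by blast
    qed
    also have "?p * (- \<i> * of_real \<sigma> / (2 * pi) * (LINT \<tau>|lborel. ft (damped \<sigma> \<delta> F) (\<tau>, \<xi>) / ?q \<tau> * cnj (ft g (\<tau>, \<xi>)))) =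
       - \<i> * of_real \<sigma> / (2 * pi) * (?p * (LINT \<tau>|lborel. ft (damped \<sigma> \<delta> F) (\<tau>, \<xi>) / ?q \<tau> * cnj (ft g (\<tau>, \<xi>))))"
      by (rule mult.left_commute)
    also have "?p * (LINT \<tau>|lborel. ft (damped \<sigma> \<delta> F) (\<tau>, \<xi>) / ?q \<tau> * cnj (ft g (\<tau>, \<xi>))) =
       (LINT \<tau>|lborel. ?p * (ft (damped \<sigma> \<delta> F) (\<tau>, \<xi>) / ?q \<tau> * cnj (ft g (\<tau>, \<xi>))))"
      by (rule integral_mult_right_zero[symmetric])
    also have "(\<lambda>\<tau>. ?p * (ft (damped \<sigma> \<delta> F) (\<tau>, \<xi>) / ?q \<tau> * cnj (ft g (\<tau>, \<xi>)))) = (\<lambda>\<tau>. ?H (\<tau>, \<xi>))"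
      by (simp add: symbol_def)
    finally show ?thesis .
  qed
  have "(LINT t|lborel. LINT x|lborel. ?e t * (P (t, x) * cnj (g (t, x)))) = (LINT t|lborel. 1 / ?K * (LINT \<xi>|lborel. \<Phi> t \<xi>))"
    by (simp only: space)
  also have "\<dots> = 1 / ?K * (LINT t|lborel. LINT \<xi>|lborel. \<Phi> t \<xi>)"
    by (rule integral_mult_right_zero)
  also have "(LINT t|lborel. LINT \<xi>|lborel. \<Phi> t \<xi>) = (LINT \<xi>|lborel. LINT t|lborel. \<Phi> t \<xi>)"
    by (rule lborel_pair.Fubini_integral[OF \<Phi>_int, symmetric])
  also have "\<dots> = (LINT \<xi>|lborel. - \<i> * of_real \<sigma> / (2 * pi) * (LINT \<tau>|lborel. ?H (\<tau>, \<xi>)))"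
    by (simp only: time)
  also have "\<dots> = - \<i> * of_real \<sigma> / (2 * pi) * (LINT \<xi>|lborel. LINT \<tau>|lborel. ?H (\<tau>, \<xi>))"
    by (rule integral_mult_right_zero)
  also have "(LINT \<xi>|lborel. LINT \<tau>|lborel. ?H (\<tau>, \<xi>)) = (LINT z|lborel. ?H z)"
    using lborel_pair.integral_snd[OF H] by (simp add: lborel_prod case_prod_unfold)
  finally show ?thesis by simp
qed


section \<open>Sums over unit cubes\<close>

text \<open>A bridge between two notions of sum: the counting-measure integral admits Tonelli's
  theorem, while the final estimate is stated with \<open>infsum\<close>. Finite initial segments of
  an enumeration exhaust the index type.\<close>

lemma nn_integral_count_space_le_infsum:
  fixes f :: "'a::countable \<Rightarrow> ennreal"
  shows "(\<integral>\<^sup>+\<alpha>. f \<alpha> \<partial>count_space UNIV) \<le> (\<Sum>\<^sub>\<infinity>\<alpha>\<in>UNIV. f \<alpha>)"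
proof (rule nn_integral_le_of_tendsto)
  let ?A = "\<lambda>m. {\<alpha>::'a. to_nat \<alpha> \<le> m}"
  have fin: "finite (?A m)" for m
    by (rule finite_imageD[of to_nat]) (auto intro: finite_subset[of _ "{..m}"] inj_on_subset[OF inj_to_nat])
  show "(\<lambda>m. f \<alpha> * indicator (?A m) \<alpha>) \<longlonglongrightarrow> f \<alpha>" for \<alpha>
  proof (rule tendsto_eventually)
    show "\<forall>\<^sub>F m in sequentially. f \<alpha> * indicator (?A m) \<alpha> = f \<alpha>"
      using eventually_ge_at_top[of "to_nat \<alpha>"] by eventually_elim simp
  qed
  show "(\<integral>\<^sup>+\<alpha>. f \<alpha> * indicator (?A m) \<alpha> \<partial>count_space UNIV) \<le> (\<Sum>\<^sub>\<infinity>\<alpha>\<in>UNIV. f \<alpha>)" for m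
  proof -
    have "(\<integral>\<^sup>+\<alpha>. f \<alpha> * indicator (?A m) \<alpha> \<partial>count_space UNIV) = (\<Sum>\<alpha>\<in>?A m. f \<alpha> * indicator (?A m) \<alpha>)"
      by (rule nn_integral_count_space'[OF fin]) (auto simp: indicator_def)
    also have "\<dots> = (\<Sum>\<alpha>\<in>?A m. f \<alpha>)" by (rule sum.cong) auto
    also have "\<dots> \<le> (SUP A\<in>{A. finite A \<and> A \<subseteq> UNIV}. \<Sum>\<alpha>\<in>A. f \<alpha>)"
      using fin by (intro SUP_upper) auto
    also have "\<dots> = (\<Sum>\<^sub>\<infinity>\<alpha>\<in>UNIV. f \<alpha>)"
      by (rule nonneg_infsum_complete[symmetric]) simp
    finally show ?thesis .
  qed
qed simp

text \<open>Subadditivity of the square root: writing f as the square of its root, one copy is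
  bounded by the total \<open>?S\<close>.\<close>

lemma esqrt_count_space_le:
  "esqrt (\<integral>\<^sup>+\<alpha>. f \<alpha> \<partial>count_space UNIV) \<le> (\<integral>\<^sup>+\<alpha>. esqrt (f \<alpha>) \<partial>count_space UNIV)"
proof -
  let ?S = "\<integral>\<^sup>+\<alpha>. esqrt (f \<alpha>) \<partial>count_space UNIV"
  have "(\<integral>\<^sup>+\<alpha>. f \<alpha> \<partial>count_space UNIV) = (\<integral>\<^sup>+\<alpha>. esqrt (f \<alpha>) * esqrt (f \<alpha>) \<partial>count_space UNIV)"
    by (simp only: power2_eq_square[symmetric] esqrt_power2)
  also have "\<dots> \<le> (\<integral>\<^sup>+\<alpha>. esqrt (f \<alpha>) * ?S \<partial>count_space UNIV)"
    by (intro nn_integral_mono mult_left_mono nn_integral_ge_point) auto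
  also have "\<dots> = ?S\<^sup>2"
    by (simp add: nn_integral_multc power2_eq_square)
  finally have "esqrt (\<integral>\<^sup>+\<alpha>. f \<alpha> \<partial>count_space UNIV) \<le> esqrt (?S\<^sup>2)"
    by (rule esqrt_mono)
  then show ?thesis by (simp only: esqrt_of_power2)
qed

section \<open>Unit cubes and mixed norms\<close>

lemma unit_cube_borel [measurable]: "unit_cube (\<alpha> :: int ^ 'n::finite) \<in> sets borel"
proof -
  have "unit_cube \<alpha> = (\<Inter>i\<in>UNIV. (\<lambda>x. x $ i - of_int (\<alpha> $ i)) -` {-1/2..<1/2})"
    by (auto simp: unit_cube_def)
  also have "\<dots> \<in> sets borel"
  proof (rule sets.finite_INT)
    fix i
    have "(\<lambda>x::real ^ 'n. x $ i - of_int (\<alpha> $ i)) \<in> borel_measurable borel"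
      by (intro borel_measurable_continuous_onI continuous_intros)
    from measurable_sets_borel[OF this, of "{-1/2..<1/2}"]
    show "(\<lambda>x::real ^ 'n. x $ i - of_int (\<alpha> $ i)) -` {-1/2..<1/2} \<in> sets borel" by simp
  qed auto
  finally show ?thesis .
qed

lemma time_cylinder_borel [measurable]:
  fixes Q :: "(real ^ 'n::finite) set"
  assumes Q [measurable]: "Q \<in> sets borel"
  shows "UNIV \<times> Q \<in> sets (borel :: (real \<times> (real ^ 'n)) measure)"
  by (simp add: borel_prod[symmetric])

lemma bounded_unit_cube: "bounded (unit_cube \<alpha>)"
proof (rule bounded_subset[OF bounded_cbox])
  show "unit_cube \<alpha> \<subseteq> cbox (\<chi> i. of_int (\<alpha> $ i) - 1/2) (\<chi> i. of_int (\<alpha> $ i) + 1/2)"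
  proof
    fix x assume x: "x \<in> unit_cube \<alpha>"
    have "of_int (\<alpha> $ i) - 1/2 \<le> x $ i \<and> x $ i \<le> of_int (\<alpha> $ i) + 1/2" for i
    proof -
      have "x $ i - of_int (\<alpha> $ i) \<in> {-1/2..<1/2}" using x by (simp only: unit_cube_def mem_Collect_eq)
      then show ?thesis unfolding atLeastLessThan_iff by linarith
    qed
    then show "x \<in> cbox (\<chi> i. of_int (\<alpha> $ i) - 1/2) (\<chi> i. of_int (\<alpha> $ i) + 1/2)"
      by (simp add: mem_box_cart)
  qed
qed

lemma unit_cube_cover: "\<exists>\<alpha>. x \<in> unit_cube \<alpha>"
proof
  show "x \<in> unit_cube (\<chi> i. \<lfloor>x $ i + 1/2\<rfloor>)"
    unfolding unit_cube_def
  proof (intro CollectI allI)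
    fix i
    have "- 1/2 \<le> x $ i - of_int \<lfloor>x $ i + 1/2\<rfloor> \<and> x $ i - of_int \<lfloor>x $ i + 1/2\<rfloor> < 1/2"
      by linarith
    then show "x $ i - of_int ((\<chi> i. \<lfloor>x $ i + 1/2\<rfloor>) $ i) \<in> {-1/2..<1/2}"
      by (simp only: atLeastLessThan_iff vec_lambda_beta)
  qed
qed

text \<open>Cauchy-Schwarz in x_j over an interval of length 1 costs no constant. It is used for the
  pieces of the source and for the test function, which all live over a single cube.\<close>

lemma slab_norm_le_of_support:
  fixes H :: "real \<times> (real ^ 'n::finite) \<Rightarrow> complex"
  assumes [measurable]: "H \<in> borel_measurable borel"
    and supp: "\<And>z. H z \<noteq> 0 \<Longrightarrow> snd z $ j - c \<in> {-1/2..<1/2}"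
  shows "slab_norm j H \<le> esqrt (\<integral>\<^sup>+z. ennreal ((cmod (H z))\<^sup>2) \<partial>lborel)"
proof -
  let ?h = "\<lambda>y. \<integral>\<^sup>+\<omega>. ennreal ((cmod (H (swap_time j (y, \<omega>))))\<^sup>2) \<partial>lborel"
  let ?I = "{c - 1/2..<c + 1/2}"
  have [measurable]: "(\<lambda>p. H (swap_time j p)) \<in> borel_measurable (borel \<Otimes>\<^sub>M borel)"
    by (simp add: borel_prod)
  have "slab_norm j H = (\<integral>\<^sup>+y. indicator ?I y * esqrt (?h y) \<partial>lborel)"
    unfolding slab_norm_def
  proof (rule nn_integral_cong)
    fix y
    show "esqrt (?h y) = indicator ?I y * esqrt (?h y)"
    proof (cases "y \<in> ?I")
      case False
      have "H (swap_time j (y, \<omega>)) = 0" for \<omega>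
      proof (rule ccontr)
        assume "H (swap_time j (y, \<omega>)) \<noteq> 0"
        from supp[OF this] show "False"
          using False by (simp add: swap_time_def)
      qed
      then show ?thesis by (simp add: esqrt_def)
    qed simp
  qed
  also have "\<dots> \<le> esqrt (\<integral>\<^sup>+y. (indicator ?I y)\<^sup>2 \<partial>lborel) * esqrt (\<integral>\<^sup>+y. (esqrt (?h y))\<^sup>2 \<partial>lborel)"
    by (rule nn_integral_mult_le_esqrt) measurable
  also have "(\<integral>\<^sup>+y. (indicator ?I y)\<^sup>2 \<partial>lborel) = (\<integral>\<^sup>+y. indicator ?I y \<partial>lborel)"
    by (intro nn_integral_cong) (simp add: indicator_def)
  also have "\<dots> = 1" by simp
  also have "(\<integral>\<^sup>+y. (esqrt (?h y))\<^sup>2 \<partial>lborel) = (\<integral>\<^sup>+p. ennreal ((cmod (H (swap_time j p)))\<^sup>2) \<partial>(lborel \<Otimes>\<^sub>M lborel))"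
    unfolding esqrt_power2 by (rule lborel.nn_integral_fst) measurable
  also have "\<dots> = (\<integral>\<^sup>+z. ennreal ((cmod (H z))\<^sup>2) \<partial>lborel)"
    unfolding lborel_prod by (rule nn_integral_swap_time) measurable
  finally show ?thesis by (simp add: esqrt_def)
qed

text \<open>F is split into its restrictions to the cubes, and subadditivity of the square root
  carries the sum over cubes out of the inner L^2 norm; \<open>slab_norm_le_of_support\<close>
  handles each piece.\<close>

lemma slab_norm_le_infsum:
  fixes F :: "real \<times> (real ^ 'n::finite) \<Rightarrow> complex"
  assumes [measurable]: "F \<in> borel_measurable borel"
  shows "slab_norm j F \<le> (\<Sum>\<^sub>\<infinity>\<alpha>\<in>(UNIV :: (int ^ 'n) set). L2_norm_on (UNIV \<times> unit_cube \<alpha>) F)"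
proof -
  define G where "G \<alpha> z = indicator (UNIV \<times> unit_cube \<alpha>) z * F z" for \<alpha> :: "int ^ 'n" and z
  have [measurable]: "G \<alpha> \<in> borel_measurable borel" for \<alpha>
    unfolding G_def by measurable
  have [measurable]: "(\<lambda>p. G \<alpha> (swap_time j p)) \<in> borel_measurable (borel \<Otimes>\<^sub>M borel)" for \<alpha>
    by (simp add: borel_prod)
  let ?sq = "\<lambda>f z. ennreal ((cmod (f z))\<^sup>2)"
  have F_le: "?sq F z \<le> (\<integral>\<^sup>+\<alpha>. ?sq (G \<alpha>) z \<partial>count_space UNIV)" for z
  proof -
    obtain \<alpha> where "snd z \<in> unit_cube \<alpha>" using unit_cube_cover by blast
    then have "?sq F z = ?sq (G \<alpha>) z"
      by (simp add: G_def indicator_def mem_Times_iff)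
    also have "\<dots> \<le> (\<integral>\<^sup>+\<alpha>. ?sq (G \<alpha>) z \<partial>count_space UNIV)"
      by (rule nn_integral_ge_point) simp
    finally show ?thesis .
  qed
  have cnt: "countable (UNIV :: (int ^ 'n) set)" by simp
  have "slab_norm j F \<le> (\<integral>\<^sup>+y. \<integral>\<^sup>+\<alpha>. esqrt (\<integral>\<^sup>+\<omega>. ?sq (G \<alpha>) (swap_time j (y, \<omega>)) \<partial>lborel) \<partial>count_space UNIV \<partial>lborel)"
    unfolding slab_norm_def
  proof (rule nn_integral_mono)
    fix y
    have "(\<integral>\<^sup>+\<omega>. ?sq F (swap_time j (y, \<omega>)) \<partial>lborel) \<le>
       (\<integral>\<^sup>+\<omega>. \<integral>\<^sup>+\<alpha>. ?sq (G \<alpha>) (swap_time j (y, \<omega>)) \<partial>count_space UNIV \<partial>lborel)"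
      by (intro nn_integral_mono F_le)
    also have "\<dots> = (\<integral>\<^sup>+\<alpha>. \<integral>\<^sup>+\<omega>. ?sq (G \<alpha>) (swap_time j (y, \<omega>)) \<partial>lborel \<partial>count_space UNIV)"
      by (rule nn_integral_count_space_nn_integral[OF cnt]) measurable
    finally have "esqrt (\<integral>\<^sup>+\<omega>. ?sq F (swap_time j (y, \<omega>)) \<partial>lborel) \<le>
       esqrt (\<integral>\<^sup>+\<alpha>. \<integral>\<^sup>+\<omega>. ?sq (G \<alpha>) (swap_time j (y, \<omega>)) \<partial>lborel \<partial>count_space UNIV)"
      by (rule esqrt_mono)
    also have "\<dots> \<le> (\<integral>\<^sup>+\<alpha>. esqrt (\<integral>\<^sup>+\<omega>. ?sq (G \<alpha>) (swap_time j (y, \<omega>)) \<partial>lborel) \<partial>count_space UNIV)"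
      by (rule esqrt_count_space_le)
    finally show "esqrt (\<integral>\<^sup>+\<omega>. ?sq F (swap_time j (y, \<omega>)) \<partial>lborel) \<le>
      (\<integral>\<^sup>+\<alpha>. esqrt (\<integral>\<^sup>+\<omega>. ?sq (G \<alpha>) (swap_time j (y, \<omega>)) \<partial>lborel) \<partial>count_space UNIV)" .
  qed
  also have "\<dots> = (\<integral>\<^sup>+\<alpha>. slab_norm j (G \<alpha>) \<partial>count_space UNIV)"
    unfolding slab_norm_def by (rule nn_integral_count_space_nn_integral[OF cnt]) measurable
  also have "\<dots> \<le> (\<integral>\<^sup>+\<alpha>. L2_norm_on (UNIV \<times> unit_cube \<alpha>) F \<partial>count_space UNIV)"
  proof (rule nn_integral_mono)
    fix \<alpha> :: "int ^ 'n"
    have "slab_norm j (G \<alpha>) \<le> esqrt (\<integral>\<^sup>+z. ?sq (G \<alpha>) z \<partial>lborel)"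
    proof (rule slab_norm_le_of_support)
      fix z assume "G \<alpha> z \<noteq> 0"
      then have "snd z \<in> unit_cube \<alpha>"
        by (auto simp: G_def indicator_def split: if_splits)
      then show "snd z $ j - of_int (\<alpha> $ j) \<in> {-1/2..<1/2}"
        unfolding unit_cube_def by blast
    qed measurable
    also have "(\<integral>\<^sup>+z. ?sq (G \<alpha>) z \<partial>lborel) = (\<integral>\<^sup>+z\<in>UNIV \<times> unit_cube \<alpha>. ?sq F z \<partial>lborel)"
      by (intro nn_integral_cong) (simp add: G_def indicator_def)
    finally show "slab_norm j (G \<alpha>) \<le> L2_norm_on (UNIV \<times> unit_cube \<alpha>) F"
      by (simp only: L2_norm_on_eq)
  qed
  also have "\<dots> \<le> (\<Sum>\<^sub>\<infinity>\<alpha>\<in>UNIV. L2_norm_on (UNIV \<times> unit_cube \<alpha>) F)"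
    by (rule nn_integral_count_space_le_infsum)
  finally show ?thesis .
qed

section \<open>The estimate on each half-line of time\<close>

lemma L2_norm_on_damped_le:
  fixes F :: "real \<times> (real ^ 'n::finite) \<Rightarrow> complex"
  assumes [measurable]: "F \<in> borel_measurable borel" "Q \<in> sets borel"
    and sg: "\<sigma> = 1 \<or> \<sigma> = - 1" and d: "0 \<le> \<delta>"
  shows "L2_norm_on (UNIV \<times> Q) (damped \<sigma> \<delta> F) \<le> L2_norm_on (UNIV \<times> Q) F"
  unfolding L2_norm_on_eq
proof (rule esqrt_mono)
  have "(\<integral>\<^sup>+z\<in>UNIV \<times> Q. ennreal ((cmod (damped \<sigma> \<delta> F z))\<^sup>2) \<partial>lborel) \<le>
    (\<integral>\<^sup>+z. ennreal ((cmod (F (\<sigma> * fst z, snd z)))\<^sup>2) * indicator (UNIV \<times> Q) (\<sigma> * fst z, snd z) \<partial>lborel)"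
    by (intro nn_integral_mono mult_mono ennreal_leI power_mono norm_damped_le d) (auto simp: indicator_def)
  also have "\<dots> = (\<integral>\<^sup>+z. ennreal ((cmod (F z))\<^sup>2) * indicator (UNIV \<times> Q) z \<partial>lborel)"
    by (rule nn_integral_time_reflection[OF _ sg, of "\<lambda>z. ennreal ((cmod (F z))\<^sup>2) * indicator (UNIV \<times> Q) z"]) measurable
  finally show "(\<integral>\<^sup>+z\<in>UNIV \<times> Q. ennreal ((cmod (damped \<sigma> \<delta> F z))\<^sup>2) \<partial>lborel) \<le>
    (\<integral>\<^sup>+z\<in>UNIV \<times> Q. ennreal ((cmod (F z))\<^sup>2) \<partial>lborel)" .
qed

lemma infsum_mono_ennreal:
  fixes f g :: "'a \<Rightarrow> ennreal"
  assumes "\<And>x. f x \<le> g x"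
  shows "(\<Sum>\<^sub>\<infinity>x\<in>A. f x) \<le> (\<Sum>\<^sub>\<infinity>x\<in>A. g x)"
  using assms by (intro infsum_mono nonneg_summable_on_complete) auto

text \<open>With \<open>\<delta> = 1 / T\<close> the damping costs at most the factor \<open>e\<close> on \<open>(0, T]\<close>, uniformly in \<open>T\<close>.\<close>

lemma half_line_estimate:
  fixes u F :: "real \<times> (real ^ 'n::finite) \<Rightarrow> complex" and i1 i2 i3 :: 'n
  assumes e: "0 \<le> \<epsilon>" and sol: "cauchy_solution \<epsilon> F u" and F: "schwartz F"
    and sg: "\<sigma> = 1 \<or> \<sigma> = - 1" and T: "0 < T"
  defines "P \<equiv> \<lambda>z. iter_deriv (map space_dir [i1, i2, i3]) u (\<sigma> * fst z, snd z)"
  shows "esqrt (\<integral>\<^sup>+z. ennreal ((cmod (P z))\<^sup>2) * indicator ({0<..T} \<times> unit_cube \<alpha>) z \<partial>lborel) \<le>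
    ennreal (exp 1 * CARD('n) * (162 * pi * (2 * pi) ^ CARD('n))) *
      (\<Sum>\<^sub>\<infinity>\<alpha>\<in>(UNIV :: (int ^ 'n) set). L2_norm_on (UNIV \<times> unit_cube \<alpha>) F)"
proof -
  let ?bs = "map space_dir [i1, i2, i3]"
  let ?C = "162 * pi * (2 * pi) ^ CARD('n)"
  define S where "S = (\<Sum>\<^sub>\<infinity>\<alpha>\<in>(UNIV :: (int ^ 'n) set). L2_norm_on (UNIV \<times> unit_cube \<alpha>) F)"
  define R where "R = {0<..T} \<times> unit_cube \<alpha>"
  \<comment> \<open>The test function of the duality argument is the quantity to be estimated,
    restricted to a bounded region so that its norm is known to be finite.\<close>
  define g where "g z = indicator R z * P z" for z
  define \<delta> where "\<delta> = 1 / T"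
  have d: "0 < \<delta>" using T by (simp add: \<delta>_def)
  have u: "schwartz_in_space u" using sol by (simp add: cauchy_solution_def)
  have [measurable]: "R \<in> sets borel"
    unfolding R_def by (simp add: borel_prod[symmetric])
  have R_fin: "emeasure lborel R < \<infinity>"
    unfolding R_def by (intro emeasure_bounded_finite bounded_Times bounded_unit_cube) simp
  have P_meas [measurable]: "P \<in> borel_measurable borel"
  proof -
    have [measurable]: "iter_deriv ?bs u \<in> borel_measurable borel"
      by (intro borel_measurable_continuous_onI smooth_continuous smooth_u u set_space_dirs)
    show ?thesis unfolding P_def by measurable
  qed
  have g_meas [measurable]: "g \<in> borel_measurable borel"
    unfolding g_def by measurable
  have F_meas [measurable]: "F \<in> borel_measurable borel"
    using schwartz_integrable[OF F, of "[]"] by auto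
  obtain A where A: "\<And>t x. \<bar>t\<bar> \<le> T \<Longrightarrow> cmod (iter_deriv ?bs u (t, x)) \<le> A * decay x"
    using schwartz_in_space_decay[OF u set_space_dirs] by blast
  have "0 \<le> A * decay (0 :: real ^ 'n)" using order_trans[OF norm_ge_zero A[of 0 0]] T by simp
  then have A0: "0 \<le> A" by (simp add: decay_def)
  have g_bd: "cmod (g (t, x)) \<le> A * decay x * indicator R (t, x)" for t x
    using A[of "\<sigma> * t" x] sg by (auto simp: g_def P_def R_def indicator_def)
  have g_bd': "cmod (g z) \<le> A * indicator R z" for z
  proof (cases z)
    case (Pair t x)
    have "A * decay x * indicator R (t, x) \<le> A * 1 * indicator R (t, x)"
      by (intro mult_right_mono mult_left_mono decay_le_1 A0) simp
    then show ?thesis using g_bd[of t x] Pair by simp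
  qed
  have gi: "integrable lborel g"
  proof (rule Bochner_Integration.integrable_bound)
    show "integrable lborel (\<lambda>z. A * indicator R z :: real)"
      using R_fin by (intro integrable_mult_right integrable_real_indicator) auto
    show "AE z in lborel. norm (g z) \<le> norm (A * indicator R z)"
      using order_trans[OF g_bd' abs_ge_self] by auto
  qed simp
  have "cmod (g z) \<le> A" for z
    using order_trans[OF g_bd'[of z], of A] A0 by (simp add: indicator_def)
  then have g_sq: "(\<integral>\<^sup>+z. ennreal ((cmod (g z))\<^sup>2) \<partial>lborel) < \<infinity>"
    by (rule integrable_bounded_square[OF gi])
  define N where "N = esqrt (\<integral>\<^sup>+z. ennreal ((cmod (g z))\<^sup>2) \<partial>lborel)"
  have N2: "N\<^sup>2 = (\<integral>\<^sup>+z. ennreal ((cmod (g z))\<^sup>2) \<partial>lborel)"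
    by (simp add: N_def esqrt_power2)
  have N_fin: "N < \<infinity>" using g_sq by (simp add: N_def esqrt_def)
  let ?e = "\<lambda>t. if 0 < t then exp (- (\<delta> * t)) else 0 :: real"
  define J where "J = (LINT t|lborel. LINT x|lborel. of_real (?e t) * (P (t, x) * cnj (g (t, x))))"
  have J_eq: "J = - \<i> * of_real \<sigma> / (2 * pi) ^ (CARD('n) + 1) *
      (LINT z|lborel. symbol \<epsilon> \<sigma> \<delta> i1 i2 i3 z * (ft (damped \<sigma> \<delta> F) z * cnj (ft g z)))"
    unfolding J_def P_def
  proof (rule pairing_identity[OF sol F sg d T g_meas _ gi])
    show "cmod (g z) \<le> (if 0 < fst z \<and> fst z \<le> T then cmod (iter_deriv ?bs u (\<sigma> * fst z, snd z)) else 0)" for z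
      by (auto simp: g_def P_def R_def indicator_def)
    show "(LINT x|lborel. cmod (g (t, x))) \<le> (LINT x|lborel. A * decay (x :: real ^ 'n))" for t
    proof (rule Bochner_Integration.integral_mono')
      show "integrable lborel (\<lambda>x::real ^ 'n. A * decay x)"
        by (intro integrable_mult_right integrable_decay)
      show nn: "0 \<le> A * decay x" for x :: "real ^ 'n"
        using A0 decay_pos[of x] by simp
      show "cmod (g (t, x)) \<le> A * decay x" for x
        using g_bd[of t x] nn[of x] by (cases "(t, x) \<in> R") auto
    qed
  qed
  have iF: "integrable lborel (damped \<sigma> \<delta> F)"
    using schwartz_integrable[OF F, of "[]"] d by (intro integrable_damped sg) auto
  have "ennreal (cmod J) \<le> ennreal (cmod (LINT z|lborel. symbol \<epsilon> \<sigma> \<delta> i1 i2 i3 z * (ft (damped \<sigma> \<delta> F) z * cnj (ft g z))))"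
  proof (rule ennreal_leI)
    \<comment> \<open>The favourable factor from Parseval is simply discarded.\<close>
    have "1 \<le> (2 * pi) ^ (CARD('n) + 1)"
      using pi_ge_two by (intro one_le_power) simp
    then have "cmod (- \<i> * of_real \<sigma> / (2 * pi) ^ (CARD('n) + 1)) \<le> 1"
      using sg by (auto simp: norm_divide norm_mult norm_power divide_le_eq_1)
    then show "cmod J \<le> cmod (LINT z|lborel. symbol \<epsilon> \<sigma> \<delta> i1 i2 i3 z * (ft (damped \<sigma> \<delta> F) z * cnj (ft g z)))"
      unfolding J_eq norm_mult[of "_ / _"] by (intro mult_left_le_one_le) auto
  qed
  also have "\<dots> \<le> (\<Sum>j\<in>UNIV. ennreal ?C * slab_norm j (damped \<sigma> \<delta> F) * slab_norm j g)"
    by (rule symbol_estimate[OF e sg d iF gi integrable_symbol_mult[OF F sg d gi g_sq]])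
  \<comment> \<open>The two mixed norms are treated asymmetrically: the source is spread over all
    cubes and yields their sum \<open>S\<close>, whereas \<open>g\<close> lives over one cube and
    yields its plain L^2 norm. The bound is the same for each \<open>j\<close>, hence the factor
    \<open>CARD('n)\<close>.\<close>
  also have "\<dots> \<le> (\<Sum>j\<in>(UNIV :: 'n set). ennreal ?C * S * N)"
  proof (intro sum_mono mult_mono)
    fix j :: 'n
    have "slab_norm j (damped \<sigma> \<delta> F) \<le> (\<Sum>\<^sub>\<infinity>\<alpha>\<in>(UNIV :: (int ^ 'n) set). L2_norm_on (UNIV \<times> unit_cube \<alpha>) (damped \<sigma> \<delta> F))"
      by (rule slab_norm_le_infsum) measurable
    also have "\<dots> \<le> S"
      unfolding S_def using d by (intro infsum_mono_ennreal L2_norm_on_damped_le sg) auto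
    finally show "slab_norm j (damped \<sigma> \<delta> F) \<le> S" .
    show "slab_norm j g \<le> N"
      unfolding N_def
    proof (rule slab_norm_le_of_support)
      fix z assume "g z \<noteq> 0"
      then have "snd z \<in> unit_cube \<alpha>"
        by (auto simp: g_def R_def indicator_def split: if_splits)
      then show "snd z $ j - of_int (\<alpha> $ j) \<in> {-1/2..<1/2}"
        unfolding unit_cube_def by blast
    qed measurable
  qed auto
  also have "\<dots> = ennreal (CARD('n) * ?C) * S * N"
    by (simp add: ennreal_mult ennreal_of_nat_eq_real_of_nat mult.assoc)
  finally have J_le: "ennreal (cmod J) \<le> ennreal (CARD('n) * ?C) * S * N" .
  have "ennreal (exp (- 1)) * N\<^sup>2 \<le> ennreal (cmod J)"
  proof -
    let ?h = "\<lambda>z. ?e (fst z) * (cmod (g z))\<^sup>2"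
    have h_meas: "?h \<in> borel_measurable borel" by measurable
    have h_int: "integrable lborel ?h"
    proof (rule Bochner_Integration.integrable_bound)
      have "integrable lborel (\<lambda>z. g z * cnj (g z))"
        using g_sq by (intro integrable_mult_of_squares) auto
      then show "integrable lborel (\<lambda>z. cmod (g z * cnj (g z)))" by simp
      show "AE z in lborel. norm (?h z) \<le> norm (cmod (g z * cnj (g z)))"
        using d by (auto simp: norm_mult power2_eq_square intro!: mult_left_le_one_le)
    qed (use h_meas in simp)
    \<comment> \<open>On \<open>R\<close> the test function agrees with \<open>P\<close>, and
      elsewhere it is 0; so the pairing integrates a nonnegative weight against |g|^2 and nothing is
      lost in passing to \<open>cmod J\<close>.\<close>
    have h_eq: "of_real (?e t) * (P (t, x) * cnj (g (t, x))) = complex_of_real (?h (t, x))" for t x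
    proof -
      have "P (t, x) * cnj (g (t, x)) = complex_of_real ((cmod (g (t, x)))\<^sup>2)"
        by (simp add: g_def indicator_def complex_norm_square del: of_real_power)
      then show ?thesis by simp
    qed
    have "J = (LINT t|lborel. LINT x|lborel. complex_of_real (?h (t, x)))"
      unfolding J_def h_eq ..
    also have "\<dots> = (LINT z|(lborel \<Otimes>\<^sub>M lborel). complex_of_real (?h z))"
      using h_int by (intro lborel_pair.integral_fst') (simp only: lborel_prod complex_of_real_integrable_eq)
    also have "\<dots> = of_real (LINT z|lborel. ?h z)"
      by (simp only: lborel_prod integral_complex_of_real)
    finally have "cmod J = (LINT z|lborel. ?h z)"
      by (simp add: integral_nonneg_AE)
    then have "ennreal (cmod J) = (\<integral>\<^sup>+z. ennreal (?h z) \<partial>lborel)"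
      using nn_integral_eq_integral[OF h_int] by simp
    moreover have "ennreal (exp (- 1)) * N\<^sup>2 = (\<integral>\<^sup>+z. ennreal (exp (- 1)) * ennreal ((cmod (g z))\<^sup>2) \<partial>lborel)"
      unfolding N2 by (rule nn_integral_cmult[symmetric]) measurable
    moreover have "\<dots> \<le> (\<integral>\<^sup>+z. ennreal (?h z) \<partial>lborel)"
    proof (rule nn_integral_mono)
      fix z
      have "exp (- 1) * (cmod (g z))\<^sup>2 \<le> ?h z"
      proof (cases "z \<in> R")
        case True
        then have z: "0 < fst z" "fst z \<le> T" by (auto simp: R_def)
        then have "\<delta> * fst z \<le> 1" using T by (simp add: \<delta>_def divide_le_eq)
        then have "exp (- 1) \<le> exp (- (\<delta> * fst z))" by simp
        with z show ?thesis by (simp add: mult_right_mono)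
      qed (simp add: g_def)
      then show "ennreal (exp (- 1)) * ennreal ((cmod (g z))\<^sup>2) \<le> ennreal (?h z)"
        by (simp add: ennreal_mult'[symmetric] ennreal_leI del: exp_le_one_iff)
    qed
    ultimately show ?thesis by simp
  qed
  with J_le have "ennreal (exp (- 1)) * N\<^sup>2 \<le> ennreal (CARD('n) * ?C) * S * N"
    by (rule order_trans[rotated])
  then have "ennreal (exp 1) * (ennreal (exp (- 1)) * N\<^sup>2) \<le> ennreal (exp 1) * (ennreal (CARD('n) * ?C) * S * N)"
    by (intro mult_left_mono) auto
  moreover have "ennreal (exp 1) * (ennreal (exp (- 1)) * N\<^sup>2) = N * N"
    by (simp add: mult.assoc[symmetric] ennreal_mult[symmetric] power2_eq_square flip: exp_add)
  moreover have "ennreal (exp 1) * (ennreal (CARD('n) * ?C) * S * N) = N * (ennreal (exp 1 * CARD('n) * ?C) * S)"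
    by (simp add: ennreal_mult mult_ac)
  ultimately have "N * N \<le> N * (ennreal (exp 1 * CARD('n) * ?C) * S)" by simp
  \<comment> \<open>Cancelling one \<open>N\<close> is legitimate in \<open>ennreal\<close> only for
    0 < N < \<infinity>; the case N = 0 is trivial.\<close>
  then have "N \<le> ennreal (exp 1 * CARD('n) * ?C) * S"
    using N_fin by (cases "N = 0") (auto simp: ennreal_mult_le_mult_iff)
  moreover have "N = esqrt (\<integral>\<^sup>+z. ennreal ((cmod (P z))\<^sup>2) * indicator ({0<..T} \<times> unit_cube \<alpha>) z \<partial>lborel)"
    unfolding N_def R_def[symmetric]
    by (intro arg_cong[where f=esqrt] nn_integral_cong) (simp add: g_def indicator_def)
  ultimately show ?thesis unfolding S_def by simp
qed

text \<open>The bound of \<open>half_line_estimate\<close> is free of T, so Fatou's lemma lets T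
  tend to infinity. It is stated for the squared norm so that the two half-lines can be
  added.\<close>

lemma half_space_estimate:
  fixes u F :: "real \<times> (real ^ 'n::finite) \<Rightarrow> complex" and i1 i2 i3 :: 'n
  assumes e: "0 \<le> \<epsilon>" and sol: "cauchy_solution \<epsilon> F u" and F: "schwartz F"
    and sg: "\<sigma> = 1 \<or> \<sigma> = - 1"
  defines "D \<equiv> iter_deriv (map space_dir [i1, i2, i3]) u"
  shows "(\<integral>\<^sup>+z. ennreal ((cmod (D z))\<^sup>2) * indicator {z. 0 < \<sigma> * fst z \<and> snd z \<in> unit_cube \<alpha>} z \<partial>lborel) \<le>
    (ennreal (exp 1 * CARD('n) * (162 * pi * (2 * pi) ^ CARD('n))) *
      (\<Sum>\<^sub>\<infinity>\<alpha>\<in>(UNIV :: (int ^ 'n) set). L2_norm_on (UNIV \<times> unit_cube \<alpha>) F))\<^sup>2"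
proof -
  have u: "schwartz_in_space u" using sol by (simp add: cauchy_solution_def)
  have [measurable]: "D \<in> borel_measurable borel"
    unfolding D_def by (intro borel_measurable_continuous_onI smooth_continuous smooth_u u set_space_dirs)
  have [measurable]: "{0<..T} \<times> unit_cube \<alpha> \<in> sets borel" for T :: real
    by (simp add: borel_prod[symmetric])
  have [measurable]: "{z :: real \<times> (real ^ 'n). 0 < \<sigma> * fst z \<and> snd z \<in> unit_cube \<alpha>} \<in> sets borel"
  proof -
    have "{z :: real \<times> (real ^ 'n). 0 < \<sigma> * fst z \<and> snd z \<in> unit_cube \<alpha>} =
       (\<lambda>z. \<sigma> * fst z) -` {0<..} \<inter> (UNIV \<times> unit_cube \<alpha>)" by auto
    also have "\<dots> \<in> sets borel"
      by (intro sets.Int time_cylinder_borel unit_cube_borel measurable_sets_borel[of _ borel]) measurable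
    finally show ?thesis .
  qed
  let ?f = "\<lambda>z. ennreal ((cmod (D z))\<^sup>2) * indicator {z. 0 < \<sigma> * fst z \<and> snd z \<in> unit_cube \<alpha>} z"
  have "(\<integral>\<^sup>+z. ?f z \<partial>lborel) = (\<integral>\<^sup>+z. ?f (\<sigma> * fst z, snd z) \<partial>lborel)"
    by (rule nn_integral_time_reflection[of ?f, OF _ sg, symmetric]) measurable
  also have "\<dots> = (\<integral>\<^sup>+z. ennreal ((cmod (D (\<sigma> * fst z, snd z)))\<^sup>2) * indicator ({0<..} \<times> unit_cube \<alpha>) z \<partial>lborel)"
    using sg by (intro nn_integral_cong) (auto simp: indicator_def)
  also have "\<dots> \<le> (ennreal (exp 1 * CARD('n) * (162 * pi * (2 * pi) ^ CARD('n))) *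
      (\<Sum>\<^sub>\<infinity>\<alpha>\<in>(UNIV :: (int ^ 'n) set). L2_norm_on (UNIV \<times> unit_cube \<alpha>) F))\<^sup>2"
  proof (rule nn_integral_le_of_tendsto)
    show "(\<lambda>z. ennreal ((cmod (D (\<sigma> * fst z, snd z)))\<^sup>2) * indicator ({0<..real (Suc m)} \<times> unit_cube \<alpha>) z) \<in> borel_measurable lborel" for m
      by measurable
    show "(\<lambda>m. ennreal ((cmod (D (\<sigma> * fst z, snd z)))\<^sup>2) * indicator ({0<..real (Suc m)} \<times> unit_cube \<alpha>) z)
      \<longlonglongrightarrow> ennreal ((cmod (D (\<sigma> * fst z, snd z)))\<^sup>2) * indicator ({0<..} \<times> unit_cube \<alpha>) z" for z
    proof (rule tendsto_eventually)
      obtain M :: nat where "fst z \<le> real M" using real_arch_simple by blast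
      then have "fst z \<le> real (Suc m)" if "M \<le> m" for m using that by simp
      then show "\<forall>\<^sub>F m in sequentially. ennreal ((cmod (D (\<sigma> * fst z, snd z)))\<^sup>2) * indicator ({0<..real (Suc m)} \<times> unit_cube \<alpha>) z
        = ennreal ((cmod (D (\<sigma> * fst z, snd z)))\<^sup>2) * indicator ({0<..} \<times> unit_cube \<alpha>) z"
        by (intro eventually_sequentiallyI[of M]) (auto simp: indicator_def mem_Times_iff)
    qed
    show "(\<integral>\<^sup>+z. ennreal ((cmod (D (\<sigma> * fst z, snd z)))\<^sup>2) * indicator ({0<..real (Suc m)} \<times> unit_cube \<alpha>) z \<partial>lborel) \<le>
      (ennreal (exp 1 * CARD('n) * (162 * pi * (2 * pi) ^ CARD('n))) *
      (\<Sum>\<^sub>\<infinity>\<alpha>\<in>(UNIV :: (int ^ 'n) set). L2_norm_on (UNIV \<times> unit_cube \<alpha>) F))\<^sup>2" for m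
      using power_mono[OF half_line_estimate[OF e sol F sg, of "real (Suc m)" i1 i2 i3 \<alpha>], of 2]
      by (simp add: esqrt_power2 D_def)
  qed
  finally show ?thesis .
qed

text \<open>Whichever list the choice operator selects, its length is the sum of its multiplicities,
  hence 3. As the estimates hold for arbitrary \<open>i1 i2 i3\<close>, the chosen order of
  differentiation is harmless.\<close>

lemma spatial_deriv_order_3:
  fixes \<nu> :: "'n::finite \<Rightarrow> nat"
  assumes "(\<Sum>i\<in>UNIV. \<nu> i) = 3"
  obtains i1 i2 i3 where "\<And>u. spatial_deriv \<nu> u = iter_deriv (map space_dir [i1, i2, i3]) u"
proof -
  define ks where "ks = (SOME is. \<forall>i. count_list is i = \<nu> i)"
  \<comment> \<open>A witness for the choice operator: any enumeration of the multiset with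
    multiplicities \<open>\<nu>\<close>.\<close>
  obtain js :: "'n list" where js: "mset js = (\<Sum>i\<in>UNIV. replicate_mset (\<nu> i) i)"
    using ex_mset by blast
  have "count_list js i = \<nu> i" for i
    unfolding count_mset[symmetric] js by (simp add: count_sum)
  then have "\<exists>js. \<forall>i. count_list js i = \<nu> i" by blast
  from someI_ex[OF this] have cnt: "count_list ks i = \<nu> i" for i
    unfolding ks_def by blast
  have "length ks = (\<Sum>i\<in>set ks. count_list ks i)"
    by (rule sum_count_set[symmetric]) auto
  also have "\<dots> = (\<Sum>i\<in>UNIV. count_list ks i)"
    by (rule sum.mono_neutral_left) (auto simp: count_list_0_iff)
  finally have "length ks = 3" using assms by (simp add: cnt)
  then obtain i1 i2 i3 where "ks = [i1, i2, i3]"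
    by (auto simp: length_Suc_conv numeral_3_eq_3)
  then show ?thesis
    using that unfolding spatial_deriv_def ks_def by metis
qed

theorem proposition3p8:
  fixes \<epsilon> :: real
  assumes "\<epsilon> \<in> {0, 1}"
  shows "\<exists>C::real. C > 0 \<and>
    (\<forall>(\<nu> :: 'n::finite \<Rightarrow> nat) (F :: real \<times> (real ^ 'n) \<Rightarrow> complex) (u :: real \<times> (real ^ 'n) \<Rightarrow> complex).
      (\<Sum>i\<in>UNIV. \<nu> i) = 3 \<longrightarrow> schwartz F \<longrightarrow> cauchy_solution \<epsilon> F u \<longrightarrow>
      (SUP \<alpha>\<in>(UNIV :: (int ^ 'n) set). L2_norm_on (UNIV \<times> unit_cube \<alpha>) (spatial_deriv \<nu> u))
        \<le> ennreal C * (\<Sum>\<^sub>\<infinity>\<alpha>\<in>(UNIV :: (int ^ 'n) set). L2_norm_on (UNIV \<times> unit_cube \<alpha>) F))"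
proof -
  \<comment> \<open>The factor e is the cost of damping, \<open>CARD('n)\<close> counts the
    directions j, and the rest is the constant of \<open>directional_estimate\<close>.\<close>
  define K where "K = exp 1 * CARD('n) * (162 * pi * (2 * pi) ^ CARD('n))"
  have K: "0 < K" by (simp add: K_def)
  have e: "0 \<le> \<epsilon>" using assms by auto
  have main: "L2_norm_on (UNIV \<times> unit_cube \<alpha>) (spatial_deriv \<nu> u) \<le>
      ennreal (2 * K) * (\<Sum>\<^sub>\<infinity>\<alpha>\<in>(UNIV :: (int ^ 'n) set). L2_norm_on (UNIV \<times> unit_cube \<alpha>) F)"
    if \<nu>: "(\<Sum>i\<in>UNIV. \<nu> i) = 3" and F: "schwartz F" and sol: "cauchy_solution \<epsilon> F u"
    for \<nu> :: "'n \<Rightarrow> nat" and F u :: "real \<times> (real ^ 'n) \<Rightarrow> complex" and \<alpha> :: "int ^ 'n"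
  proof -
    let ?S = "\<Sum>\<^sub>\<infinity>\<alpha>\<in>(UNIV :: (int ^ 'n) set). L2_norm_on (UNIV \<times> unit_cube \<alpha>) F"
    obtain i1 i2 i3 where D: "spatial_deriv \<nu> u = iter_deriv (map space_dir [i1, i2, i3]) u"
      using spatial_deriv_order_3[OF \<nu>] by metis
    let ?D = "spatial_deriv \<nu> u"
    let ?f = "\<lambda>\<sigma> z. ennreal ((cmod (?D z))\<^sup>2) * indicator {z. 0 < \<sigma> * fst z \<and> snd z \<in> unit_cube \<alpha>} z"
    have u: "schwartz_in_space u" using sol by (simp add: cauchy_solution_def)
    have [measurable]: "?D \<in> borel_measurable borel"
      unfolding D by (intro borel_measurable_continuous_onI smooth_continuous smooth_u u set_space_dirs)
    have [measurable]: "{z :: real \<times> (real ^ 'n). 0 < \<sigma> * fst z \<and> snd z \<in> unit_cube \<alpha>} \<in> sets borel" for \<sigma>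
    proof -
      have "{z :: real \<times> (real ^ 'n). 0 < \<sigma> * fst z \<and> snd z \<in> unit_cube \<alpha>} =
         (\<lambda>z. \<sigma> * fst z) -` {0<..} \<inter> (UNIV \<times> unit_cube \<alpha>)" by auto
      also have "\<dots> \<in> sets borel"
        by (intro sets.Int time_cylinder_borel unit_cube_borel measurable_sets_borel[of _ borel]) measurable
      finally show ?thesis .
    qed
    \<comment> \<open>The hyperplane t = 0, missed by both open half-spaces, is a null set.\<close>
    have "time_dir \<in> (Basis :: (real \<times> (real ^ 'n)) set)" by (rule space_time_Basis)
    from AE_lborel_inner_neq[OF this, of 0]
    have "AE z :: real \<times> (real ^ 'n) in lborel. fst z \<noteq> 0"
      by eventually_elim (auto simp: inner_prod_def)
    then have "AE z in lborel. ennreal ((cmod (?D z))\<^sup>2) * indicator (UNIV \<times> unit_cube \<alpha>) z \<le> ?f 1 z + ?f (- 1) z"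
      by eventually_elim (auto simp: indicator_def)
    then have "(\<integral>\<^sup>+z\<in>UNIV \<times> unit_cube \<alpha>. ennreal ((cmod (?D z))\<^sup>2) \<partial>lborel) \<le> (\<integral>\<^sup>+z. ?f 1 z + ?f (- 1) z \<partial>lborel)"
      by (rule nn_integral_mono_AE)
    also have "\<dots> = (\<integral>\<^sup>+z. ?f 1 z \<partial>lborel) + (\<integral>\<^sup>+z. ?f (- 1) z \<partial>lborel)"
      by (rule nn_integral_add) measurable
    also have "\<dots> \<le> (ennreal K * ?S)\<^sup>2 + (ennreal K * ?S)\<^sup>2"
      unfolding D K_def by (intro add_mono half_space_estimate[OF e sol F]) auto
    also have "\<dots> \<le> (ennreal (2 * K) * ?S)\<^sup>2"
    proof -
      \<comment> \<open>The crude factor 2 instead of the square root of 2 avoids an irrational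
        constant.\<close>
      have "x\<^sup>2 + x\<^sup>2 \<le> (2 * x)\<^sup>2" for x :: ennreal
      proof -
        have "x\<^sup>2 + x\<^sup>2 = 2 * x\<^sup>2" by (simp add: mult_2)
        also have "\<dots> \<le> 4 * x\<^sup>2" by (intro mult_right_mono) auto
        finally show ?thesis by (simp add: power_mult_distrib)
      qed
      from this[of "ennreal K * ?S"] K show ?thesis
        by (simp add: ennreal_mult mult.assoc)
    qed
    finally have "L2_norm_on (UNIV \<times> unit_cube \<alpha>) ?D \<le> esqrt ((ennreal (2 * K) * ?S)\<^sup>2)"
      unfolding L2_norm_on_eq[of _ ?D] by (rule esqrt_mono)
    then show ?thesis by (simp only: esqrt_of_power2)
  qed
  show ?thesis
    using K main by (intro exI[of _ "2 * K"]) (auto intro!: SUP_least)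
qed

end
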